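(* Let $1\leq l,l'<n$ and $r,r'\in\mathbb{Z}_n$. Assume that $l+l'\leq n$, and let $l_1=\min\{l,l'\}$. Then, as $H_n(1,q)$-modules, $$V(l,r)\otimes P(l',r')\cong\Big(\bigoplus_{i=0}^{l_1-1}P(l+l'-1-2i,\,r+r'+i)\Big)\oplus\Big(\bigoplus_{c(l+l'-1)\leq i\leq l-1}2P(n+l+l'-1-2i,\,r+r'+i)\Big).$$
   Context: Setting: $k$ is an algebraically closed field, $n>2$ is a fixed integer, $q\in k$ is a primitive $n$-th root of unity, $\mathbb{Z}_n=\mathbb{Z}/n\mathbb{Z}$, and $(i)_q=1+q+\cdots+q^{i-1}$. $H_n(1,q)$ is the Hopf algebra over $k$ (isomorphic to the Drinfeld double of the Taft algebra $H_n(q)$) generated as an algebra by $a,b,c,d$ with relations $ba=qab$, $db=qbd$, $ca=qac$, $dc=qcd$, $bc=cb$, $a^n=0$, $b^n=1$, $c^n=1$, $d^n=0$, $da-qad=1-bc$, with comultiplication $\Delta(a)=a\otimes b+1\otimes a$, $\Delta(b)=b\otimes b$, $\Delta(c)=c\otimes c$, $\Delta(d)=d\otimes c+1\otimes d$, counit $\varepsilon(a)=\varepsilon(d)=0$, $\varepsilon(b)=\varepsilon(c)=1$, and antipode $S(a)=-ab^{-1}$, $S(b)=b^{-1}$, $S(c)=c^{-1}$, $S(d)=-dc^{-1}$. All modules are finite-dimensional left $H_n(1,q)$-modules, $\otimes=\otimes_k$ with action through $\Delta$, and $sM$ is the direct sum of $s$ copies of $M$ ($sM=0$ if $s=0$).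 Simple modules: for $1\leq l\leq n$, $r\in\mathbb{Z}_n$, $V(l,r)$ has basis $v_1,\dots,v_l$ with $av_i=v_{i+1}$ for $i<l$, $av_l=0$, $bv_i=q^{r+i-1}v_i$, $cv_i=q^{i-r-l}v_i$, $dv_1=0$, $dv_i=\alpha_{i-1}(l)v_{i-1}$ for $1<i\leq l$, where $\alpha_i(l)=(i)_q(1-q^{i-l})$. For $1\leq l<n$, $P(l,r)$ is the projective cover of $V(l,r)$, and $P(n,r)=V(n,r)$ (which is projective). Conventions: integers in the second argument of $V$ and $P$ are read modulo $n$; $c(t)=\lfloor (t+1)/2\rfloor$ for $t\in\mathbb{Z}$ (the function $c(\cdot)$ is not to be confused with the generator $c$); a direct sum over an empty range of indices is zero. *)

theory Defs
  imports Complex_Main "HOL-Computational_Algebra.Polynomial" "Jordan_Normal_Form.Matrix"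
begin

definition primitive_root_of_unity :: "nat \<Rightarrow> 'k::field \<Rightarrow> bool" where
  "primitive_root_of_unity n q \<longleftrightarrow> n > 0 \<and> q ^ n = 1 \<and> (\<forall>m. 0 < m \<and> m < n \<longrightarrow> q ^ m \<noteq> 1)"


text \<open>
  The algebra H_n(1,q) is presented by the generators a, b, c, d and their relations, so a left
  module on the coordinate space k^m is the same thing as four m x m matrices that satisfy these
  relations.  Every finite-dimensional module is isomorphic to one on a coordinate space, and all
  notions below (homomorphism, projectivity, tensor product, ...) are those of this category.
  Matrices act on column vectors, so column j of a matrix is the image of the basis vector j.
\<close>

record 'k hmod =
  hdim :: nat
  act_a :: "'k mat"
  act_b :: "'k mat"
  act_c :: "'k mat"
  act_d :: "'k mat"

definition H_module :: "nat \<Rightarrow> 'k::field \<Rightarrow> 'k hmod \<Rightarrow> bool" where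
  "H_module n q M \<longleftrightarrow>
    (let m = hdim M; a = act_a M; b = act_b M; c = act_c M; d = act_d M in
      a \<in> carrier_mat m m \<and> b \<in> carrier_mat m m \<and> c \<in> carrier_mat m m \<and> d \<in> carrier_mat m m \<and>
      b * a = q \<cdot>\<^sub>m (a * b) \<and> d * b = q \<cdot>\<^sub>m (b * d) \<and>
      c * a = q \<cdot>\<^sub>m (a * c) \<and> d * c = q \<cdot>\<^sub>m (c * d) \<and>
      b * c = c * b \<and>
      a ^\<^sub>m n = 0\<^sub>m m m \<and> b ^\<^sub>m n = 1\<^sub>m m \<and> c ^\<^sub>m n = 1\<^sub>m m \<and> d ^\<^sub>m n = 0\<^sub>m m m \<and>
      d * a - q \<cdot>\<^sub>m (a * d) = 1\<^sub>m m - b * c)"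

definition H_hom :: "'k::field hmod \<Rightarrow> 'k hmod \<Rightarrow> 'k mat set" where
  "H_hom M N = {F \<in> carrier_mat (hdim N) (hdim M).
     F * act_a M = act_a N * F \<and> F * act_b M = act_b N * F \<and>
     F * act_c M = act_c N * F \<and> F * act_d M = act_d N * F}"

definition H_epi :: "'k::field hmod \<Rightarrow> 'k hmod \<Rightarrow> 'k mat set" where
  "H_epi M N = {F \<in> H_hom M N.
     (\<lambda>v. F *\<^sub>v v) ` carrier_vec (hdim M) = carrier_vec (hdim N)}"

definition H_iso :: "nat \<Rightarrow> 'k::field \<Rightarrow> 'k hmod \<Rightarrow> 'k hmod \<Rightarrow> bool" where
  "H_iso n q M N \<longleftrightarrow> H_module n q M \<and> H_module n q N \<and>
     (\<exists>F \<in> H_hom M N. \<exists>G \<in> H_hom N M. G * F = 1\<^sub>m (hdim M) \<and> F * G = 1\<^sub>m (hdim N))"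


definition H_projective :: "nat \<Rightarrow> 'k::field \<Rightarrow> 'k hmod \<Rightarrow> bool" where
  "H_projective n q P \<longleftrightarrow> H_module n q P \<and>
     (\<forall>M N. H_module n q M \<longrightarrow> H_module n q N \<longrightarrow>
        (\<forall>F \<in> H_epi M N. \<forall>G \<in> H_hom P N. \<exists>L \<in> H_hom P M. F * L = G))"

text \<open>
  A projective cover of V is a projective module P with an essential epimorphism from P to V:
  a homomorphism into P is surjective as soon as its composite with the epimorphism is.
\<close>

definition H_projective_cover :: "nat \<Rightarrow> 'k::field \<Rightarrow> 'k hmod \<Rightarrow> 'k hmod \<Rightarrow> bool" where
  "H_projective_cover n q P V \<longleftrightarrow> H_module n q V \<and> H_projective n q P \<and>
     (\<exists>E \<in> H_epi P V. \<forall>X. H_module n q X \<longrightarrow>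
        (\<forall>G \<in> H_hom X P. E * G \<in> H_epi X V \<longrightarrow> G \<in> H_epi X P))"


definition H_dsum :: "'k::field hmod list \<Rightarrow> 'k hmod" where
  "H_dsum Ms = \<lparr> hdim = sum_list (map hdim Ms),
     act_a = diag_block_mat (map act_a Ms), act_b = diag_block_mat (map act_b Ms),
     act_c = diag_block_mat (map act_c Ms), act_d = diag_block_mat (map act_d Ms) \<rparr>"

abbreviation H_copies :: "nat \<Rightarrow> 'k::field hmod \<Rightarrow> 'k hmod" where
  "H_copies s M \<equiv> H_dsum (replicate s M)"

text \<open>
  Kronecker product: the basis vector (i, j) of the tensor product has index i * s + j, where s is
  the dimension of the second factor.
\<close>

definition kron :: "'k::field mat \<Rightarrow> 'k mat \<Rightarrow> 'k mat" where
  "kron A B = mat (dim_row A * dim_row B) (dim_col A * dim_col B)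
     (\<lambda>(i, j). A $$ (i div dim_row B, j div dim_col B) * B $$ (i mod dim_row B, j mod dim_col B))"

text \<open>
  The generators act through the comultiplication: a as a (x) b + 1 (x) a, b as b (x) b,
  c as c (x) c, d as d (x) c + 1 (x) d.
\<close>

definition H_tensor :: "'k::field hmod \<Rightarrow> 'k hmod \<Rightarrow> 'k hmod" where
  "H_tensor M N = \<lparr> hdim = hdim M * hdim N,
     act_a = kron (act_a M) (act_b N) + kron (1\<^sub>m (hdim M)) (act_a N),
     act_b = kron (act_b M) (act_b N),
     act_c = kron (act_c M) (act_c N),
     act_d = kron (act_d M) (act_c N) + kron (1\<^sub>m (hdim M)) (act_d N) \<rparr>"


definition qint :: "'k::field \<Rightarrow> nat \<Rightarrow> 'k" where
  "qint q i = (\<Sum>j<i. q ^ j)"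

definition simple_alpha :: "'k::field \<Rightarrow> nat \<Rightarrow> nat \<Rightarrow> 'k" where
  "simple_alpha q l i = qint q i * (1 - q powi (int i - int l))"

text \<open>
  The module V(l, r).  The basis v_1, ..., v_l is indexed from 0 here, so index j stands for
  v_(j+1).  Only the residue class of r modulo n matters when q is an n-th root of unity.
\<close>

definition V :: "'k::field \<Rightarrow> nat \<Rightarrow> int \<Rightarrow> 'k hmod" where
  "V q l r = \<lparr> hdim = l,
     act_a = mat l l (\<lambda>(i, j). if i = j + 1 then 1 else 0),
     act_b = mat l l (\<lambda>(i, j). if i = j then q powi (r + int j) else 0),
     act_c = mat l l (\<lambda>(i, j). if i = j then q powi (int j + 1 - r - int l) else 0),
     act_d = mat l l (\<lambda>(i, j). if j = i + 1 then simple_alpha q l j else 0) \<rparr>"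

definition half_up :: "int \<Rightarrow> int" where
  "half_up t = \<lfloor>(real_of_int t + 1) / 2\<rfloor>"

end

theory Submission
  imports Defs "Jordan_Normal_Form.Determinant" "Jordan_Normal_Form.VS_Connect"
begin

text \<open>A projective module is determined by its multiplicities, the dimensions of its spaces of
  homomorphisms into the simple modules V(m, s): a nonzero homomorphism onto V(m, s) splits off the
  projective cover P(m, s), and one proceeds by induction on the dimension.  Tensoring with V(2, 0)
  acts on the multiplicities by an explicit recurrence, because V(2, 0) has a dual and because the
  tensor product of V(2, 0) and V(l, r) is an extension of V(l - 1, r + 1) by V(l + 1, r), or for
  l = n of one Verma module by another.  The former extensions split after tensoring with a projective
  module, so that the multiplicities of the tensor product of V(l, r) and P(l', r') follow by
  induction on l.\<close>

subsection \<open>Spaces of matrices\<close>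

text \<open>The modules \<open>P m s\<close> are given only by the covering property, so nothing
  about them can be computed in a basis; what is accessible is Hom into the simple modules.
  Surjectivity and exactness are witnessed throughout by linear one-sided inverses, which replace
  kernels and images. The doubled summands originate at V(n, s): V(2, -1) tensor V(n, s) has V(n -
  1, s) and V(1, s - 1) twice each as composition factors, so V(2, 0) tensor P(1, z) has the
  multiplicities of P(2, z) and of two copies of P(n, z + 1). The condition l + l' <= n keeps the
  formal index below n - 1 whenever V(2, 0) is applied: at index n - 1 two copies of P(n, z) would
  appear where the formal rule has one. The defining relations are checked on a tensor product only
  when the left factor is V(1, r) or V(2, r), where a and d square to zero. For longer V(l, r) they
  are inherited, because the tensor product is a direct summand of a module already
  constructed.\<close>

lemma mult_one_imp_le:
  fixes A B :: "'k::field mat"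
  assumes A: "A \<in> carrier_mat t r" and B: "B \<in> carrier_mat r t" and AB: "A * B = 1\<^sub>m t"
  shows "t \<le> r"
proof (rule ccontr)
  assume "\<not> t \<le> r"
  then have rt: "r < t" by simp
  \<comment> \<open>Padding with zeros gives square matrices, for which a one-sided inverse is
    two-sided; but row \<open>r\<close> of \<open>B'\<close> is zero, so the entry (r, r) of
    \<open>B' * A'\<close> cannot be 1.\<close>
  define A' where "A' = mat t t (\<lambda>(i, j). if j < r then A $$ (i, j) else 0)"
  define B' where "B' = mat t t (\<lambda>(i, j). if i < r then B $$ (i, j) else 0)"
  have c: "A' \<in> carrier_mat t t" "B' \<in> carrier_mat t t" by (auto simp: A'_def B'_def)
  have "A' * B' = A * B"
  proof (rule eq_matI)
    fix i j assume "i < dim_row (A * B)" "j < dim_col (A * B)"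
    then have ij: "i < t" "j < t" using A B by auto
    have "(A' * B') $$ (i, j) = (\<Sum>k = 0..<t. A' $$ (i, k) * B' $$ (k, j))"
      using ij c by (auto simp: scalar_prod_def)
    also have "\<dots> = (\<Sum>k = 0..<t. if k < r then A $$ (i, k) * B $$ (k, j) else 0)"
      using ij by (intro sum.cong) (auto simp: A'_def B'_def)
    also have "\<dots> = (\<Sum>k = 0..<r. A $$ (i, k) * B $$ (k, j))"
      using rt by (intro sum.mono_neutral_cong_right) auto
    also have "\<dots> = (A * B) $$ (i, j)" using ij A B by (auto simp: scalar_prod_def)
    finally show "(A' * B') $$ (i, j) = (A * B) $$ (i, j)" .
  qed (use A B c in auto)
  then have "A' * B' = 1\<^sub>m t" using AB by simp
  then have "B' * A' = 1\<^sub>m t" by (rule mat_mult_left_right_inverse[OF c])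
  moreover have "(B' * A') $$ (r, r) = 0"
    using rt c by (auto simp: scalar_prod_def B'_def intro!: sum.neutral)
  ultimately show False using rt by simp
qed

lemma massoc:
  fixes A B C :: "'k::semiring_0 mat"
  assumes "dim_col A = dim_row B" "dim_col B = dim_row C"
  shows "A * B * C = A * (B * C)"
  by (rule assoc_mult_mat[of _ "dim_row A" "dim_col A" _ "dim_col B" _ "dim_col C"]) (use assms in auto)

definition "msub r c W \<longleftrightarrow> W \<subseteq> carrier_mat r c \<and> 0\<^sub>m r c \<in> W \<and>
  (\<forall>A\<in>W. \<forall>B\<in>W. A + B \<in> W) \<and> (\<forall>k. \<forall>A\<in>W. k \<cdot>\<^sub>m A \<in> W)"

abbreviation mspace :: "nat \<Rightarrow> nat \<Rightarrow> 'k::field mat set \<Rightarrow> ('k, 'k mat) module" where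
  "mspace r c W \<equiv> (module_mat TYPE('k) r c)\<lparr>carrier := W\<rparr>"

definition sdim :: "nat \<Rightarrow> nat \<Rightarrow> 'k::field mat set \<Rightarrow> nat" where
  "sdim r c W = vectorspace.dim class_ring (mspace r c W)"

lemma msub_subspace:
  assumes "msub r c (W :: 'k::field mat set)"
  shows "subspace class_ring W (module_mat TYPE('k) r c)"
proof -
  interpret V: vectorspace class_ring "module_mat TYPE('k) r c" by (rule matrix_vs)
  have neg: "\<ominus>\<^bsub>module_mat TYPE('k) r c\<^esub> A = (-1) \<cdot>\<^sub>m A" if "A \<in> carrier_mat r c" for A :: "'k mat"
    using that V.smult_minus_1[of A] by (simp add: matrix_vs_simps)
  show ?thesis
    using assms unfolding msub_def
    using V.module_axioms
    by (auto simp: subspace_def submodule_def matrix_vs matrix_vs_simps)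
qed

lemma msub_vs:
  assumes "msub r c (W :: 'k::field mat set)"
  shows "vectorspace class_ring (mspace r c W)"
  using vectorspace.subspace_is_vs[OF matrix_vs msub_subspace[OF assms]] by simp

text \<open>The whole matrix space is a linear image of k^(rc) and so finite-dimensional.
  Independent subsets of \<open>W\<close> stay independent in it, hence have bounded size, and a
  maximal one generates \<open>W\<close>.\<close>

lemma msub_fin_dim:
  assumes "msub r c (W :: 'k::field mat set)"
  shows "vectorspace.fin_dim class_ring (mspace r c W)"
proof -
  define T :: "'k vec \<Rightarrow> 'k mat" where "T v = mat r c (\<lambda>(i, j). v $ (i * c + j))" for v
  interpret M: vectorspace class_ring "module_mat TYPE('k) r c" by (rule matrix_vs)
  interpret V: vec_space "TYPE('k)" "r * c" .
  interpret vectorspace class_ring "mspace r c W" by (rule msub_vs[OF assms])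
  have idx: "i * c + j < r * c" if "i < r" "j < c" for i j
  proof -
    have "i * c + j < Suc i * c" using that by simp
    also have "\<dots> \<le> r * c" using that by (intro mult_le_mono1) simp
    finally show ?thesis .
  qed
  interpret T: linear_map class_ring "module_vec TYPE('k) (r * c)" "module_mat TYPE('k) r c" T
    using V.vectorspace_axioms M.vectorspace_axioms
    by (auto simp: linear_map_def mod_hom_def mod_hom_axioms_def vectorspace_def
      module_hom_def matrix_vs_simps module_vec_simps T_def idx intro!: eq_matI)
  have "T ` carrier_vec (r * c) = carrier_mat r c"
  proof (intro equalityI subsetI)
    fix A :: "'k mat" assume A: "A \<in> carrier_mat r c"
    have "A = T (vec (r * c) (\<lambda>i. A $$ (i div c, i mod c)))"
      using A idx by (intro eq_matI) (auto simp: T_def)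
    then show "A \<in> T ` carrier_vec (r * c)" by auto
  qed (auto simp: T_def)
  then have fd: "M.fin_dim"
    using T.surj_fin_dim V.fin_dim by (simp add: matrix_vs_simps module_vec_simps)
  have li: "M.lin_indpt S" if "lin_indpt S" "S \<subseteq> W" for S
    using that M.span_li_not_depend(2)[OF that(2)] msub_subspace[OF assms]
    by (simp add: subspace_def)
  have *: "finite S \<and> card S \<le> M.dim" if "S \<subseteq> W" "lin_indpt S" for S
    using M.li_le_dim[OF fd _ li[OF that(2,1)]] that assms
    by (auto simp: msub_def matrix_vs_simps)
  have "\<exists>S. finite S \<and> maximal S (\<lambda>S. S \<subseteq> W \<and> lin_indpt S)"
    by (rule maximal_exists[where B = "{}" and N = "M.dim"]) (use * in \<open>auto simp: finite_lin_indpt2\<close>)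
  then obtain S where S: "finite S" "maximal S (\<lambda>S. S \<subseteq> W \<and> lin_indpt S)" by blast
  then have "gen_set S" by (intro max_li_is_gen) (auto simp: matrix_vs_simps)
  then show ?thesis using S unfolding fin_dim_def maximal_def by (auto simp: matrix_vs_simps)
qed

lemma msub_linear_map:
  assumes "msub r c (W :: 'k::field mat set)" "msub r' c' Z"
    and "\<And>A. A \<in> W \<Longrightarrow> T A \<in> Z"
    and "\<And>A B. A \<in> W \<Longrightarrow> B \<in> W \<Longrightarrow> T (A + B) = T A + T B"
    and "\<And>k A. A \<in> W \<Longrightarrow> T (k \<cdot>\<^sub>m A) = k \<cdot>\<^sub>m T A"
  shows "linear_map class_ring (mspace r c W) (mspace r' c' Z) T"
  using msub_vs[OF assms(1)] msub_vs[OF assms(2)] assms(3-)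
  by (auto simp: linear_map_def mod_hom_def mod_hom_axioms_def vectorspace.is_module[OF msub_vs]
    module_hom_def matrix_vs_simps vectorspace_def)

lemma sdim_rank_nullity:
  fixes W Z :: "'k::field mat set"
  assumes "msub r c W" "msub r' c' Z"
    and T: "T ` W = Z"
    and "\<And>A B. A \<in> W \<Longrightarrow> B \<in> W \<Longrightarrow> T (A + B) = T A + T B"
    and "\<And>k A. A \<in> W \<Longrightarrow> T (k \<cdot>\<^sub>m A) = k \<cdot>\<^sub>m T A"
  shows "sdim r c W = sdim r' c' Z + sdim r c {A \<in> W. T A = 0\<^sub>m r' c'}"
proof -
  interpret linear_map class_ring "mspace r c W" "mspace r' c' Z" T
    using assms by (intro msub_linear_map) auto
  show ?thesis using rank_nullity[OF msub_fin_dim[OF assms(1)]] T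
    by (simp add: sdim_def im_def ker_def matrix_vs_simps)
qed

lemma sdim_eq:
  fixes W Z :: "'k::field mat set"
  assumes "msub r c W" "msub r' c' Z"
    and T: "bij_betw T W Z"
    and "\<And>A B. A \<in> W \<Longrightarrow> B \<in> W \<Longrightarrow> T (A + B) = T A + T B"
    and "\<And>k A. A \<in> W \<Longrightarrow> T (k \<cdot>\<^sub>m A) = k \<cdot>\<^sub>m T A"
  shows "sdim r c W = sdim r' c' Z"
proof -
  interpret linear_map class_ring "mspace r c W" "mspace r' c' Z" T
    using assms by (intro msub_linear_map) (auto simp: bij_betw_def)
  show ?thesis using dim_eq[OF msub_fin_dim[OF assms(1)]] T
    by (simp add: sdim_def bij_betw_def)
qed

lemma sdim_zero: "sdim r c {0\<^sub>m r c :: 'k::field mat} = 0"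
proof -
  have m: "msub r c {0\<^sub>m r c :: 'k mat}" by (auto simp: msub_def)
  interpret vectorspace class_ring "mspace r c {0\<^sub>m r c :: 'k mat}" by (rule msub_vs[OF m])
  show ?thesis unfolding sdim_def
    by (rule dim0I) (use span_zero span_closed in \<open>auto simp: matrix_vs_simps\<close>)
qed

lemma sdim_pos:
  assumes m: "msub r c (W :: 'k::field mat set)" and A: "A \<in> W" "A \<noteq> 0\<^sub>m r c"
  shows "sdim r c W > 0"
proof -
  interpret vectorspace class_ring "mspace r c W" by (rule msub_vs[OF m])
  have "lin_indpt {A}"
    using A lin_dep_iff_in_span[of "{}" A] by (simp add: span_empty matrix_vs_simps finite_lin_indpt2)
  then have "card {A} \<le> dim" using li_le_dim(2)[OF msub_fin_dim[OF m], of "{A}"] A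
    by (simp add: matrix_vs_simps)
  then show ?thesis by (simp add: sdim_def)
qed

lemma sdim_one:
  assumes m: "msub r c (W :: 'k::field mat set)" and A: "A \<in> W" "A \<noteq> 0\<^sub>m r c"
    and W: "\<And>B. B \<in> W \<Longrightarrow> \<exists>k. B = k \<cdot>\<^sub>m A"
  shows "sdim r c W = 1"
proof -
  interpret vectorspace class_ring "mspace r c W" by (rule msub_vs[OF m])
  have "B \<in> span {A}" if B: "B \<in> W" for B
  proof -
    obtain k where "B = k \<cdot>\<^sub>m A" using W B by auto
    then show ?thesis
      using A span_mem[of "{A}" A] span_is_submodule[of "{A}"]
      by (auto simp: submodule_def matrix_vs_simps)
  qed
  then show ?thesis unfolding sdim_def using A
    by (intro dim1I[of A]) (use span_closed[of "{A}"] in \<open>auto simp: matrix_vs_simps\<close>)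
qed

lemma mdist_left:
  fixes A B C :: "'k::ring mat"
  assumes "dim_col A = dim_row B" "dim_row C = dim_row B" "dim_col C = dim_col B"
  shows "A * (B + C) = A * B + A * C" "A * (B - C) = A * B - A * C"
  using assms by (auto intro!: mult_add_distrib_mat[of _ "dim_row A" "dim_col A" _ "dim_col B"]
     mult_minus_distrib_mat[of _ "dim_row A" "dim_col A" _ "dim_col B"])

lemma mdist_right:
  fixes A B C :: "'k::ring mat"
  assumes "dim_col A = dim_row C" "dim_row A = dim_row B" "dim_col A = dim_col B"
  shows "(A + B) * C = A * C + B * C" "(A - B) * C = A * C - B * C"
  using assms by (auto intro!: add_mult_distrib_mat[of _ "dim_row A" "dim_col A" _ _ "dim_col C"]
     minus_mult_distrib_mat[of _ "dim_row A" "dim_col A" _ _ "dim_col C"])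

lemma msmult:
  fixes A B :: "'k::comm_ring_1 mat"
  assumes "dim_col A = dim_row B"
  shows "A * (k \<cdot>\<^sub>m B) = k \<cdot>\<^sub>m (A * B)" "(k \<cdot>\<^sub>m A) * B = k \<cdot>\<^sub>m (A * B)"
  using assms
  by (auto intro!: mult_smult_distrib[of _ "dim_row A" "dim_col A" _ "dim_col B"]
      mult_smult_assoc_mat[of _ "dim_row A" "dim_col A" _ "dim_col B"])

lemma mone:
  fixes A :: "'k::semiring_1 mat"
  shows "dim_col A = k \<Longrightarrow> A * 1\<^sub>m k = A" "dim_row A = k \<Longrightarrow> 1\<^sub>m k * A = A"
  by (auto intro!: eq_matI)

lemma mzero:
  fixes A :: "'k::semiring_1 mat"
  shows "dim_col A = k \<Longrightarrow> A * 0\<^sub>m k c = 0\<^sub>m (dim_row A) c" "dim_row A = k \<Longrightarrow> 0\<^sub>m r k * A = 0\<^sub>m r (dim_col A)"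
  by (auto intro!: eq_matI)

lemma madd0:
  fixes A :: "'k::ring mat"
  shows "dim_row A = r \<Longrightarrow> dim_col A = c \<Longrightarrow> A + 0\<^sub>m r c = A"
    "dim_row A = r \<Longrightarrow> dim_col A = c \<Longrightarrow> 0\<^sub>m r c + A = A"
    "dim_row A = r \<Longrightarrow> dim_col A = c \<Longrightarrow> A - A = 0\<^sub>m r c"
    "dim_row A = r \<Longrightarrow> dim_col A = c \<Longrightarrow> A - 0\<^sub>m r c = A"
  by (auto intro!: eq_matI)

lemmas malg = massoc mdist_left mdist_right msmult mone mzero madd0

text \<open>A maximal partial splitting of an idempotent is complete: otherwise a nonzero entry of the
  complementary idempotent provides one more pair of dual vectors.\<close>

lemma idempotent_splits:
  fixes e :: "'k::field mat"
  assumes e: "e \<in> carrier_mat r r" "e * e = e"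
  obtains t i p where "i \<in> carrier_mat r t" "p \<in> carrier_mat t r" "p * i = 1\<^sub>m t" "i * p = e"
proof -
  \<comment> \<open>\<open>Q t\<close> is a splitting of a part of \<open>e\<close> of rank t.
    \<open>mult_one_imp_le\<close> bounds t by \<open>r\<close>, so a largest such t exists.\<close>
  define Q where "Q t \<longleftrightarrow> (\<exists>i p. i \<in> carrier_mat r t \<and> p \<in> carrier_mat t r \<and> p * i = 1\<^sub>m t \<and>
    e * i = i \<and> p * e = p)" for t
  have Q0: "Q 0" unfolding Q_def
    by (rule exI[of _ "0\<^sub>m r 0"], rule exI[of _ "0\<^sub>m 0 r"]) (use e in \<open>auto intro!: eq_matI\<close>)
  have Qr: "t \<le> r" if "Q t" for t using that mult_one_imp_le unfolding Q_def by blast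
  define t where "t = (GREATEST t. Q t)"
  have Qt: "Q t" unfolding t_def by (rule GreatestI_nat[where k = 0 and b = r]) (use Q0 Qr in auto)
  have Qmax: "\<not> Q (Suc t)" using Greatest_le_nat[of Q "Suc t" r] Qr unfolding t_def by force
  from Qt obtain i p where ip: "i \<in> carrier_mat r t" "p \<in> carrier_mat t r" "p * i = 1\<^sub>m t"
    "e * i = i" "p * e = p" unfolding Q_def by blast
  note d = carrier_matD[OF e(1)] carrier_matD[OF ip(1)] carrier_matD[OF ip(2)]
  have "i * p = e"
  proof (rule ccontr)
    assume ne: "i * p \<noteq> e"
    define e' where "e' = e - i * p"
    have e'c: "e' \<in> carrier_mat r r" using d by (auto simp: e'_def)
    have pe': "p * e' = 0\<^sub>m t r"
    proof -
      have "p * e' = p * e - (p * i) * p" using d by (simp add: e'_def malg)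
      then show ?thesis using d ip by (simp add: malg)
    qed
    have e'i: "e' * i = 0\<^sub>m r t"
      using d ip by (simp add: e'_def malg)
    have e'e: "e' * e = e'" using d ip e by (simp add: e'_def malg)
    have ee': "e * e' = e'"
    proof -
      have "e * e' = e * e - (e * i) * p" using d by (simp add: e'_def malg)
      then show ?thesis using e ip by (simp add: e'_def)
    qed
    have e'e': "e' * e' = e'"
    proof -
      have "e' * e' = e' * e - (e' * i) * p" using d e'c by (simp add: e'_def[of] malg)
      then show ?thesis using e'e e'i d e'c by (simp add: malg)
    qed
    have "e' \<noteq> 0\<^sub>m r r"
    proof
      assume "e' = 0\<^sub>m r r"
      then have "(e - i * p) $$ (a, b) = 0" if "a < r" "b < r" for a b
        using that by (simp add: e'_def)
      then have "i * p = e" using d by (intro eq_matI) auto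
      then show False using ne by simp
    qed
    then obtain k l where kl: "k < r" "l < r" "e' $$ (k, l) \<noteq> 0" using e'c by (metis eq_matI carrier_matD index_zero_mat)
    let ?x = "e' $$ (k, l)"
    \<comment> \<open>The new column is column l of \<open>e'\<close> and the new row is row k of
      \<open>e'\<close> divided by \<open>?x\<close>. Since \<open>e'\<close> is idempotent, row k
      times column l is the entry \<open>?x\<close> itself, so the pairing is 1.\<close>
    define i' where "i' = mat r (Suc t) (\<lambda>(a, j). if j < t then i $$ (a, j) else e' $$ (a, l))"
    define p' where "p' = mat (Suc t) r (\<lambda>(j, a). if j < t then p $$ (j, a) else e' $$ (k, a) / ?x)"
    have c: "i' \<in> carrier_mat r (Suc t)" "p' \<in> carrier_mat (Suc t) r" by (auto simp: i'_def p'_def)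
    have col: "col i' j = (if j < t then col i j else col e' l)" if "j < Suc t" for j
      using that d e'c kl by (auto simp: i'_def intro!: eq_vecI)
    have row: "row p' j = (if j < t then row p j else (1 / ?x) \<cdot>\<^sub>v row e' k)" if "j < Suc t" for j
      using that d e'c kl by (auto simp: p'_def intro!: eq_vecI)
    have "p' * i' = 1\<^sub>m (Suc t)"
    proof (rule eq_matI)
      fix a b assume "a < dim_row (1\<^sub>m (Suc t))" "b < dim_col (1\<^sub>m (Suc t))"
      then have ab: "a < Suc t" "b < Suc t" by auto
      have "(p' * i') $$ (a, b) = row p' a \<bullet> col i' b" using ab c by simp
      also have "\<dots> = 1\<^sub>m (Suc t) $$ (a, b)"
      proof (cases "a < t"; cases "b < t")
        assume s: "a < t" "b < t"
        then have "row p a \<bullet> col i b = (p * i) $$ (a, b)" using d by simp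
        then show ?thesis using s ip row[OF ab(1)] col[OF ab(2)] by simp
      next
        assume s: "a < t" "\<not> b < t"
        then have "row p a \<bullet> col e' l = (p * e') $$ (a, l)" using d kl e'c by simp
        then show ?thesis using s ab kl pe' row[OF ab(1)] col[OF ab(2)] by simp
      next
        assume s: "\<not> a < t" "b < t"
        then have "row e' k \<bullet> col i b = (e' * i) $$ (k, b)" using d kl e'c by simp
        then show ?thesis using s ab kl e'i d e'c row[OF ab(1)] col[OF ab(2)] by simp
      next
        assume s: "\<not> a < t" "\<not> b < t"
        then have "row e' k \<bullet> col e' l = (e' * e') $$ (k, l)" using d kl e'c by simp
        then show ?thesis using s ab kl e'e' d e'c row[OF ab(1)] col[OF ab(2)] by simp
      qed
      finally show "(p' * i') $$ (a, b) = 1\<^sub>m (Suc t) $$ (a, b)" .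
    qed (use c in auto)
    moreover have "e * i' = i'"
    proof (rule eq_matI)
      fix a b assume "a < dim_row i'" "b < dim_col i'"
      then have ab: "a < r" "b < Suc t" using c by auto
      have "(e * i') $$ (a, b) = row e a \<bullet> col i' b" using ab c d by simp
      also have "\<dots> = (if b < t then (e * i) $$ (a, b) else (e * e') $$ (a, l))"
        using ab col[OF ab(2)] d e'c kl by simp
      also have "\<dots> = i' $$ (a, b)" unfolding ip ee' using ab by (simp add: i'_def)
      finally show "(e * i') $$ (a, b) = i' $$ (a, b)" .
    qed (use c d in auto)
    moreover have "p' * e = p'"
    proof (rule eq_matI)
      fix a b assume "a < dim_row p'" "b < dim_col p'"
      then have ab: "a < Suc t" "b < r" using c by auto
      have "(p' * e) $$ (a, b) = row p' a \<bullet> col e b" using ab c d by simp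
      also have "\<dots> = (if a < t then (p * e) $$ (a, b) else (e' * e) $$ (k, b) / ?x)"
        using ab row[OF ab(1)] d e'c kl by simp
      also have "\<dots> = p' $$ (a, b)" unfolding ip e'e using ab by (simp add: p'_def)
      finally show "(p' * e) $$ (a, b) = p' $$ (a, b)" .
    qed (use c d in auto)
    ultimately show False using Qmax c unfolding Q_def by blast
  qed
  then show thesis using that ip by blast
qed

text \<open>A single index for the four generators, so that an equation about all actions is one
  statement quantified over \<open>g\<close>.\<close>

datatype gen = GA | GB | GC | GD

fun act :: "'k hmod \<Rightarrow> gen \<Rightarrow> 'k mat" where
  "act M GA = act_a M" | "act M GB = act_b M" | "act M GC = act_c M" | "act M GD = act_d M"

subsection \<open>Modules and homomorphisms\<close>

lemma all_gen: "(\<forall>g. P g) \<longleftrightarrow> P GA \<and> P GB \<and> P GC \<and> P GD"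
  by (metis gen.exhaust)

text \<open>Only the shapes of the action matrices. Homomorphism spaces, biproducts and tensor
  products make sense at this level, before the defining relations have been verified.\<close>

definition wf_hmod :: "'k hmod \<Rightarrow> bool" where
  "wf_hmod M \<longleftrightarrow> (\<forall>g. act M g \<in> carrier_mat (hdim M) (hdim M))"

lemma wf_hmodD [simp]:
  assumes "wf_hmod M"
  shows "dim_row (act M g) = hdim M" "dim_col (act M g) = hdim M"
  using assms by (auto simp: wf_hmod_def)

lemma H_module_wf: "H_module n q M \<Longrightarrow> wf_hmod M"
  by (auto simp: H_module_def Let_def wf_hmod_def all_gen)

lemma H_hom_iff: "F \<in> H_hom M N \<longleftrightarrow>
  F \<in> carrier_mat (hdim N) (hdim M) \<and> (\<forall>g. F * act M g = act N g * F)"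
  by (auto simp: H_hom_def all_gen)

lemma H_homD [simp]:
  assumes "F \<in> H_hom M N"
  shows "dim_row F = hdim N" "dim_col F = hdim M"
  using assms by (auto simp: H_hom_def)

lemma H_hom_act: "F \<in> H_hom M N \<Longrightarrow> F * act M g = act N g * F"
  by (auto simp: H_hom_iff)

lemma H_homI:
  assumes "dim_row F = hdim N" "dim_col F = hdim M" "\<And>g. F * act M g = act N g * F"
  shows "F \<in> H_hom M N"
  using assms by (auto simp: H_hom_iff)

lemma H_hom_comp:
  assumes G: "G \<in> H_hom N K" and F: "F \<in> H_hom M N" and wf: "wf_hmod M" "wf_hmod N" "wf_hmod K"
  shows "G * F \<in> H_hom M K"
proof (rule H_homI)
  fix g
  have "G * F * act M g = G * (F * act M g)" using assms by (simp add: massoc)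
  also have "\<dots> = G * act N g * F" using assms by (simp add: massoc H_hom_act[OF F])
  also have "\<dots> = act K g * (G * F)" using assms by (simp add: massoc H_hom_act[OF G])
  finally show "G * F * act M g = act K g * (G * F)" .
qed (use assms in auto)

lemma H_hom_one: "wf_hmod M \<Longrightarrow> 1\<^sub>m (hdim M) \<in> H_hom M M"
  by (rule H_homI) (auto simp: mone)

lemma H_hom_zero: "wf_hmod M \<Longrightarrow> wf_hmod N \<Longrightarrow> 0\<^sub>m (hdim N) (hdim M) \<in> H_hom M N"
  by (rule H_homI) (auto simp: mzero)

lemma H_hom_add:
  assumes "wf_hmod M" "wf_hmod N" "F \<in> H_hom M N" "G \<in> H_hom M N"
  shows "F + G \<in> H_hom M N" "F - G \<in> H_hom M N"
  using assms by (auto intro!: H_homI simp: mdist_left mdist_right H_hom_act)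

lemma H_hom_smult:
  assumes "wf_hmod M" "wf_hmod N" "F \<in> H_hom M N"
  shows "k \<cdot>\<^sub>m F \<in> H_hom M N"
  using assms by (auto intro!: H_homI simp: msmult H_hom_act)

lemma H_hom_msub:
  assumes "wf_hmod M" "wf_hmod N"
  shows "msub (hdim N) (hdim M) (H_hom M N)"
  using H_hom_add[OF assms] H_hom_smult[OF assms] H_hom_zero[OF assms]
  by (auto simp: msub_def H_hom_def)

definition hom_dim :: "'k::field hmod \<Rightarrow> 'k hmod \<Rightarrow> nat" where
  "hom_dim M N = sdim (hdim N) (hdim M) (H_hom M N)"

text \<open>Intertwining survives products, powers, differences and scalar multiples. Each side of a
  defining relation therefore intertwines with the same expression in the target, and relations can
  be pulled back along homomorphisms.\<close>

definition intertwines :: "nat \<Rightarrow> nat \<Rightarrow> 'k::comm_ring_1 mat \<Rightarrow> 'k mat \<Rightarrow> 'k mat \<Rightarrow> bool" where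
  "intertwines r s F A B \<longleftrightarrow> F \<in> carrier_mat s r \<and> A \<in> carrier_mat r r \<and> B \<in> carrier_mat s s \<and> F * A = B * F"

lemma intertwines_mult:
  assumes "intertwines r s F A B" "intertwines r s F A' B'"
  shows "intertwines r s F (A * A') (B * B')"
proof -
  have c: "dim_row F = s" "dim_col F = r" "dim_row A = r" "dim_col A = r" "dim_row A' = r"
    "dim_col A' = r" "dim_row B = s" "dim_col B = s" "dim_row B' = s" "dim_col B' = s"
    using assms by (auto simp: intertwines_def)
  have "F * (A * A') = B * F * A'" using assms c by (simp add: intertwines_def massoc[symmetric])
  also have "\<dots> = B * B' * F" using assms c by (simp add: intertwines_def massoc)
  finally show ?thesis using assms by (auto simp: intertwines_def)
qed

lemma intertwines_pow:
  assumes "intertwines r s F A B"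
  shows "intertwines r s F (A ^\<^sub>m k) (B ^\<^sub>m k)"
proof (induction k)
  case 0
  then show ?case using assms by (auto simp: intertwines_def mone)
next
  case (Suc k)
  then show ?case using intertwines_mult[OF Suc assms] by simp
qed

lemma intertwines_minus:
  assumes "intertwines r s F A B" "intertwines r s F A' B'"
  shows "intertwines r s F (A - A') (B - B')"
  using assms by (auto simp: intertwines_def mdist_left mdist_right)

lemma intertwines_smult: "intertwines r s F A B \<Longrightarrow> intertwines r s F (k \<cdot>\<^sub>m A) (k \<cdot>\<^sub>m B)"
  by (auto simp: intertwines_def msmult)

lemma intertwines_one: "F \<in> carrier_mat s r \<Longrightarrow> intertwines r s F (1\<^sub>m r) (1\<^sub>m s)"
  and intertwines_zero: "F \<in> carrier_mat s r \<Longrightarrow> intertwines r s F (0\<^sub>m r r) (0\<^sub>m s s)"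
  by (auto simp: intertwines_def mone mzero)

text \<open>Each relation holds after \<open>p\<close> and after \<open>p'\<close>, and
  \<open>g * p + g' * p' = 1\<close> cancels both maps. Since \<open>g\<close> and \<open>g'\<close>
  are merely linear, this serves direct sums and, with the same map taken twice, submodules.\<close>

lemma jointly_monic_H_module:
  assumes A: "H_module n q A" and B: "H_module n q B" and wf: "wf_hmod D"
    and p: "p \<in> H_hom D A" "p' \<in> H_hom D B"
    and g: "g \<in> carrier_mat (hdim D) (hdim A)" "g' \<in> carrier_mat (hdim D) (hdim B)"
      "g * p + g' * p' = 1\<^sub>m (hdim D)"
  shows "H_module n q D"
proof -
  have eqI: "X = Y" if "intertwines (hdim D) (hdim A) p X X'" "intertwines (hdim D) (hdim A) p Y Y'"
    "intertwines (hdim D) (hdim B) p' X X''" "intertwines (hdim D) (hdim B) p' Y Y''" "X' = Y'" "X'' = Y''"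
    for X Y X' Y' X'' Y''
  proof -
    have d: "dim_row X = hdim D" "dim_row Y = hdim D" "dim_col X = hdim D" "dim_col Y = hdim D"
      using that by (auto simp: intertwines_def)
    note gd = carrier_matD[OF g(1)] carrier_matD[OF g(2)]
    have "X = (g * p + g' * p') * X" using d g by (simp add: mone)
    also have "\<dots> = g * (p * X) + g' * (p' * X)" using d gd p by (simp add: malg)
    also have "\<dots> = g * (p * Y) + g' * (p' * Y)" using that by (simp add: intertwines_def)
    also have "\<dots> = (g * p + g' * p') * Y" using d gd p by (simp add: malg)
    also have "\<dots> = Y" using d g by (simp add: mone)
    finally show ?thesis .
  qed
  have i: "intertwines (hdim D) (hdim K) F (act D h) (act K h)" if "F \<in> H_hom D K" "wf_hmod K" for F K h
    using that wf by (auto simp: intertwines_def wf_hmod_def H_hom_iff)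
  note wfA = H_module_wf[OF A] and wfB = H_module_wf[OF B]
  have i1: "intertwines (hdim D) (hdim A) p (act_a D) (act_a A)" "intertwines (hdim D) (hdim A) p (act_b D) (act_b A)"
    "intertwines (hdim D) (hdim A) p (act_c D) (act_c A)" "intertwines (hdim D) (hdim A) p (act_d D) (act_d A)"
    using i[OF p(1) wfA, of GA] i[OF p(1) wfA, of GB] i[OF p(1) wfA, of GC] i[OF p(1) wfA, of GD] by simp_all
  have i2: "intertwines (hdim D) (hdim B) p' (act_a D) (act_a B)" "intertwines (hdim D) (hdim B) p' (act_b D) (act_b B)"
    "intertwines (hdim D) (hdim B) p' (act_c D) (act_c B)" "intertwines (hdim D) (hdim B) p' (act_d D) (act_d B)"
    using i[OF p(2) wfB, of GA] i[OF p(2) wfB, of GB] i[OF p(2) wfB, of GC] i[OF p(2) wfB, of GD] by simp_all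
  have pc: "p \<in> carrier_mat (hdim A) (hdim D)" "p' \<in> carrier_mat (hdim B) (hdim D)"
    using p by (auto simp: H_hom_def)
  note rules = intertwines_mult intertwines_pow intertwines_minus intertwines_smult intertwines_one[OF pc(1)] intertwines_one[OF pc(2)]
    intertwines_zero[OF pc(1)] intertwines_zero[OF pc(2)] i1 i2
  note RA = A[unfolded H_module_def Let_def] and RB = B[unfolded H_module_def Let_def]
  have "act_b D * act_a D = q \<cdot>\<^sub>m (act_a D * act_b D)"
    by (rule eqI, (rule rules)+) (use RA RB in \<open>simp_all\<close>)
  moreover have "act_d D * act_b D = q \<cdot>\<^sub>m (act_b D * act_d D)"
    by (rule eqI, (rule rules)+) (use RA RB in \<open>simp_all\<close>)
  moreover have "act_c D * act_a D = q \<cdot>\<^sub>m (act_a D * act_c D)"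
    by (rule eqI, (rule rules)+) (use RA RB in \<open>simp_all\<close>)
  moreover have "act_d D * act_c D = q \<cdot>\<^sub>m (act_c D * act_d D)"
    by (rule eqI, (rule rules)+) (use RA RB in \<open>simp_all\<close>)
  moreover have "act_b D * act_c D = act_c D * act_b D"
    by (rule eqI, (rule rules)+) (use RA RB in \<open>simp_all\<close>)
  moreover have "act_a D ^\<^sub>m n = 0\<^sub>m (hdim D) (hdim D)"
    by (rule eqI, (rule rules)+) (use RA RB in \<open>simp_all\<close>)
  moreover have "act_b D ^\<^sub>m n = 1\<^sub>m (hdim D)"
    by (rule eqI, (rule rules)+) (use RA RB in \<open>simp_all\<close>)
  moreover have "act_c D ^\<^sub>m n = 1\<^sub>m (hdim D)"
    by (rule eqI, (rule rules)+) (use RA RB in \<open>simp_all\<close>)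
  moreover have "act_d D ^\<^sub>m n = 0\<^sub>m (hdim D) (hdim D)"
    by (rule eqI, (rule rules)+) (use RA RB in \<open>simp_all\<close>)
  moreover have "act_d D * act_a D - q \<cdot>\<^sub>m (act_a D * act_d D) = 1\<^sub>m (hdim D) - act_b D * act_c D"
    by (rule eqI, (rule rules)+) (use RA RB in \<open>simp_all\<close>)
  ultimately show ?thesis
    using wf unfolding H_module_def Let_def by (simp add: wf_hmod_def all_gen)
qed

lemma H_module_embed:
  assumes X: "H_module n q X" and wf: "wf_hmod A" and i: "i \<in> H_hom A X"
    and r: "r \<in> carrier_mat (hdim A) (hdim X)" "r * i = 1\<^sub>m (hdim A)"
  shows "H_module n q A"
  by (rule jointly_monic_H_module[OF X X wf i i r(1), of "0\<^sub>m (hdim A) (hdim X)"])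
     (use i r in \<open>auto simp: malg\<close>)

text \<open>Preimages of the unit vectors are the columns of a right inverse. \<open>R\<close> is
  only linear; in this form surjectivity passes to tensor products by applying \<open>kron\<close>
  to \<open>R\<close>.\<close>

lemma H_epi_iff:
  assumes "wf_hmod M" "wf_hmod N"
  shows "F \<in> H_epi M N \<longleftrightarrow> F \<in> H_hom M N \<and> (\<exists>R \<in> carrier_mat (hdim M) (hdim N). F * R = 1\<^sub>m (hdim N))"
proof (intro iffI conjI)
  assume F: "F \<in> H_epi M N"
  then show "F \<in> H_hom M N" by (simp add: H_epi_def)
  then have d: "dim_row F = hdim N" "dim_col F = hdim M" by auto
  have "\<exists>v\<in>carrier_vec (hdim M). F *\<^sub>v v = unit_vec (hdim N) j" for j
  proof -
    have "unit_vec (hdim N) j \<in> (\<lambda>v. F *\<^sub>v v) ` carrier_vec (hdim M)"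
      using F unfolding H_epi_def by simp
    then show ?thesis by auto
  qed
  then obtain v where v: "v j \<in> carrier_vec (hdim M)" "F *\<^sub>v v j = unit_vec (hdim N) j" for j by metis
  let ?R = "mat (hdim M) (hdim N) (\<lambda>(i, j). v j $ i)"
  have "F * ?R = 1\<^sub>m (hdim N)"
  proof (rule eq_matI)
    fix i j assume ij: "i < dim_row (1\<^sub>m (hdim N))" "j < dim_col (1\<^sub>m (hdim N))"
    have "col ?R j = v j" using ij v(1)[of j] by (auto intro!: eq_vecI)
    then have "(F * ?R) $$ (i, j) = (F *\<^sub>v v j) $ i" using ij d by simp
    then show "(F * ?R) $$ (i, j) = 1\<^sub>m (hdim N) $$ (i, j)" using ij v by (simp add: unit_vec_def)
  qed (use d in auto)
  then show "\<exists>R \<in> carrier_mat (hdim M) (hdim N). F * R = 1\<^sub>m (hdim N)" by (intro bexI[of _ ?R]) auto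
next
  assume "F \<in> H_hom M N \<and> (\<exists>R \<in> carrier_mat (hdim M) (hdim N). F * R = 1\<^sub>m (hdim N))"
  then obtain R where F: "F \<in> H_hom M N" and R: "R \<in> carrier_mat (hdim M) (hdim N)" "F * R = 1\<^sub>m (hdim N)" by auto
  have Fc: "F \<in> carrier_mat (hdim N) (hdim M)" using F by (simp add: H_hom_def)
  have "w = F *\<^sub>v (R *\<^sub>v w)" if "w \<in> carrier_vec (hdim N)" for w
    using that R Fc by (simp add: assoc_mult_mat_vec[symmetric])
  moreover have "R *\<^sub>v w \<in> carrier_vec (hdim M)" if "w \<in> carrier_vec (hdim N)" for w
    using R that by auto
  ultimately have "(\<lambda>v. F *\<^sub>v v) ` carrier_vec (hdim M) = carrier_vec (hdim N)"
    using Fc by (auto simp: image_iff)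
  then show "F \<in> H_epi M N" using F by (simp add: H_epi_def)
qed

subsection \<open>Projective modules and short exact sequences\<close>

lemma mult_cancel_assoc:
  fixes A B C X :: "'k::semiring_0 mat"
  assumes "A * B = C" "dim_col A = dim_row B" "dim_col B = dim_row X"
  shows "A * (B * X) = C * X"
  using assms massoc[of A B X] by simp

text \<open>Direct sums in terms of inclusions and projections instead of subspaces; every later use
  reduces to these five identities.\<close>

definition biprod :: "'k::field hmod \<Rightarrow> 'k hmod \<Rightarrow> 'k hmod \<Rightarrow> bool" where
  "biprod M A B \<longleftrightarrow> wf_hmod M \<and> wf_hmod A \<and> wf_hmod B \<and>
    (\<exists>f\<in>H_hom M A. \<exists>g\<in>H_hom A M. \<exists>p\<in>H_hom M B. \<exists>i\<in>H_hom B M.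
      f * g = 1\<^sub>m (hdim A) \<and> p * i = 1\<^sub>m (hdim B) \<and> g * f + i * p = 1\<^sub>m (hdim M) \<and>
      f * i = 0\<^sub>m (hdim A) (hdim B) \<and> p * g = 0\<^sub>m (hdim B) (hdim A))"

lemma biprodE:
  assumes "biprod M A B"
  obtains f g p i where "f \<in> H_hom M A" "g \<in> H_hom A M" "p \<in> H_hom M B" "i \<in> H_hom B M"
    "f * g = 1\<^sub>m (hdim A)" "p * i = 1\<^sub>m (hdim B)" "g * f + i * p = 1\<^sub>m (hdim M)"
    "f * i = 0\<^sub>m (hdim A) (hdim B)" "p * g = 0\<^sub>m (hdim B) (hdim A)"
    "wf_hmod M" "wf_hmod A" "wf_hmod B"
  using assms unfolding biprod_def by blast

lemma biprod_sym: 
  assumes "biprod M A B"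
  shows "biprod M B A"
proof -
  obtain f g p i where *: "f \<in> H_hom M A" "g \<in> H_hom A M" "p \<in> H_hom M B" "i \<in> H_hom B M"
    "f * g = 1\<^sub>m (hdim A)" "p * i = 1\<^sub>m (hdim B)" "g * f + i * p = 1\<^sub>m (hdim M)"
    "f * i = 0\<^sub>m (hdim A) (hdim B)" "p * g = 0\<^sub>m (hdim B) (hdim A)"
    "wf_hmod M" "wf_hmod A" "wf_hmod B" using assms by (elim biprodE)
  have "i * p + g * f = 1\<^sub>m (hdim M)" using * comm_add_mat[of "i * p" "hdim M" "hdim M" "g * f"]
    by (auto simp: H_hom_def)
  then show ?thesis using * unfolding biprod_def by blast
qed

lemma sub_one_comb:
  fixes F g f i p :: "'k::field mat"
  assumes "g * f + i * p = 1\<^sub>m m" "dim_col F = m" "dim_row g = m" "dim_row i = m"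
    "dim_row f = dim_col g" "dim_row p = dim_col i" "dim_col f = m" "dim_col p = m"
  shows "F * g * f + F * i * p = F"
proof -
  have "F * (g * f + i * p) = F" using assms by (simp add: mone)
  moreover have "F * (g * f + i * p) = F * g * f + F * i * p"
    using assms(2-) by (simp add: massoc mdist_left)
  ultimately show ?thesis by simp
qed

text \<open>Restriction to \<open>A\<close> is onto Hom(A, X) because \<open>f\<close> is a left
  inverse of \<open>g\<close>; its kernel is Hom(B, X), and rank-nullity adds the two.\<close>

lemma hom_dim_biprod:
  assumes b: "biprod M A B" and X: "wf_hmod X"
  shows "hom_dim M X = hom_dim A X + hom_dim B X"
proof -
  obtain f g p i where *: "f \<in> H_hom M A" "g \<in> H_hom A M" "p \<in> H_hom M B" "i \<in> H_hom B M"
    "f * g = 1\<^sub>m (hdim A)" "p * i = 1\<^sub>m (hdim B)" "g * f + i * p = 1\<^sub>m (hdim M)"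
    "f * i = 0\<^sub>m (hdim A) (hdim B)" "p * g = 0\<^sub>m (hdim B) (hdim A)"
    "wf_hmod M" "wf_hmod A" "wf_hmod B" using b by (elim biprodE)
  let ?K = "{F \<in> H_hom M X. F * g = 0\<^sub>m (hdim X) (hdim A)}"
  note cmp = H_hom_comp[OF _ _ _ _ X]
  have im: "(\<lambda>F. F * g) ` H_hom M X = H_hom A X"
  proof (intro equalityI subsetI)
    fix G assume "G \<in> H_hom A X"
    then have "G * f \<in> H_hom M X" "G = (G * f) * g" using * cmp by (auto simp: massoc mone)
    then show "G \<in> (\<lambda>F. F * g) ` H_hom M X" by blast
  qed (use * cmp in auto)
  have 1: "hom_dim M X = hom_dim A X + sdim (hdim X) (hdim M) ?K"
    unfolding hom_dim_def
    by (rule sdim_rank_nullity[OF H_hom_msub H_hom_msub im])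
       (use * X in \<open>auto simp: mdist_right msmult\<close>)
  have K: "msub (hdim X) (hdim M) ?K"
    using H_hom_msub[OF *(10) X] * by (auto simp: msub_def mdist_right msmult malg)
  have "bij_betw (\<lambda>F. F * i) ?K (H_hom B X)"
  proof (rule bij_betw_byWitness[where f' = "\<lambda>G. G * p"])
    show "\<forall>F\<in>?K. F * i * p = F"
    proof
      fix F assume "F \<in> ?K"
      then have F: "F \<in> H_hom M X" "F * g = 0\<^sub>m (hdim X) (hdim A)" by auto
      then have "F * g * f + F * i * p = F" by (intro sub_one_comb[OF *(7)]) (use * in auto)
      then show "F * i * p = F" using F * by (simp add: malg)
    qed
    show "\<forall>G\<in>H_hom B X. G * p * i = G" using * by (auto simp: massoc mone)
    show "(\<lambda>F. F * i) ` ?K \<subseteq> H_hom B X" using * cmp by auto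
    show "(\<lambda>G. G * p) ` H_hom B X \<subseteq> ?K" using * cmp by (auto simp: massoc mzero)
  qed
  note bij = this
  have "sdim (hdim X) (hdim M) ?K = hom_dim B X"
    unfolding hom_dim_def
    by (rule sdim_eq[OF K H_hom_msub bij]) (use * X in \<open>auto simp: mdist_right msmult\<close>)
  then show ?thesis using 1 by simp
qed

lemma projective_lift:
  assumes P: "H_projective n q P" and M: "H_module n q M" and N: "H_module n q N"
    and F: "F \<in> H_hom M N" "R \<in> carrier_mat (hdim M) (hdim N)" "F * R = 1\<^sub>m (hdim N)"
    and G: "G \<in> H_hom P N"
  obtains L where "L \<in> H_hom P M" "F * L = G"
proof -
  have "F \<in> H_epi M N" using F M N H_module_wf H_epi_iff by blast
  then show thesis using P M N G that unfolding H_projective_def by blast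
qed

lemma projectiveI:
  assumes "H_module n q P"
    and "\<And>M N F R G. H_module n q M \<Longrightarrow> H_module n q N \<Longrightarrow> F \<in> H_hom M N \<Longrightarrow>
      R \<in> carrier_mat (hdim M) (hdim N) \<Longrightarrow> F * R = 1\<^sub>m (hdim N) \<Longrightarrow> G \<in> H_hom P N \<Longrightarrow>
      \<exists>L \<in> H_hom P M. F * L = G"
  shows "H_projective n q P"
  using assms unfolding H_projective_def by (metis H_epi_iff H_module_wf)

lemma projective_module: "H_projective n q P \<Longrightarrow> H_module n q P"
  by (simp add: H_projective_def)

lemma projective_wf: "H_projective n q P \<Longrightarrow> wf_hmod P"
  by (rule H_module_wf[OF projective_module])

text \<open>\<open>r\<close> and \<open>s\<close> are merely linear. They witness that
  \<open>i\<close> is injective, that \<open>p\<close> is surjective and that the kernel of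
  \<open>p\<close> is the image of \<open>i\<close>.\<close>

definition ses :: "'k::field hmod \<Rightarrow> 'k hmod \<Rightarrow> 'k hmod \<Rightarrow> bool" where
  "ses A X B \<longleftrightarrow> wf_hmod A \<and> wf_hmod X \<and> wf_hmod B \<and>
    (\<exists>i\<in>H_hom A X. \<exists>p\<in>H_hom X B. \<exists>r\<in>carrier_mat (hdim A) (hdim X). \<exists>s\<in>carrier_mat (hdim X) (hdim B).
      r * i = 1\<^sub>m (hdim A) \<and> p * s = 1\<^sub>m (hdim B) \<and> i * r + s * p = 1\<^sub>m (hdim X) \<and>
      p * i = 0\<^sub>m (hdim B) (hdim A))"

lemma sesE:
  assumes "ses A X B"
  obtains i p r s where "i \<in> H_hom A X" "p \<in> H_hom X B"
      "r \<in> carrier_mat (hdim A) (hdim X)" "s \<in> carrier_mat (hdim X) (hdim B)"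
      "r * i = 1\<^sub>m (hdim A)" "p * s = 1\<^sub>m (hdim B)" "i * r + s * p = 1\<^sub>m (hdim X)"
      "p * i = 0\<^sub>m (hdim B) (hdim A)" "wf_hmod A" "wf_hmod X" "wf_hmod B"
  using assms unfolding ses_def by blast

text \<open>The required identity holds after composition with \<open>i\<close>, and the linear left
  inverse \<open>r\<close> cancels \<open>i\<close>.\<close>

lemma mono_reflects_hom:
  assumes i: "i \<in> H_hom A X" and r: "r \<in> carrier_mat (hdim A) (hdim X)" "r * i = 1\<^sub>m (hdim A)"
    and wf: "wf_hmod A" "wf_hmod X" "wf_hmod M"
    and G: "G \<in> carrier_mat (hdim A) (hdim M)" and iG: "i * G \<in> H_hom M X"
  shows "G \<in> H_hom M A"
proof (rule H_homI)
  fix g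
  have "i * (G * act M g) = i * (act A g * G)"
  proof -
    have "i * (G * act M g) = act X g * (i * G)"
      using i wf G H_hom_act[OF iG, of g] by (simp add: massoc[symmetric])
    also have "\<dots> = i * act A g * G" using i wf G by (simp add: massoc[symmetric] H_hom_act[OF i])
    finally show ?thesis using i wf G by (simp add: massoc)
  qed
  then have "r * i * (G * act M g) = r * i * (act A g * G)"
    using i r(1) wf G by (simp add: massoc)
  then show "G * act M g = act A g * G" using i r wf G by (simp add: mone)
qed (use G in auto)

text \<open>Hom(M, -) is exact for projective \<open>M\<close>: lifting along \<open>p\<close> is
  surjectivity, and the maps killed by \<open>p\<close> are those that factor through
  \<open>i\<close>.\<close>

lemma hom_dim_ses:
  assumes M: "H_projective n q M" and s: "ses A X B" and X: "H_module n q X" and B: "H_module n q B"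
  shows "hom_dim M X = hom_dim M A + hom_dim M B"
proof -
  obtain i p r s where *: "i \<in> H_hom A X" "p \<in> H_hom X B"
      "r \<in> carrier_mat (hdim A) (hdim X)" "s \<in> carrier_mat (hdim X) (hdim B)"
      "r * i = 1\<^sub>m (hdim A)" "p * s = 1\<^sub>m (hdim B)" "i * r + s * p = 1\<^sub>m (hdim X)"
      "p * i = 0\<^sub>m (hdim B) (hdim A)" "wf_hmod A" "wf_hmod X" "wf_hmod B" using s by (elim sesE)
  note wM = projective_wf[OF M]
  note d = carrier_matD[OF *(3)] carrier_matD[OF *(4)]
  let ?K = "{F \<in> H_hom M X. p * F = 0\<^sub>m (hdim B) (hdim M)}"
  note cmp = H_hom_comp[OF _ _ wM]
  have im: "(\<lambda>F. p * F) ` H_hom M X = H_hom M B"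
  proof (intro equalityI subsetI)
    fix G assume "G \<in> H_hom M B"
    then obtain L where "L \<in> H_hom M X" "p * L = G"
      using projective_lift[OF M X B *(2) *(4,6)] by blast
    then show "G \<in> (\<lambda>F. p * F) ` H_hom M X" by blast
  qed (use * cmp in auto)
  have 1: "hom_dim M X = hom_dim M B + sdim (hdim X) (hdim M) ?K"
    unfolding hom_dim_def
    by (rule sdim_rank_nullity[OF H_hom_msub H_hom_msub im])
       (use * wM in \<open>auto simp: mdist_left msmult\<close>)
  have K: "msub (hdim X) (hdim M) ?K"
    using H_hom_msub[OF wM *(10)] * by (auto simp: msub_def mdist_left msmult malg)
  have "bij_betw (\<lambda>G. i * G) (H_hom M A) ?K"
  proof (rule bij_betw_byWitness[where f' = "\<lambda>F. r * F"])
    have iF: "i * (r * F) = F" if "F \<in> ?K" for F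
    proof -
      have F: "F \<in> H_hom M X" "p * F = 0\<^sub>m (hdim B) (hdim M)" using that by auto
      have "F = (i * r + s * p) * F" using F * by (simp add: mone)
      also have "\<dots> = i * (r * F) + s * (p * F)" using F *(1,2,9-11) d by (simp add: malg)
      finally show ?thesis using F *(1,2,9-11) d by (simp add: malg)
    qed
    then show "\<forall>F\<in>?K. i * (r * F) = F" by blast
    show "\<forall>G\<in>H_hom M A. r * (i * G) = G" using * d by (auto simp: massoc[symmetric] mone)
    show "(\<lambda>G. i * G) ` H_hom M A \<subseteq> ?K" using * cmp by (auto simp: massoc[symmetric] mzero)
    show "(\<lambda>F. r * F) ` ?K \<subseteq> H_hom M A"
    proof safe
      fix F assume F: "F \<in> H_hom M X" "p * F = 0\<^sub>m (hdim B) (hdim M)"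
      have "r * F \<in> carrier_mat (hdim A) (hdim M)" using *(3) F(1) by (auto simp: H_hom_def)
      then show "r * F \<in> H_hom M A"
        using mono_reflects_hom[OF *(1,3,5,9,10) wM] iF F by auto
    qed
  qed
  note bij = this
  have "hom_dim M A = sdim (hdim X) (hdim M) ?K"
    unfolding hom_dim_def
    by (rule sdim_eq[OF H_hom_msub K bij]) (use * wM in \<open>auto simp: mdist_left msmult\<close>)
  then show ?thesis using 1 by simp
qed

text \<open>Projectivity of \<open>B\<close> gives a section \<open>t\<close> of \<open>p\<close>.
  The map \<open>1 - t * p\<close> takes values in the kernel of \<open>p\<close>, so composing it
  with \<open>r\<close> gives a homomorphism although \<open>r\<close> alone need not be
  one.\<close>

lemma ses_biprod:
  assumes P: "H_projective n q B" and s: "ses A X B" and X: "H_module n q X"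
  shows "biprod X B A"
proof -
  obtain i p r s where *: "i \<in> H_hom A X" "p \<in> H_hom X B"
      "r \<in> carrier_mat (hdim A) (hdim X)" "s \<in> carrier_mat (hdim X) (hdim B)"
      "r * i = 1\<^sub>m (hdim A)" "p * s = 1\<^sub>m (hdim B)" "i * r + s * p = 1\<^sub>m (hdim X)"
      "p * i = 0\<^sub>m (hdim B) (hdim A)" "wf_hmod A" "wf_hmod X" "wf_hmod B" using s by (elim sesE)
  note d = carrier_matD[OF *(3)] carrier_matD[OF *(4)] H_homD[OF *(1)] H_homD[OF *(2)]
  obtain t where t: "t \<in> H_hom B X" "p * t = 1\<^sub>m (hdim B)"
    using projective_lift[OF P X projective_module[OF P] *(2) *(4,6) H_hom_one[OF *(11)]] by blast
  note d = d H_homD[OF t(1)]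
  let ?e = "1\<^sub>m (hdim X) - t * p"
  have pe: "p * ?e = 0\<^sub>m (hdim B) (hdim X)"
    using d t by (simp add: malg mult_cancel_assoc[OF t(2)])
  have ie: "i * (r * ?e) = ?e"
  proof -
    have "?e = (i * r + s * p) * ?e" using d * by (simp add: mone)
    also have "\<dots> = i * (r * ?e) + s * (p * ?e)" using d by (simp add: mdist_right massoc)
    also have "\<dots> = i * (r * ?e)" using d unfolding pe by (simp add: malg)
    finally show ?thesis by simp
  qed
  have "?e \<in> H_hom X X"
    using H_hom_add(2)[OF *(10,10) H_hom_one[OF *(10)] H_hom_comp[OF t(1) *(2) *(10,11,10)]] .
  then have re: "r * ?e \<in> H_hom X A"
    using ie d by (intro mono_reflects_hom[OF *(1,3,5,9,10,10)]) auto
  have "r * ?e * i = 1\<^sub>m (hdim A)"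
  proof -
    have "r * ?e * i = r * i - r * (t * (p * i))" using d by (simp add: malg)
    then show ?thesis using d * by (simp add: malg)
  qed
  moreover have "r * ?e * t = 0\<^sub>m (hdim A) (hdim B)"
  proof -
    have "r * ?e * t = r * t - r * (t * (p * t))" using d by (simp add: malg)
    then show ?thesis using d t by (simp add: malg)
  qed
  moreover have "t * p + i * (r * ?e) = 1\<^sub>m (hdim X)"
    unfolding ie using d by (intro eq_matI) auto
  ultimately show ?thesis
    unfolding biprod_def using * t re by blast
qed

text \<open>The complement is the image of the idempotent \<open>1 - g * f\<close>. Modules live on
  coordinate spaces here, so \<open>idempotent_splits\<close> supplies coordinates on that image and
  the actions are transported along them.\<close>

lemma hom_split:
  assumes M: "H_module n q M" and wP: "wf_hmod P"
    and f: "f \<in> H_hom M P" and g: "g \<in> H_hom P M" and fg: "f * g = 1\<^sub>m (hdim P)"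
  obtains M' where "H_module n q M'" "biprod M P M'"
proof -
  note wM = H_module_wf[OF M]
  note d = H_homD[OF f] H_homD[OF g]
  let ?e = "1\<^sub>m (hdim M) - g * f"
  have e: "?e \<in> H_hom M M"
    using H_hom_add(2)[OF wM wM H_hom_one[OF wM] H_hom_comp[OF g f wM wP wM]] .
  have ee: "?e * ?e = ?e"
    using d by (simp add: malg mult_cancel_assoc[OF fg])
  have ec: "?e \<in> carrier_mat (hdim M) (hdim M)" using e by (simp add: H_hom_def)
  obtain t i p where ip: "i \<in> carrier_mat (hdim M) t" "p \<in> carrier_mat t (hdim M)"
    "p * i = 1\<^sub>m t" "i * p = ?e"
    by (rule idempotent_splits[OF ec ee])
  note d = d carrier_matD[OF ip(1)] carrier_matD[OF ip(2)]
  have fi: "f * i = 0\<^sub>m (hdim P) t"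
  proof -
    have "f * i = f * (i * p) * i" using d ip(3) by (simp add: massoc mone)
    also have "f * (i * p) = 0\<^sub>m (hdim P) (hdim M)" unfolding ip using d
      by (simp add: malg mult_cancel_assoc[OF fg])
    finally show ?thesis using d by (simp add: malg)
  qed
  have pg: "p * g = 0\<^sub>m t (hdim P)"
  proof -
    have "p * g = p * ((i * p) * g)" using d ip(3) by (simp add: massoc mone mult_cancel_assoc[OF ip(3)])
    also have "(i * p) * g = 0\<^sub>m (hdim M) (hdim P)" unfolding ip using d
      by (simp add: malg fg)
    finally show ?thesis using d by (simp add: malg)
  qed
  define M' where "M' = \<lparr>hdim = t, act_a = p * act_a M * i, act_b = p * act_b M * i,
    act_c = p * act_c M * i, act_d = p * act_d M * i\<rparr>"
  have [simp]: "hdim M' = t" by (simp add: M'_def)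
  have acts: "act M' h = p * act M h * i" for h by (cases h) (simp_all add: M'_def)
  have wf: "wf_hmod M'" unfolding wf_hmod_def acts using d wM by auto
  have i: "i \<in> H_hom M' M"
  proof (rule H_homI)
    fix h
    have "i * act M' h = ?e * act M h * i" unfolding acts ip(4)[symmetric] using d wM by (simp add: massoc)
    also have "\<dots> = act M h * (?e * i)" using d wM by (simp add: massoc H_hom_act[OF e])
    also have "?e * i = i" unfolding ip(4)[symmetric] using d ip(1-3) by (simp add: massoc mone)
    finally show "i * act M' h = act M h * i" .
  qed (use d in auto)
  have p: "p \<in> H_hom M M'"
  proof (rule H_homI)
    fix h
    have "act M' h * p = p * (act M h * ?e)" unfolding acts ip(4)[symmetric] using d wM by (simp add: massoc)
    also have "\<dots> = p * ?e * act M h" using d wM by (simp add: massoc H_hom_act[OF e, symmetric])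
    also have "p * ?e = p" unfolding ip(4)[symmetric] using d ip(1-3) by (simp add: massoc[symmetric] mone)
    finally show "p * act M h = act M' h * p" by simp
  qed (use d in auto)
  have "H_module n q M'"
    by (rule H_module_embed[OF M wf i]) (use ip in auto)
  moreover have "biprod M P M'"
    unfolding biprod_def
  proof (intro conjI bexI)
    show "g * f + i * p = 1\<^sub>m (hdim M)" unfolding ip using d by (intro eq_matI) auto
  qed (use wM wP wf f g i p fg ip fi pg in auto)
  ultimately show thesis by (rule that)
qed

lemma projective_summand:
  assumes M: "H_projective n q M" and b: "biprod M A B"
  shows "H_projective n q A"
proof -
  obtain f g p i where *: "f \<in> H_hom M A" "g \<in> H_hom A M" "p \<in> H_hom M B" "i \<in> H_hom B M"
    "f * g = 1\<^sub>m (hdim A)" "p * i = 1\<^sub>m (hdim B)" "g * f + i * p = 1\<^sub>m (hdim M)"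
    "f * i = 0\<^sub>m (hdim A) (hdim B)" "p * g = 0\<^sub>m (hdim B) (hdim A)"
    "wf_hmod M" "wf_hmod A" "wf_hmod B" using b by (elim biprodE)
  show ?thesis
  proof (rule projectiveI)
    show "H_module n q A"
      by (rule H_module_embed[OF projective_module[OF M] *(11,2)]) (use * in \<open>auto simp: H_hom_def\<close>)
    fix X N F R G
    assume X: "H_module n q X" and N: "H_module n q N" and F: "F \<in> H_hom X N"
      "R \<in> carrier_mat (hdim X) (hdim N)" "F * R = 1\<^sub>m (hdim N)" and G: "G \<in> H_hom A N"
    note wN = H_module_wf[OF N] and wX = H_module_wf[OF X]
    obtain L where L: "L \<in> H_hom M X" "F * L = G * f"
      using projective_lift[OF M X N F H_hom_comp[OF G *(1) *(10,11) wN]] by blast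
    have "F * (L * g) = G" using L F G * by (simp add: massoc[symmetric]) (simp add: massoc mone)
    then show "\<exists>L \<in> H_hom A X. F * L = G" using H_hom_comp[OF L(1) *(2,11,10) wX] by blast
  qed
qed

lemma projective_biprod:
  assumes A: "H_projective n q A" and B: "H_projective n q B" and b: "biprod M A B"
  shows "H_projective n q M"
proof -
  obtain f g p i where *: "f \<in> H_hom M A" "g \<in> H_hom A M" "p \<in> H_hom M B" "i \<in> H_hom B M"
    "f * g = 1\<^sub>m (hdim A)" "p * i = 1\<^sub>m (hdim B)" "g * f + i * p = 1\<^sub>m (hdim M)"
    "f * i = 0\<^sub>m (hdim A) (hdim B)" "p * g = 0\<^sub>m (hdim B) (hdim A)"
    "wf_hmod M" "wf_hmod A" "wf_hmod B" using b by (elim biprodE)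
  show ?thesis
  proof (rule projectiveI)
    show "H_module n q M"
      by (rule jointly_monic_H_module[OF projective_module[OF A] projective_module[OF B] *(10,1,3)])
         (use * in \<open>auto simp: H_hom_def\<close>)
    fix X N F R G
    assume X: "H_module n q X" and N: "H_module n q N" and F: "F \<in> H_hom X N"
      "R \<in> carrier_mat (hdim X) (hdim N)" "F * R = 1\<^sub>m (hdim N)" and G: "G \<in> H_hom M N"
    note wN = H_module_wf[OF N] and wX = H_module_wf[OF X]
    obtain L where L: "L \<in> H_hom A X" "F * L = G * g"
      using projective_lift[OF A X N F H_hom_comp[OF G *(2) *(11,10) wN]] by blast
    obtain K where K: "K \<in> H_hom B X" "F * K = G * i"
      using projective_lift[OF B X N F H_hom_comp[OF G *(4) *(12,10) wN]] by blast
    have "L * f + K * p \<in> H_hom M X"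
      using H_hom_add(1)[OF *(10) wX H_hom_comp[OF L(1) *(1,10,11) wX] H_hom_comp[OF K(1) *(3,10,12) wX]] .
    moreover have "F * (L * f + K * p) = G"
    proof -
      have "F * (L * f + K * p) = F * L * f + F * K * p"
        using L(1) K(1) F(1) *(1-4) by (simp add: mdist_left massoc)
      then show ?thesis using sub_one_comb[OF *(7)] L K G * by simp
    qed
    ultimately show "\<exists>L \<in> H_hom M X. F * L = G" by blast
  qed
qed

text \<open>With equal dimensions \<open>i\<close> and \<open>p\<close> would be mutually inverse,
  so \<open>p * g = 0\<close> would force \<open>g = 0\<close>, against \<open>f * g = 1\<close> on
  a nonzero space. This drives the induction on the dimension when summands are split off.\<close>

lemma biprod_hdim_less:
  assumes b: "biprod M A B" and A: "hdim A > 0"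
  shows "hdim B < hdim M"
proof (rule ccontr)
  assume nl: "\<not> hdim B < hdim M"
  obtain f g p i where *: "f \<in> H_hom M A" "g \<in> H_hom A M" "p \<in> H_hom M B" "i \<in> H_hom B M"
    "f * g = 1\<^sub>m (hdim A)" "p * i = 1\<^sub>m (hdim B)" "g * f + i * p = 1\<^sub>m (hdim M)"
    "f * i = 0\<^sub>m (hdim A) (hdim B)" "p * g = 0\<^sub>m (hdim B) (hdim A)"
    "wf_hmod M" "wf_hmod A" "wf_hmod B" using b by (elim biprodE)
  have "hdim B \<le> hdim M" using mult_one_imp_le[OF _ _ *(6)] * by (auto simp: H_hom_def)
  then have e: "hdim B = hdim M" using nl by simp
  have "i * p = 1\<^sub>m (hdim M)"
    using mat_mult_left_right_inverse[of p "hdim M" i] * e by (auto simp: H_hom_def)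
  then have "g = i * p * g" using * by (simp add: mone)
  also have "\<dots> = 0\<^sub>m (hdim M) (hdim A)" using * by (simp add: malg)
  finally have "f * g = 0\<^sub>m (hdim A) (hdim A)" using * by (simp add: malg)
  then have "(1\<^sub>m (hdim A) :: 'a mat) $$ (0, 0) = 0\<^sub>m (hdim A) (hdim A) $$ (0, 0)" using * by simp
  then show False using A by simp
qed

lemma H_iso_biprod:
  assumes M: "H_module n q M" and N: "H_module n q N" and bM: "biprod M A B" and bN: "biprod N A B'"
    and iso: "H_iso n q B B'"
  shows "H_iso n q M N"
proof -
  obtain f g p i where *: "f \<in> H_hom M A" "g \<in> H_hom A M" "p \<in> H_hom M B" "i \<in> H_hom B M"
    "f * g = 1\<^sub>m (hdim A)" "p * i = 1\<^sub>m (hdim B)" "g * f + i * p = 1\<^sub>m (hdim M)"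
    "f * i = 0\<^sub>m (hdim A) (hdim B)" "p * g = 0\<^sub>m (hdim B) (hdim A)"
    "wf_hmod M" "wf_hmod A" "wf_hmod B" using bM by (elim biprodE)
  obtain f' g' p' i' where o: "f' \<in> H_hom N A" "g' \<in> H_hom A N" "p' \<in> H_hom N B'" "i' \<in> H_hom B' N"
    "f' * g' = 1\<^sub>m (hdim A)" "p' * i' = 1\<^sub>m (hdim B')" "g' * f' + i' * p' = 1\<^sub>m (hdim N)"
    "f' * i' = 0\<^sub>m (hdim A) (hdim B')" "p' * g' = 0\<^sub>m (hdim B') (hdim A)"
    "wf_hmod N" "wf_hmod A" "wf_hmod B'" using bN by (elim biprodE)
  obtain F G where FG: "F \<in> H_hom B B'" "G \<in> H_hom B' B" "G * F = 1\<^sub>m (hdim B)" "F * G = 1\<^sub>m (hdim B')"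
    using iso unfolding H_iso_def by blast
  let ?F = "g' * f + i' * (F * p)" and ?G = "g * f' + i * (G * p')"
  have F: "?F \<in> H_hom M N"
    using * o FG by (intro H_hom_add(1) H_hom_comp[of _ A] H_hom_comp[of _ B] H_hom_comp[of _ B']) auto
  have G: "?G \<in> H_hom N M"
    using * o FG by (intro H_hom_add(1) H_hom_comp[of _ A] H_hom_comp[of _ B] H_hom_comp[of _ B']) auto
  note d = H_homD[OF *(1)] H_homD[OF *(2)] H_homD[OF *(3)] H_homD[OF *(4)] H_homD[OF o(1)]
    H_homD[OF o(2)] H_homD[OF o(3)] H_homD[OF o(4)] H_homD[OF FG(1)] H_homD[OF FG(2)]
  note ca = mult_cancel_assoc[OF *(5)] mult_cancel_assoc[OF *(6)] mult_cancel_assoc[OF *(8)]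
    mult_cancel_assoc[OF *(9)] mult_cancel_assoc[OF o(5)] mult_cancel_assoc[OF o(6)] mult_cancel_assoc[OF o(8)]
    mult_cancel_assoc[OF o(9)] mult_cancel_assoc[OF FG(3)] mult_cancel_assoc[OF FG(4)]
  have 1: "?G * ?F = 1\<^sub>m (hdim M)" using d *(7) by (simp add: malg ca)
  have 2: "?F * ?G = 1\<^sub>m (hdim N)" using d o(7) by (simp add: malg ca)
  show ?thesis unfolding H_iso_def using M N F G 1 2 by blast
qed

lemma act_H_dsum: "act (H_dsum Ms) g = diag_block_mat (map (\<lambda>M. act M g) Ms)"
  by (cases g) (simp_all add: H_dsum_def)

lemma wf_H_dsum:
  assumes "\<And>M. M \<in> set Ms \<Longrightarrow> wf_hmod M"
  shows "wf_hmod (H_dsum Ms)"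
proof -
  have "map dim_row (map (\<lambda>M. act M g) Ms) = map hdim Ms" "map dim_col (map (\<lambda>M. act M g) Ms) = map hdim Ms" for g
    using assms by auto
  then have "dim_row (diag_block_mat (map (\<lambda>M. act M g) Ms)) = sum_list (map hdim Ms)"
    "dim_col (diag_block_mat (map (\<lambda>M. act M g) Ms)) = sum_list (map hdim Ms)" for g
    by (auto simp: dim_diag_block_mat simp del: map_map)
  then show ?thesis unfolding wf_hmod_def act_H_dsum by (auto simp: H_dsum_def)
qed

text \<open>Reduces lists of summands to iterated biproducts. The four maps are the coordinate
  inclusions and projections of the block decomposition.\<close>

lemma biprod_H_dsum_Cons:
  assumes wf: "wf_hmod A" "\<And>M. M \<in> set Ms \<Longrightarrow> wf_hmod M"
  shows "biprod (H_dsum (A # Ms)) A (H_dsum Ms)"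
proof -
  let ?B = "H_dsum Ms" and ?M = "H_dsum (A # Ms)"
  let ?a = "hdim A" and ?b = "hdim ?B"
  have h: "hdim ?M = ?a + ?b" by (simp add: H_dsum_def)
  have wB: "wf_hmod ?B" using wf by (intro wf_H_dsum) auto
  have wM: "wf_hmod ?M" using wf by (intro wf_H_dsum) auto
  have a: "act ?M g = mat (?a + ?b) (?a + ?b) (\<lambda>(i, j).
      if i < ?a then if j < ?a then act A g $$ (i, j) else 0
      else if j < ?a then 0 else act ?B g $$ (i - ?a, j - ?a))" for g
  proof -
    have d: "dim_row (act ?B g) = ?b" "dim_col (act ?B g) = ?b" using wB by auto
    have "act ?M g = four_block_mat (act A g) (0\<^sub>m ?a ?b) (0\<^sub>m ?b ?a) (act ?B g)"
      using wf d by (simp add: act_H_dsum Let_def)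
    then show ?thesis using wf d by (intro eq_matI) auto
  qed
  define f :: "'a mat" where "f = mat ?a (?a + ?b) (\<lambda>(i, j). if i = j then 1 else 0)"
  define g :: "'a mat" where "g = mat (?a + ?b) ?a (\<lambda>(i, j). if i = j then 1 else 0)"
  define p :: "'a mat" where "p = mat ?b (?a + ?b) (\<lambda>(i, j). if i + ?a = j then 1 else 0)"
  define i :: "'a mat" where "i = mat (?a + ?b) ?b (\<lambda>(i, j). if i = j + ?a then 1 else 0)"
  have left: "(\<Sum>k = 0..<N. (if k = u then 1 else 0) * X k) = (if u < N then X u else 0)"
    "(\<Sum>k = 0..<N. (if u = k then 1 else 0) * X k) = (if u < N then X u else 0)"
    "(\<Sum>k = 0..<N. X k * (if k = u then 1 else 0)) = (if u < N then X u else 0)"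
    "(\<Sum>k = 0..<N. X k * (if u = k then 1 else 0)) = (if u < N then X u else 0)" for N u and X :: "nat \<Rightarrow> 'a"
    by (auto simp: if_distrib if_distribR cong: if_cong)
  have shift: "(\<Sum>k = 0..<N. X k * (if u = k + m then 1 else 0)) = (if m \<le> u \<and> u < N + m then X (u - m) else 0)"
    "(\<Sum>k = 0..<N. X k * (if k + m = u then 1 else 0)) = (if m \<le> u \<and> u < N + m then X (u - m) else 0)"
    "(\<Sum>k = 0..<N. (if u = k + m then 1 else 0) * X k) = (if m \<le> u \<and> u < N + m then X (u - m) else 0)"
    "(\<Sum>k = 0..<N. (if k + m = u then 1 else 0) * X k) = (if m \<le> u \<and> u < N + m then X (u - m) else 0)"
    for N u m and X :: "nat \<Rightarrow> 'a"
  proof -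
    have e: "(u = k + m) = (m \<le> u \<and> k = u - m)" "(k + m = u) = (m \<le> u \<and> k = u - m)" for k by auto
    show "(\<Sum>k = 0..<N. X k * (if u = k + m then 1 else 0)) = (if m \<le> u \<and> u < N + m then X (u - m) else 0)"
      "(\<Sum>k = 0..<N. X k * (if k + m = u then 1 else 0)) = (if m \<le> u \<and> u < N + m then X (u - m) else 0)"
      "(\<Sum>k = 0..<N. (if u = k + m then 1 else 0) * X k) = (if m \<le> u \<and> u < N + m then X (u - m) else 0)"
      "(\<Sum>k = 0..<N. (if k + m = u then 1 else 0) * X k) = (if m \<le> u \<and> u < N + m then X (u - m) else 0)"
      unfolding e by (cases "m \<le> u"; auto simp: left)+
  qed
  note sp = scalar_prod_def left shift
  have "f \<in> H_hom ?M A" by (rule H_homI) (use wf in \<open>auto simp: f_def a h sp intro!: eq_matI\<close>)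
  moreover have "g \<in> H_hom A ?M" by (rule H_homI) (use wf in \<open>auto simp: g_def a h sp intro!: eq_matI\<close>)
  moreover have "p \<in> H_hom ?M ?B" by (rule H_homI) (use wB in \<open>auto simp: p_def a h sp intro!: eq_matI\<close>)
  moreover have "i \<in> H_hom ?B ?M" by (rule H_homI) (use wB in \<open>auto simp: i_def a h sp intro!: eq_matI\<close>)
  moreover have "f * g = 1\<^sub>m ?a" by (auto simp: f_def g_def sp intro!: eq_matI)
  moreover have "p * i = 1\<^sub>m ?b" by (auto simp: p_def i_def sp intro!: eq_matI)
  moreover have "f * i = 0\<^sub>m ?a ?b" by (auto simp: f_def i_def sp intro!: eq_matI)
  moreover have "p * g = 0\<^sub>m ?b ?a" by (auto simp: p_def g_def sp intro!: eq_matI)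
  moreover have "g * f + i * p = 1\<^sub>m (?a + ?b)" by (auto simp: p_def g_def f_def i_def sp intro!: eq_matI)
  ultimately show ?thesis unfolding biprod_def h[symmetric] using wM wf wB by blast
qed

subsection \<open>Tensor products and duals\<close>

lemma dim_kron [simp]:
  "dim_row (kron A B) = dim_row A * dim_row B" "dim_col (kron A B) = dim_col A * dim_col B"
  by (simp_all add: kron_def)

lemma index_kron [simp]:
  "i < dim_row A * dim_row B \<Longrightarrow> j < dim_col A * dim_col B \<Longrightarrow>
    kron A B $$ (i, j) = A $$ (i div dim_row B, j div dim_col B) * B $$ (i mod dim_row B, j mod dim_col B)"
  by (simp add: kron_def)

lemma div_mod_less:
  assumes "(i::nat) < a * b"
  shows "i div b < a" "i mod b < b"
proof -
  have "b > 0" using assms by (cases b) auto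
  then show "i div b < a" "i mod b < b" using assms by (auto simp: less_mult_imp_div_less)
qed

lemma sum_div_mod:
  fixes f :: "nat \<Rightarrow> nat \<Rightarrow> 'a::comm_monoid_add"
  shows "(\<Sum>k = 0..<a * b. f (k div b) (k mod b)) = (\<Sum>i = 0..<a. \<Sum>j = 0..<b. f i j)"
proof -
  have less: "i * b + j < a * b" if "i < a" "j < b" for i j
  proof -
    have "i * b + j < Suc i * b" using that by simp
    also have "\<dots> \<le> a * b" using that by (intro mult_le_mono1) simp
    finally show ?thesis .
  qed
  have "(\<Sum>i = 0..<a. \<Sum>j = 0..<b. f i j) = (\<Sum>(i, j)\<in>{0..<a} \<times> {0..<b}. f i j)"
    by (simp add: sum.cartesian_product)
  also have "\<dots> = (\<Sum>k = 0..<a * b. f (k div b) (k mod b))"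
    by (rule sum.reindex_bij_witness[where i = "\<lambda>k. (k div b, k mod b)" and j = "\<lambda>(i, j). i * b + j"])
       (auto simp: div_mod_less less)
  finally show ?thesis by simp
qed

lemma kron_mult:
  assumes "dim_col A = dim_row C" "dim_col B = dim_row D"
  shows "kron A B * kron C D = kron (A * C) (B * D)"
proof (rule eq_matI)
  fix i j assume "i < dim_row (kron (A * C) (B * D))" "j < dim_col (kron (A * C) (B * D))"
  then have i: "i < dim_row A * dim_row B" and j: "j < dim_col C * dim_col D" by auto
  note dm = div_mod_less[OF i] div_mod_less[OF j]
  have "(kron A B * kron C D) $$ (i, j) =
     (\<Sum>k = 0..<dim_row C * dim_row D.
        (A $$ (i div dim_row B, k div dim_row D) * B $$ (i mod dim_row B, k mod dim_row D)) *
        (C $$ (k div dim_row D, j div dim_col D) * D $$ (k mod dim_row D, j mod dim_col D)))"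
    using i j assms by (simp add: scalar_prod_def)
  also have "\<dots> = (\<Sum>k = 0..<dim_row C. \<Sum>l = 0..<dim_row D.
        (A $$ (i div dim_row B, k) * B $$ (i mod dim_row B, l)) *
        (C $$ (k, j div dim_col D) * D $$ (l, j mod dim_col D)))"
    by (rule sum_div_mod)
  also have "\<dots> = (\<Sum>k = 0..<dim_row C. A $$ (i div dim_row B, k) * C $$ (k, j div dim_col D)) *
     (\<Sum>l = 0..<dim_row D. B $$ (i mod dim_row B, l) * D $$ (l, j mod dim_col D))"
    by (simp add: sum_product mult_ac)
  also have "\<dots> = kron (A * C) (B * D) $$ (i, j)"
    using i j dm assms by (simp add: scalar_prod_def)
  finally show "(kron A B * kron C D) $$ (i, j) = kron (A * C) (B * D) $$ (i, j)" .
qed auto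

lemma kron_add:
  assumes "dim_row A = dim_row B" "dim_col A = dim_col B"
  shows "kron (A + B) C = kron A C + kron B C" "kron C (A + B) = kron C A + kron C B"
    "kron (A - B) C = kron A C - kron B C" "kron C (A - B) = kron C A - kron C B"
  using assms by (auto intro!: eq_matI
    simp: div_mod_less distrib_left distrib_right left_diff_distrib right_diff_distrib)

lemma kron_smult:
  "kron (k \<cdot>\<^sub>m A) B = k \<cdot>\<^sub>m kron A B" "kron A (k \<cdot>\<^sub>m B) = k \<cdot>\<^sub>m kron A B"
  by (auto intro!: eq_matI simp: div_mod_less)

lemma kron_one: "kron (1\<^sub>m a) (1\<^sub>m b) = 1\<^sub>m (a * b)"
proof (rule eq_matI)
  fix i j assume "i < dim_row (1\<^sub>m (a * b))" "j < dim_col (1\<^sub>m (a * b))"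
  then have "i < a * b" "j < a * b" by auto
  moreover have "i div b = j div b \<and> i mod b = j mod b \<longleftrightarrow> i = j" by (metis div_mult_mod_eq)
  ultimately show "kron (1\<^sub>m a) (1\<^sub>m b) $$ (i, j) = 1\<^sub>m (a * b) $$ (i, j)"
    by (auto simp: div_mod_less)
qed auto

lemma kron_zero: "kron (0\<^sub>m a b) A = 0\<^sub>m (a * dim_row A) (b * dim_col A)"
  "kron A (0\<^sub>m a b) = 0\<^sub>m (dim_row A * a) (dim_col A * b)"
  by (auto intro!: eq_matI simp: div_mod_less)

lemma kron_assoc: "kron (kron A B) C = kron A (kron B C)"
proof (rule eq_matI)
  fix i j assume "i < dim_row (kron A (kron B C))" "j < dim_col (kron A (kron B C))"
  then have i: "i < dim_row A * (dim_row B * dim_row C)" "i < dim_row A * dim_row B * dim_row C"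
    and j: "j < dim_col A * (dim_col B * dim_col C)" "j < dim_col A * dim_col B * dim_col C"
    by (auto simp: mult.assoc)
  note dm = div_mod_less[OF i(1)] div_mod_less[OF i(2)] div_mod_less[OF j(1)] div_mod_less[OF j(2)]
  have *: "x div (b * c) = x div c div b" "x mod (b * c) div c = x div c mod b" "x mod (b * c) mod c = x mod c"
    for x b c :: nat
  proof -
    show "x div (b * c) = x div c div b" by (metis div_mult2_eq mult.commute)
    have "x mod (b * c) = c * (x div c mod b) + x mod c" by (metis mod_mult2_eq mult.commute)
    then show "x mod (b * c) div c = x div c mod b" by (cases "c = 0") simp_all
    show "x mod (b * c) mod c = x mod c" by (simp add: mod_mod_cancel)
  qed
  show "kron (kron A B) C $$ (i, j) = kron A (kron B C) $$ (i, j)"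
    using i j dm by (simp add: * mult.assoc)
qed (auto simp: mult.assoc)

lemma kron_one_left: "kron (1\<^sub>m 1) A = A"
  by (auto intro!: eq_matI)

lemma kron_pow:
  assumes "A \<in> carrier_mat a a" "B \<in> carrier_mat b b"
  shows "kron A B ^\<^sub>m k = kron (A ^\<^sub>m k) (B ^\<^sub>m k)"
proof (induction k)
  case 0
  then show ?case using assms by (simp add: kron_one)
next
  case (Suc k)
  then show ?case using assms by (simp add: kron_mult)
qed

lemma hdim_tensor [simp]: "hdim (H_tensor M N) = hdim M * hdim N"
  by (simp add: H_tensor_def)

lemma act_tensor:
  "act (H_tensor M N) GA = kron (act M GA) (act N GB) + kron (1\<^sub>m (hdim M)) (act N GA)"
  "act (H_tensor M N) GB = kron (act M GB) (act N GB)"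
  "act (H_tensor M N) GC = kron (act M GC) (act N GC)"
  "act (H_tensor M N) GD = kron (act M GD) (act N GC) + kron (1\<^sub>m (hdim M)) (act N GD)"
  by (simp_all add: H_tensor_def)

lemma hmod_eqI:
  fixes M N :: "'k hmod"
  assumes "hdim M = hdim N" "\<And>g. act M g = act N g"
  shows "M = N"
  using assms(1) assms(2)[of GA] assms(2)[of GB] assms(2)[of GC] assms(2)[of GD] by simp

lemma wf_tensor:
  assumes "wf_hmod M" "wf_hmod N"
  shows "wf_hmod (H_tensor M N)"
proof -
  have "dim_row (act (H_tensor M N) g) = hdim M * hdim N \<and> dim_col (act (H_tensor M N) g) = hdim M * hdim N" for g
    by (cases g) (simp_all only: act_tensor, simp_all add: assms del: act.simps)
  then show ?thesis by (auto simp: wf_hmod_def)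
qed

lemma madd_assoc:
  fixes A B C :: "'k::semigroup_add mat"
  assumes "dim_row B = dim_row A" "dim_col B = dim_col A" "dim_row C = dim_row A" "dim_col C = dim_col A"
  shows "A + B + C = A + (B + C)"
  using assms by (intro eq_matI) (auto simp: add.assoc)

text \<open>With lexicographic indices the Kronecker product is strictly associative, and the
  comultiplication is coassociative. So this is an equality of modules, and no associativity
  isomorphisms occur below.\<close>

lemma H_tensor_assoc:
  assumes w: "wf_hmod A" "wf_hmod B" "wf_hmod C"
  shows "H_tensor (H_tensor A B) C = H_tensor A (H_tensor B C)"
proof (rule hmod_eqI)
  fix g
  have "\<forall>g. act (H_tensor (H_tensor A B) C) g = act (H_tensor A (H_tensor B C)) g"
    unfolding all_gen act_tensor hdim_tensor
    by (simp add: kron_add kron_assoc w kron_one[symmetric] madd_assoc del: act.simps)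
  then show "act (H_tensor (H_tensor A B) C) g = act (H_tensor A (H_tensor B C)) g" by blast
qed (simp add: mult.assoc)

lemma tensor_hom_left:
  assumes F: "F \<in> H_hom M M'" and wf: "wf_hmod M" "wf_hmod M'" "wf_hmod N"
  shows "kron F (1\<^sub>m (hdim N)) \<in> H_hom (H_tensor M N) (H_tensor M' N)"
proof -
  note d = H_homD[OF F]
  have "\<forall>g. kron F (1\<^sub>m (hdim N)) * act (H_tensor M N) g = act (H_tensor M' N) g * kron F (1\<^sub>m (hdim N))"
    unfolding all_gen act_tensor
    by (simp add: mdist_left mdist_right kron_mult d wf mone H_hom_act[OF F] del: act.simps)
  then show ?thesis by (auto simp: H_hom_iff d)
qed

lemma tensor_hom_right:
  assumes F: "F \<in> H_hom N N'" and wf: "wf_hmod N" "wf_hmod N'" "wf_hmod M"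
  shows "kron (1\<^sub>m (hdim M)) F \<in> H_hom (H_tensor M N) (H_tensor M N')"
proof -
  note d = H_homD[OF F]
  have "\<forall>g. kron (1\<^sub>m (hdim M)) F * act (H_tensor M N) g = act (H_tensor M N') g * kron (1\<^sub>m (hdim M)) F"
    unfolding all_gen act_tensor
    by (simp add: mdist_left mdist_right kron_mult d wf mone H_hom_act[OF F] del: act.simps)
  then show ?thesis by (auto simp: H_hom_iff d)
qed

lemma ses_tensor:
  assumes s: "ses A X B" and N: "wf_hmod N"
  shows "ses (H_tensor A N) (H_tensor X N) (H_tensor B N)"
proof -
  obtain i p r s where *: "i \<in> H_hom A X" "p \<in> H_hom X B"
      "r \<in> carrier_mat (hdim A) (hdim X)" "s \<in> carrier_mat (hdim X) (hdim B)"
      "r * i = 1\<^sub>m (hdim A)" "p * s = 1\<^sub>m (hdim B)" "i * r + s * p = 1\<^sub>m (hdim X)"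
      "p * i = 0\<^sub>m (hdim B) (hdim A)" "wf_hmod A" "wf_hmod X" "wf_hmod B" using s by (elim sesE)
  let ?I = "1\<^sub>m (hdim N)"
  note d = carrier_matD[OF *(3)] carrier_matD[OF *(4)] H_homD[OF *(1)] H_homD[OF *(2)]
  show ?thesis
    unfolding ses_def
  proof (intro conjI bexI)
    show "kron r ?I * kron i ?I = 1\<^sub>m (hdim (H_tensor A N))"
      using d * by (simp add: kron_mult kron_one mone)
    show "kron p ?I * kron s ?I = 1\<^sub>m (hdim (H_tensor B N))"
      using d * by (simp add: kron_mult kron_one mone)
    show "kron p ?I * kron i ?I = 0\<^sub>m (hdim (H_tensor B N)) (hdim (H_tensor A N))"
      using d * by (simp add: kron_mult kron_zero mone)
    show "kron i ?I * kron r ?I + kron s ?I * kron p ?I = 1\<^sub>m (hdim (H_tensor X N))"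
      using d *(7) by (simp add: kron_mult kron_one mone kron_add[symmetric])
  qed (use * N d in \<open>auto intro!: wf_tensor tensor_hom_left\<close>)
qed

text \<open>The snake identities make tensoring with \<open>V\<close> on the left a left adjoint of
  tensoring with \<open>W\<close> on the left. The unit object \<open>T\<close> is required to be a
  strict left unit, as V(1, 0) is.\<close>

locale dual_pair =
  fixes T V W :: "'k::field hmod" and ev co :: "'k mat"
  assumes wf: "wf_hmod T" "wf_hmod V" "wf_hmod W"
    and T: "hdim T = 1" "\<And>M. wf_hmod M \<Longrightarrow> H_tensor T M = M"
    and ev: "ev \<in> H_hom (H_tensor V W) T"
    and co: "co \<in> H_hom T (H_tensor W V)"
    and snake: "kron ev (1\<^sub>m (hdim V)) * kron (1\<^sub>m (hdim V)) co = 1\<^sub>m (hdim V)"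
      "kron (1\<^sub>m (hdim W)) ev * kron co (1\<^sub>m (hdim W)) = 1\<^sub>m (hdim W)"
begin

definition "adj M F = kron (1\<^sub>m (hdim W)) F * kron co (1\<^sub>m (hdim M))"
definition "coadj X G = kron ev (1\<^sub>m (hdim X)) * kron (1\<^sub>m (hdim V)) G"

lemma dims: "dim_row ev = 1" "dim_col ev = hdim V * hdim W" "dim_row co = hdim W * hdim V" "dim_col co = 1"
  using H_homD[OF ev] H_homD[OF co] T by auto

lemma adj_hom:
  assumes F: "F \<in> H_hom (H_tensor V M) X" and w: "wf_hmod M" "wf_hmod X"
  shows "adj M F \<in> H_hom M (H_tensor W X)"
proof -
  have "kron co (1\<^sub>m (hdim M)) \<in> H_hom M (H_tensor W (H_tensor V M))"
    using tensor_hom_left[OF co wf(1) wf_tensor[OF wf(3,2)] w(1)] T(2)[OF w(1)] H_tensor_assoc[OF wf(3,2) w(1)] by simp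
  moreover have "kron (1\<^sub>m (hdim W)) F \<in> H_hom (H_tensor W (H_tensor V M)) (H_tensor W X)"
    by (rule tensor_hom_right[OF F wf_tensor[OF wf(2) w(1)] w(2) wf(3)])
  ultimately show ?thesis unfolding adj_def
    by (intro H_hom_comp[of _ "H_tensor W (H_tensor V M)"]) (simp_all add: wf w wf_tensor)
qed

lemma coadj_hom:
  assumes G: "G \<in> H_hom M (H_tensor W X)" and w: "wf_hmod M" "wf_hmod X"
  shows "coadj X G \<in> H_hom (H_tensor V M) X"
proof -
  have "kron ev (1\<^sub>m (hdim X)) \<in> H_hom (H_tensor V (H_tensor W X)) X"
    using tensor_hom_left[OF ev wf_tensor[OF wf(2,3)] wf(1) w(2)] T(2)[OF w(2)] H_tensor_assoc[OF wf(2,3) w(2)] by simp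
  moreover have "kron (1\<^sub>m (hdim V)) G \<in> H_hom (H_tensor V M) (H_tensor V (H_tensor W X))"
    by (rule tensor_hom_right[OF G w(1) wf_tensor[OF wf(3) w(2)] wf(2)])
  ultimately show ?thesis unfolding coadj_def
    by (intro H_hom_comp[of _ "H_tensor V (H_tensor W X)"]) (simp_all add: wf w wf_tensor)
qed

lemma coadj_adj:
  assumes F: "dim_row F = hdim X" "dim_col F = hdim V * hdim M"
  shows "coadj X (adj M F) = F"
proof -
  let ?v = "1\<^sub>m (hdim V) :: 'k mat" and ?w = "1\<^sub>m (hdim W) :: 'k mat" and ?m = "1\<^sub>m (hdim M) :: 'k mat" and ?x = "1\<^sub>m (hdim X) :: 'k mat"
  have "kron ?v (kron ?w F * kron co ?m) = kron ?v (kron ?w F) * kron ?v (kron co ?m)"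
    using F dims by (simp add: kron_mult mone mult_ac)
  then have "coadj X (adj M F) = kron ev ?x * (kron (kron ?v ?w) F * kron (kron ?v co) ?m)"
    by (simp add: coadj_def adj_def kron_assoc)
  also have "\<dots> = (kron ev ?x * kron (kron ?v ?w) F) * kron (kron ?v co) ?m"
    using F dims by (simp add: massoc mult_ac)
  \<comment> \<open>Interchange law: \<open>ev\<close> and \<open>F\<close> act on different tensor
    factors and can be applied in either order. Afterwards \<open>ev\<close> and \<open>co\<close>
    are adjacent and the first snake identity removes them.\<close>
  also have "kron ev ?x * kron (kron ?v ?w) F = kron (1\<^sub>m 1) F * kron ev (kron ?v ?m)"
    using F dims by (simp add: kron_mult kron_one mone)
  also have "\<dots> = F * kron (kron ev ?v) ?m" by (simp only: kron_one_left kron_assoc)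
  also have "\<dots> * kron (kron ?v co) ?m = F * kron (kron ev ?v * kron ?v co) (?m * ?m)"
    using F dims by (simp add: massoc kron_mult mult_ac)
  also have "\<dots> = F" using F by (simp add: snake mone kron_one)
  finally show ?thesis .
qed

lemma adj_coadj:
  assumes G: "dim_row G = hdim W * hdim X" "dim_col G = hdim M"
  shows "adj M (coadj X G) = G"
proof -
  let ?v = "1\<^sub>m (hdim V) :: 'k mat" and ?w = "1\<^sub>m (hdim W) :: 'k mat" and ?m = "1\<^sub>m (hdim M) :: 'k mat" and ?x = "1\<^sub>m (hdim X) :: 'k mat"
  have "kron ?w (kron ev ?x * kron ?v G) = kron ?w (kron ev ?x) * kron ?w (kron ?v G)"
    using G dims by (simp add: kron_mult mone mult_ac)
  then have "adj M (coadj X G) = kron (kron ?w ev) ?x * kron (kron ?w ?v) G * kron co ?m"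
    by (simp add: coadj_def adj_def kron_assoc)
  also have "\<dots> = kron (kron ?w ev) ?x * (kron (kron ?w ?v) G * kron co ?m)"
    using G dims by (simp add: massoc mult_ac)
  also have "kron (kron ?w ?v) G * kron co ?m = kron co (kron ?w ?x) * kron (1\<^sub>m 1) G"
    using G dims by (simp add: kron_mult kron_one mone)
  also have "\<dots> = kron (kron co ?w) ?x * G" by (simp only: kron_one_left kron_assoc)
  also have "kron (kron ?w ev) ?x * \<dots> = kron (kron ?w ev * kron co ?w) (?x * ?x) * G"
    using G dims by (simp add: massoc[symmetric] kron_mult mult_ac)
  also have "\<dots> = G" using G by (simp add: snake mone kron_one)
  finally show ?thesis .
qed

text \<open>The adjunction as an equality of dimensions: multiplicities of a tensor product with
  \<open>V\<close> are read off from \<open>M\<close> alone, tested against modules tensored with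
  the dual \<open>W\<close>.\<close>

lemma hom_dim_adj:
  assumes w: "wf_hmod M" "wf_hmod X"
  shows "hom_dim (H_tensor V M) X = hom_dim M (H_tensor W X)"
proof -
  have "bij_betw (adj M) (H_hom (H_tensor V M) X) (H_hom M (H_tensor W X))"
    by (rule bij_betw_byWitness[where f' = "coadj X"])
       (use adj_hom coadj_hom w in \<open>auto simp: coadj_adj adj_coadj\<close>)
  note bij = this
  show ?thesis
    unfolding hom_dim_def
    by (rule sdim_eq[OF H_hom_msub H_hom_msub bij])
      (use w wf in \<open>auto simp: wf_tensor adj_def kron_add kron_smult mdist_right msmult dims mult_ac\<close>)
qed

text \<open>A left adjoint of a functor that preserves surjections preserves projectives. The
  surjection \<open>F\<close> stays surjective after tensoring with \<open>W\<close>, because its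
  right inverse \<open>R\<close> does; the transposed map lifts, and the lift is transposed
  back.\<close>

lemma tensor_projective:
  assumes M: "H_projective n q M" and mod: "H_module n q (H_tensor V M)"
    "\<And>X. H_module n q X \<Longrightarrow> H_module n q (H_tensor W X)"
  shows "H_projective n q (H_tensor V M)"
proof (rule projectiveI[OF mod(1)])
  fix A B F R G
  assume A: "H_module n q A" and B: "H_module n q B" and F: "F \<in> H_hom A B"
    "R \<in> carrier_mat (hdim A) (hdim B)" "F * R = 1\<^sub>m (hdim B)" and G: "G \<in> H_hom (H_tensor V M) B"
  note w = H_module_wf[OF A] H_module_wf[OF B] projective_wf[OF M]
  let ?v = "1\<^sub>m (hdim V) :: 'k mat" and ?w = "1\<^sub>m (hdim W) :: 'k mat"
  note dF = H_homD[OF F(1)] carrier_matD[OF F(2)]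
  have "kron ?w F * kron ?w R = 1\<^sub>m (hdim (H_tensor W B))" "kron ?w R \<in> carrier_mat (hdim (H_tensor W A)) (hdim (H_tensor W B))"
    using dF F(3) by (auto simp: kron_mult mone kron_one)
  then obtain L where L: "L \<in> H_hom M (H_tensor W A)" "kron ?w F * L = adj M G"
    using projective_lift[OF M mod(2)[OF A] mod(2)[OF B] tensor_hom_right[OF F(1) w(1,2) wf(3)] _ _ adj_hom[OF G w(3,2)]]
    by blast
  note dL = H_homD[OF L(1), simplified]
  have "F * coadj A L = kron (1\<^sub>m 1) F * kron ev (1\<^sub>m (hdim A)) * kron ?v L"
    using dF dL dims by (simp add: coadj_def massoc mult_ac kron_one_left[simplified])
  also have "kron (1\<^sub>m 1) F * kron ev (1\<^sub>m (hdim A)) = kron ev (1\<^sub>m (hdim B)) * kron (kron ?v ?w) F"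
    using dF dims by (simp add: kron_mult kron_one mone)
  also have "\<dots> * kron ?v L = kron ev (1\<^sub>m (hdim B)) * kron ?v (kron ?w F * L)"
    using dF dims dL by (simp add: kron_mult mone massoc kron_assoc mult_ac)
  also have "\<dots> = coadj B (adj M G)" unfolding L coadj_def ..
  also have "\<dots> = G" using H_homD[OF G] by (simp add: coadj_adj)
  finally show "\<exists>L\<in>H_hom (H_tensor V M) A. F * L = G"
    using coadj_hom[OF L(1) w(3,1)] by blast
qed

end

section \<open>Gaussian integers and the defining relations on a tensor product\<close>

lemma qint_Suc: "qint q (Suc k) = 1 + q * qint q k"
proof -
  have "qint q (Suc k) = q ^ 0 + (\<Sum>j<k. q ^ Suc j)" unfolding qint_def by (rule sum.lessThan_Suc_shift)
  then show ?thesis by (simp add: qint_def sum_distrib_left)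
qed

lemma qint_0 [simp]: "qint q 0 = 0" by (simp add: qint_def)

lemma qint_geometric: "(q - 1) * qint q k = q ^ k - 1"
  unfolding qint_def by (simp add: power_diff_1_eq)

lemma pow_mat_Suc_left:
  fixes A :: "'k::semiring_1 mat"
  assumes "A \<in> carrier_mat r r"
  shows "A ^\<^sub>m Suc k = A * A ^\<^sub>m k"
proof (induction k)
  case (Suc k)
  then show ?case using assms by (simp add: massoc)
qed (use assms in auto)

text \<open>The q-binomial theorem truncated by \<open>X * X = 0\<close>: terms with two or more
  factors \<open>X\<close> vanish, and moving the single remaining \<open>X\<close> to the front
  from every possible position collects powers of \<open>p\<close> that add up to
  \<open>qint p (Suc k)\<close>.\<close>

lemma qbinomial_square_zero:
  fixes X Y :: "'k::field mat"
  assumes c: "X \<in> carrier_mat r r" "Y \<in> carrier_mat r r" and XX: "X * X = 0\<^sub>m r r"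
    and YX: "Y * X = p \<cdot>\<^sub>m (X * Y)"
  shows "(X + Y) ^\<^sub>m Suc k = Y ^\<^sub>m Suc k + qint p (Suc k) \<cdot>\<^sub>m (X * Y ^\<^sub>m k)"
proof (induction k)
  case 0
  then show ?case using c by (simp add: qint_Suc mone) (auto intro!: comm_add_mat)
next
  case (Suc k)
  let ?Z = "X * Y ^\<^sub>m Suc k"
  note d = carrier_matD[OF c(1)] carrier_matD[OF c(2)]
  have Yk: "Y * Y ^\<^sub>m k = Y ^\<^sub>m Suc k" for k using pow_mat_Suc_left[OF c(2)] by simp
  have dk: "dim_row (Y ^\<^sub>m k) = r" "dim_col (Y ^\<^sub>m k) = r" for k using c(2) by auto
  have 1: "X * (X * Y ^\<^sub>m k) = 0\<^sub>m r r" using d XX dk by (simp add: massoc[symmetric] mzero)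
  have 2: "Y * (X * Y ^\<^sub>m k) = p \<cdot>\<^sub>m ?Z"
  proof -
    have "Y * (X * Y ^\<^sub>m k) = p \<cdot>\<^sub>m (X * Y) * Y ^\<^sub>m k" using d dk YX by (simp add: massoc[symmetric])
    also have "\<dots> = p \<cdot>\<^sub>m (X * (Y * Y ^\<^sub>m k))" using d dk by (simp add: massoc msmult)
    finally show ?thesis unfolding Yk .
  qed
  have "(X + Y) ^\<^sub>m Suc (Suc k) = (X + Y) * (Y ^\<^sub>m Suc k + qint p (Suc k) \<cdot>\<^sub>m (X * Y ^\<^sub>m k))"
    using Suc pow_mat_Suc_left[of "X + Y" r "Suc k"] c by simp
  also have "\<dots> = (?Z + Y ^\<^sub>m Suc (Suc k)) + (0\<^sub>m r r + qint p (Suc k) \<cdot>\<^sub>m (p \<cdot>\<^sub>m ?Z))"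
  proof -
    have "(X + Y) * (Y ^\<^sub>m Suc k + qint p (Suc k) \<cdot>\<^sub>m (X * Y ^\<^sub>m k)) =
      X * Y ^\<^sub>m Suc k + Y * Y ^\<^sub>m Suc k + (qint p (Suc k) \<cdot>\<^sub>m (X * (X * Y ^\<^sub>m k)) + qint p (Suc k) \<cdot>\<^sub>m (Y * (X * Y ^\<^sub>m k)))"
      using d dk by (simp add: mdist_left mdist_right msmult del: pow_mat.simps)
        (auto intro!: eq_matI simp: algebra_simps simp del: pow_mat.simps)
    moreover have "c \<cdot>\<^sub>m 0\<^sub>m r r = (0\<^sub>m r r :: 'k mat)" for c :: 'k by (auto intro!: eq_matI)
    ultimately show ?thesis unfolding 1 2 Yk by simp
  qed
  also have "\<dots> = Y ^\<^sub>m Suc (Suc k) + qint p (Suc (Suc k)) \<cdot>\<^sub>m ?Z"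
    using d dk by (intro eq_matI) (auto simp: qint_Suc[of p "Suc k"] algebra_simps simp del: pow_mat.simps)
  finally show ?case .
qed

lemma primitive_qint_zero:
  assumes "primitive_root_of_unity n q" "n > 1"
  shows "qint q n = 0" "qint (inverse q) n = 0"
proof -
  have q: "q \<noteq> 1" "q ^ n = 1" using assms unfolding primitive_root_of_unity_def
    by (metis less_numeral_extra(1) power_one_right)+
  then have "q \<noteq> 0" using assms by (metis gr_implies_not0 power_0_left zero_neq_one)
  then have "inverse q \<noteq> 1" "inverse q ^ n = 1" using q by (auto simp: power_inverse)
  then show "qint q n = 0" "qint (inverse q) n = 0"
    using q qint_geometric[of q n] qint_geometric[of "inverse q" n] by auto
qed

text \<open>Only a^n = 0 and d^n = 0 are not immediate from the factors. The square-zero hypotheses,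
  valid for V(1, r) and V(2, r), leave one mixed term in the binomial expansion, and its coefficient
  is the n-th Gaussian integer at q or 1/q, which is zero.\<close>

lemma tensor_module:
  assumes prim: "primitive_root_of_unity n q" "n > 1"
    and M: "H_module n q M" and N: "H_module n q N"
    and sq: "act_a M * act_a M = 0\<^sub>m (hdim M) (hdim M)" "act_d M * act_d M = 0\<^sub>m (hdim M) (hdim M)"
  shows "H_module n q (H_tensor M N)"
proof -
  define a b c d where ab: "a = act_a M" "b = act_b M" "c = act_c M" "d = act_d M"
  define a' b' c' d' where ab': "a' = act_a N" "b' = act_b N" "c' = act_c N" "d' = act_d N"
  let ?m = "hdim M" and ?n = "hdim N"
  let ?I = "1\<^sub>m ?m :: 'a mat" and ?J = "1\<^sub>m ?n :: 'a mat"
  note M' = M[unfolded H_module_def Let_def, folded ab] and N' = N[unfolded H_module_def Let_def, folded ab']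
  have q0: "q \<noteq> 0" using prim unfolding primitive_root_of_unity_def by (metis gr_implies_not0 power_0_left zero_neq_one)
  have dm: "dim_row a = ?m" "dim_col a = ?m" "dim_row b = ?m" "dim_col b = ?m" "dim_row c = ?m" "dim_col c = ?m"
    "dim_row d = ?m" "dim_col d = ?m"  "dim_row a' = ?n" "dim_col a' = ?n" "dim_row b' = ?n" "dim_col b' = ?n"
    "dim_row c' = ?n" "dim_col c' = ?n" "dim_row d' = ?n" "dim_col d' = ?n"
    using M' N' by auto
  have rM: "b * a = q \<cdot>\<^sub>m (a * b)" "d * b = q \<cdot>\<^sub>m (b * d)" "c * a = q \<cdot>\<^sub>m (a * c)" "d * c = q \<cdot>\<^sub>m (c * d)"
    "c * b = b * c" "d * a - q \<cdot>\<^sub>m (a * d) = ?I - b * c" using M' by auto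
  have rN: "b' * a' = q \<cdot>\<^sub>m (a' * b')" "d' * b' = q \<cdot>\<^sub>m (b' * d')" "c' * a' = q \<cdot>\<^sub>m (a' * c')" "d' * c' = q \<cdot>\<^sub>m (c' * d')"
    "c' * b' = b' * c'" "d' * a' - q \<cdot>\<^sub>m (a' * d') = ?J - b' * c'" using N' by auto
  have move: "X = Y + Z" if "X - Y = Z" "dim_row X = k" "dim_col X = k" "dim_row Y = k" "dim_col Y = k" for X Y Z :: "'a mat" and k
    using that by (auto intro!: eq_matI)
  have da: "d * a = q \<cdot>\<^sub>m (a * d) + (?I - b * c)" by (rule move[OF rM(6)]) (use dm in auto)
  have da': "d' * a' = q \<cdot>\<^sub>m (a' * d') + (?J - b' * c')" by (rule move[OF rN(6)]) (use dm in auto)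
  let ?A = "kron a b' + kron ?I a'" and ?B = "kron b b'" and ?C = "kron c c'" and ?D = "kron d c' + kron ?I d'"
  note alg = mdist_left mdist_right kron_mult mone msmult kron_smult kron_add
  have add: "k \<cdot>\<^sub>m X + k \<cdot>\<^sub>m Y = k \<cdot>\<^sub>m (X + Y)" if "dim_row X = dim_row Y" "dim_col X = dim_col Y" for k and X Y :: "'a mat"
    using that by (auto intro!: eq_matI simp: algebra_simps)
  have 1: "?B * ?A = q \<cdot>\<^sub>m (?A * ?B)" using dm by (simp add: alg rM rN add)
  have 2: "?D * ?B = q \<cdot>\<^sub>m (?B * ?D)" using dm by (simp add: alg rM rN add)
  have 3: "?C * ?A = q \<cdot>\<^sub>m (?A * ?C)" using dm by (simp add: alg rM rN add)
  have 4: "?D * ?C = q \<cdot>\<^sub>m (?C * ?D)" using dm by (simp add: alg rM rN add)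
  have 5: "?B * ?C = ?C * ?B" using dm by (simp add: alg rM rN)
  have 6: "?B ^\<^sub>m n = 1\<^sub>m (?m * ?n)" "?C ^\<^sub>m n = 1\<^sub>m (?m * ?n)"
    using M' N' kron_pow[of b ?m b' ?n n] kron_pow[of c ?m c' ?n n] by (auto simp: kron_one)
  have pow: "kron ?I Z ^\<^sub>m n = 0\<^sub>m (?m * ?n) (?m * ?n)" if "Z \<in> carrier_mat ?n ?n" "Z ^\<^sub>m n = 0\<^sub>m ?n ?n" for Z :: "'a mat"
    using kron_pow[of ?I ?m Z ?n n] that by (simp add: kron_zero)
  obtain k where k: "n = Suc k" using prim by (cases n) auto
  have 7: "?A ^\<^sub>m n = 0\<^sub>m (?m * ?n) (?m * ?n)"
  proof -
    \<comment> \<open>The second factors meet in the order a b, which is 1/q times b a. For d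
      further down they meet as d c = q c d, so the parameter is q.\<close>
    have "kron ?I a' * kron a b' = inverse q \<cdot>\<^sub>m (kron a b' * kron ?I a')"
      using dm q0 by (simp add: alg rN) (auto intro!: eq_matI simp: q0)
    moreover have "kron a b' * kron a b' = 0\<^sub>m (?m * ?n) (?m * ?n)"
      using dm sq by (simp add: alg ab[symmetric] kron_zero)
    moreover have "kron a b' \<in> carrier_mat (?m * ?n) (?m * ?n)" "kron ?I a' \<in> carrier_mat (?m * ?n) (?m * ?n)"
      using dm by auto
    ultimately have "(kron a b' + kron ?I a') ^\<^sub>m Suc k =
      kron ?I a' ^\<^sub>m Suc k + qint (inverse q) (Suc k) \<cdot>\<^sub>m (kron a b' * kron ?I a' ^\<^sub>m k)"
      by (intro qbinomial_square_zero)
    moreover have "kron ?I a' ^\<^sub>m Suc k = 0\<^sub>m (?m * ?n) (?m * ?n)"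
      using pow[of a'] N' unfolding k by blast
    moreover have "qint (inverse q) (Suc k) = 0" using primitive_qint_zero[OF prim] unfolding k by simp
    ultimately show ?thesis unfolding k using dm
      by (simp del: pow_mat.simps) (auto intro!: eq_matI)
  qed
  have 8: "?D ^\<^sub>m n = 0\<^sub>m (?m * ?n) (?m * ?n)"
  proof -
    have "kron ?I d' * kron d c' = q \<cdot>\<^sub>m (kron d c' * kron ?I d')"
      using dm by (simp add: alg rN)
    moreover have "kron d c' * kron d c' = 0\<^sub>m (?m * ?n) (?m * ?n)"
      using dm sq by (simp add: alg ab[symmetric] kron_zero)
    moreover have "kron d c' \<in> carrier_mat (?m * ?n) (?m * ?n)" "kron ?I d' \<in> carrier_mat (?m * ?n) (?m * ?n)"
      using dm by auto
    ultimately have "(kron d c' + kron ?I d') ^\<^sub>m Suc k =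
      kron ?I d' ^\<^sub>m Suc k + qint q (Suc k) \<cdot>\<^sub>m (kron d c' * kron ?I d' ^\<^sub>m k)"
      by (intro qbinomial_square_zero)
    moreover have "kron ?I d' ^\<^sub>m Suc k = 0\<^sub>m (?m * ?n) (?m * ?n)"
      using pow[of d'] N' unfolding k by blast
    moreover have "qint q (Suc k) = 0" using primitive_qint_zero[OF prim] unfolding k by simp
    ultimately show ?thesis unfolding k using dm
      by (simp del: pow_mat.simps) (auto intro!: eq_matI)
  qed
  have 9: "?D * ?A - q \<cdot>\<^sub>m (?A * ?D) = 1\<^sub>m (?m * ?n) - ?B * ?C"
    using dm by (simp add: alg da da' rM rN kron_one[symmetric])
      (auto intro!: eq_matI simp: algebra_simps kron_one)
  have acts: "act_a (H_tensor M N) = ?A" "act_b (H_tensor M N) = ?B" "act_c (H_tensor M N) = ?C"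
    "act_d (H_tensor M N) = ?D" by (simp_all add: H_tensor_def ab ab')
  have car: "?A \<in> carrier_mat (?m * ?n) (?m * ?n)" "?B \<in> carrier_mat (?m * ?n) (?m * ?n)"
    "?C \<in> carrier_mat (?m * ?n) (?m * ?n)" "?D \<in> carrier_mat (?m * ?n) (?m * ?n)"
    using dm by auto
  show ?thesis
    unfolding H_module_def Let_def acts hdim_tensor using car 1 2 3 4 5 6 7 8 9 by blast
qed

subsection \<open>Strings and simple modules\<close>

lemma mult_mat_unit:
  fixes A :: "'k::semiring_1 mat"
  shows "j < dim_col A \<Longrightarrow> A *\<^sub>v unit_vec (dim_col A) j = col A j"
  by (rule eq_vecI) (simp_all add: scalar_prod_right_unit)

lemma mat_eq_vecI:
  fixes A B :: "'k::semiring_1 mat"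
  assumes "A \<in> carrier_mat r c" "B \<in> carrier_mat r c"
    "\<And>j. j < c \<Longrightarrow> A *\<^sub>v unit_vec c j = B *\<^sub>v unit_vec c j"
  shows "A = B"
proof (rule eq_matI)
  fix i j assume ij: "i < dim_row B" "j < dim_col B"
  then have "col A j = col B j" using assms mult_mat_unit[of j A] mult_mat_unit[of j B] by auto
  then have "col A j $ i = col B j $ i" by simp
  then show "A $$ (i, j) = B $$ (i, j)" using ij assms by simp
qed (use assms in auto)

lemma sum_single:
  fixes f X :: "nat \<Rightarrow> 'a::comm_ring_1"
  shows "(\<Sum>k = 0..<N. (if k = u then f k else 0) * X k) = (if u < N then f u * X u else 0)"
    "(\<Sum>k = 0..<N. (if u = k then f k else 0) * X k) = (if u < N then f u * X u else 0)"
    "(\<Sum>k = 0..<N. X k * (if k = u then f k else 0)) = (if u < N then X u * f u else 0)"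
    "(\<Sum>k = 0..<N. X k * (if u = k then f k else 0)) = (if u < N then X u * f u else 0)"
  by (auto simp: if_distrib if_distribR cong: if_cong)

lemma sum_single_Suc:
  fixes f X :: "nat \<Rightarrow> 'a::comm_ring_1"
  shows "(\<Sum>k = 0..<N. (if u = Suc k then f k else 0) * X k) = (if 0 < u \<and> u - 1 < N then f (u - 1) * X (u - 1) else 0)"
    "(\<Sum>k = 0..<N. X k * (if u = Suc k then f k else 0)) = (if 0 < u \<and> u - 1 < N then X (u - 1) * f (u - 1) else 0)"
proof -
  have e: "(u = Suc k) = (0 < u \<and> k = u - 1)" for k by auto
  show "(\<Sum>k = 0..<N. (if u = Suc k then f k else 0) * X k) = (if 0 < u \<and> u - 1 < N then f (u - 1) * X (u - 1) else 0)"
    "(\<Sum>k = 0..<N. X k * (if u = Suc k then f k else 0)) = (if 0 < u \<and> u - 1 < N then X (u - 1) * f (u - 1) else 0)"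
    unfolding e by (cases u; simp add: sum_single)+
qed

lemmas sum_singles = sum_single sum_single_Suc

lemma H_module_vec:
  assumes M: "H_module n q M" and v: "v \<in> carrier_vec (hdim M)"
  shows "act_b M *\<^sub>v (act_a M *\<^sub>v v) = q \<cdot>\<^sub>v (act_a M *\<^sub>v (act_b M *\<^sub>v v))"
    "act_d M *\<^sub>v (act_b M *\<^sub>v v) = q \<cdot>\<^sub>v (act_b M *\<^sub>v (act_d M *\<^sub>v v))"
    "act_c M *\<^sub>v (act_a M *\<^sub>v v) = q \<cdot>\<^sub>v (act_a M *\<^sub>v (act_c M *\<^sub>v v))"
    "act_d M *\<^sub>v (act_c M *\<^sub>v v) = q \<cdot>\<^sub>v (act_c M *\<^sub>v (act_d M *\<^sub>v v))"
    "act_b M *\<^sub>v (act_c M *\<^sub>v v) = act_c M *\<^sub>v (act_b M *\<^sub>v v)"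
    "act_d M *\<^sub>v (act_a M *\<^sub>v v) = q \<cdot>\<^sub>v (act_a M *\<^sub>v (act_d M *\<^sub>v v)) + (v - act_b M *\<^sub>v (act_c M *\<^sub>v v))"
proof -
  define a b c d where ab: "a = act_a M" "b = act_b M" "c = act_c M" "d = act_d M"
  let ?m = "hdim M"
  note M' = M[unfolded H_module_def Let_def, folded ab]
  have c: "a \<in> carrier_mat ?m ?m" "b \<in> carrier_mat ?m ?m" "c \<in> carrier_mat ?m ?m" "d \<in> carrier_mat ?m ?m"
    using M' by auto
  note dm = carrier_matD[OF c(1)] carrier_matD[OF c(2)] carrier_matD[OF c(3)] carrier_matD[OF c(4)]
  have as: "X *\<^sub>v (Y *\<^sub>v v) = (X * Y) *\<^sub>v v" if "X \<in> carrier_mat ?m ?m" "Y \<in> carrier_mat ?m ?m" for X Y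
    using assoc_mult_mat_vec[OF that v] by simp
  have sm: "(k \<cdot>\<^sub>m X) *\<^sub>v v = k \<cdot>\<^sub>v (X *\<^sub>v v)" if "X \<in> carrier_mat ?m ?m" for X k
    using that v by (auto intro!: eq_vecI simp: smult_scalar_prod_distrib[of _ ?m])
  have pr: "X * Y \<in> carrier_mat ?m ?m" if "X \<in> carrier_mat ?m ?m" "Y \<in> carrier_mat ?m ?m" for X Y :: "'a mat"
    using that by auto
  have r: "b * a = q \<cdot>\<^sub>m (a * b)" "d * b = q \<cdot>\<^sub>m (b * d)" "c * a = q \<cdot>\<^sub>m (a * c)" "d * c = q \<cdot>\<^sub>m (c * d)"
    "b * c = c * b" and da: "d * a - q \<cdot>\<^sub>m (a * d) = 1\<^sub>m ?m - b * c" using M' by auto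
  show "act_b M *\<^sub>v (act_a M *\<^sub>v v) = q \<cdot>\<^sub>v (act_a M *\<^sub>v (act_b M *\<^sub>v v))"
    "act_d M *\<^sub>v (act_b M *\<^sub>v v) = q \<cdot>\<^sub>v (act_b M *\<^sub>v (act_d M *\<^sub>v v))"
    "act_c M *\<^sub>v (act_a M *\<^sub>v v) = q \<cdot>\<^sub>v (act_a M *\<^sub>v (act_c M *\<^sub>v v))"
    "act_d M *\<^sub>v (act_c M *\<^sub>v v) = q \<cdot>\<^sub>v (act_c M *\<^sub>v (act_d M *\<^sub>v v))"
    "act_b M *\<^sub>v (act_c M *\<^sub>v v) = act_c M *\<^sub>v (act_b M *\<^sub>v v)"
    unfolding ab[symmetric] by (simp_all only: as c r sm pr)
  have "d * a = q \<cdot>\<^sub>m (a * d) + (1\<^sub>m ?m - b * c)"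
  proof (rule eq_matI)
    fix i j assume ij: "i < dim_row (q \<cdot>\<^sub>m (a * d) + (1\<^sub>m ?m - b * c))" "j < dim_col (q \<cdot>\<^sub>m (a * d) + (1\<^sub>m ?m - b * c))"
    have "(d * a - q \<cdot>\<^sub>m (a * d)) $$ (i, j) = (1\<^sub>m ?m - b * c) $$ (i, j)" using da by simp
    then show "(d * a) $$ (i, j) = (q \<cdot>\<^sub>m (a * d) + (1\<^sub>m ?m - b * c)) $$ (i, j)"
      using ij dm by (simp add: algebra_simps)
  qed (use dm in auto)
  then have "(d * a) *\<^sub>v v = (q \<cdot>\<^sub>m (a * d)) *\<^sub>v v + (1\<^sub>m ?m - b * c) *\<^sub>v v"
    using add_mult_distrib_mat_vec[of "q \<cdot>\<^sub>m (a * d)" ?m ?m "1\<^sub>m ?m - b * c" v]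
      pr[OF c(1,4)] minus_carrier_mat[OF pr[OF c(2,3)], of "1\<^sub>m ?m"] v
    by simp
  moreover have "(1\<^sub>m ?m - b * c) *\<^sub>v v = v - (b * c) *\<^sub>v v"
    using c v by (simp add: minus_mult_distrib_mat_vec[of _ ?m ?m])
  ultimately show "act_d M *\<^sub>v (act_a M *\<^sub>v v) = q \<cdot>\<^sub>v (act_a M *\<^sub>v (act_d M *\<^sub>v v)) + (v - act_b M *\<^sub>v (act_c M *\<^sub>v v))"
    unfolding ab[symmetric] by (simp only: as c sm pr)
qed

text \<open>The coefficient of d along a string: if d kills u and b c acts on u by q^z, then d a^j u
  is \<open>beta q z j\<close> times a^(j-1) u. At z = 1 - l it is
  \<open>simple_alpha q l j\<close>.\<close>

definition beta :: "'k::field \<Rightarrow> int \<Rightarrow> nat \<Rightarrow> 'k" where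
  "beta q z j = qint q j * (1 - q powi (z + int j - 1))"

text \<open>A string of length t under the action of a whose first vector has b-weight q^x and c-weight
  q^y and is annihilated by d; for t = n this includes the Verma modules.\<close>

definition string_mod :: "'k::field \<Rightarrow> nat \<Rightarrow> int \<Rightarrow> int \<Rightarrow> 'k hmod" where
  "string_mod q t x y = \<lparr> hdim = t,
     act_a = mat t t (\<lambda>(i, j). if i = Suc j then 1 else 0),
     act_b = mat t t (\<lambda>(i, j). if i = j then q powi (x + int j) else 0),
     act_c = mat t t (\<lambda>(i, j). if i = j then q powi (y + int j) else 0),
     act_d = mat t t (\<lambda>(i, j). if j = Suc i then beta q (x + y) j else 0) \<rparr>"

lemma hdim_string [simp]: "hdim (string_mod q t x y) = t"
  by (simp add: string_mod_def)

lemma wf_string: "wf_hmod (string_mod q t x y)"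
  by (simp add: wf_hmod_def all_gen string_mod_def)

lemma V_string: "V q l r = string_mod q l r (1 - r - int l)"
proof -
  have 1: "q powi (int j + 1 - r - int l) = q powi (1 - r - int l + int j)" for j
    by (simp add: algebra_simps)
  have 2: "simple_alpha q l j = beta q (r + (1 - r - int l)) j" for j
    by (simp add: simple_alpha_def beta_def)
  show ?thesis unfolding V_def string_mod_def 1 2 by simp
qed

lemma hdim_V [simp]: "hdim (V q l r) = l"
  by (simp add: V_def)

lemma wf_V: "wf_hmod (V q l r)"
  unfolding V_string by (rule wf_string)

locale root_of_unity =
  fixes n :: nat and q :: "'k::field"
  assumes n2: "n > 2" and prim: "primitive_root_of_unity n q"
begin

lemma q_pow_n: "q ^ n = 1" using prim by (simp add: primitive_root_of_unity_def)

lemma q0: "q \<noteq> 0" using q_pow_n n2 by (metis gr_implies_not0 power_0_left zero_neq_one)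

lemma q_powi_add: "q powi (z + w) = q powi z * q powi w" using q0 by (simp add: power_int_add)

lemma q_powi_Suc: "q powi (z + 1) = q * q powi z" using q0 by (simp add: power_int_add mult.commute)

lemma q_powi_eq_1_iff: "q powi z = 1 \<longleftrightarrow> int n dvd z"
proof -
  have pn: "q powi (int n * w) = 1" for w
    using q_pow_n by (simp add: power_int_mult)
  have "q powi z = q powi (z mod int n)"
    using q_powi_add[of "int n * (z div int n)" "z mod int n"] pn by simp
  also have "\<dots> = q ^ nat (z mod int n)" using n2 by (simp add: power_int_def)
  also have "\<dots> = 1 \<longleftrightarrow> nat (z mod int n) = 0"
    using prim n2 nat_less_iff[of "z mod int n" n] unfolding primitive_root_of_unity_def
    by (metis neq0_conv pos_mod_bound pos_mod_sign power_0 of_nat_0_less_iff)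
  also have "\<dots> \<longleftrightarrow> int n dvd z" using n2
    by (metis dvd_eq_mod_eq_0 nat_0 nat_eq_iff of_nat_0 of_nat_0_less_iff order_less_trans pos_mod_sign zero_less_numeral)
  finally show ?thesis .
qed

lemma q_powi_eq_iff: "q powi z = q powi w \<longleftrightarrow> int n dvd z - w"
proof -
  have "q powi z = q powi (z - w) * q powi w" using q_powi_add[of "z - w" w] by simp
  then have "q powi z = q powi w \<longleftrightarrow> q powi (z - w) = 1" using q0 by simp
  then show ?thesis by (simp add: q_powi_eq_1_iff)
qed

lemma qint_eq_0_iff: "qint q k = 0 \<longleftrightarrow> n dvd k"
proof -
  have "q \<noteq> 1" using q_powi_eq_1_iff[of 1] n2 by auto
  then have "qint q k = 0 \<longleftrightarrow> q ^ k = 1" using qint_geometric[of q k] by auto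
  also have "\<dots> \<longleftrightarrow> n dvd k" using q_powi_eq_1_iff[of "int k"] by (simp add: power_int_def)
  finally show ?thesis .
qed

text \<open>The relation d a - q a d = 1 - b c read on the j-th vector of a string, where b c acts
  by q^(z + 2j). Together with \<open>beta_0\<close> it determines \<open>beta\<close>.\<close>

lemma beta_Suc: "beta q z (Suc j) = q * beta q z j + (1 - q powi (z + 2 * int j))"
proof -
  have 1: "q powi (z + int (Suc j) - 1) = q * q powi (z + int j - 1)"
    using q_powi_Suc[of "z + int j - 1"] by (simp add: algebra_simps)
  have "q powi (z + 2 * int j) = q powi (z + int j - 1 + 1) * q powi (int j)"
    unfolding q_powi_add[symmetric] by (simp add: algebra_simps)
  then have 2: "q powi (z + 2 * int j) = q * q powi (z + int j - 1) * q ^ j"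
    unfolding q_powi_Suc by simp
  have 3: "q ^ j = (q - 1) * qint q j + 1" using qint_geometric[of q j] by simp
  show ?thesis unfolding beta_def 1 2 3 qint_Suc by (simp add: algebra_simps)
qed

lemma beta_0 [simp]: "beta q z 0 = 0" by (simp add: beta_def)

lemma beta_eq_0_iff: "beta q z j = 0 \<longleftrightarrow> n dvd j \<or> int n dvd z + int j - 1"
  using q_powi_eq_1_iff[of "z + int j - 1"] by (auto simp: beta_def qint_eq_0_iff)

lemma beta_n [simp]: "beta q z n = 0" by (simp add: beta_eq_0_iff)

text \<open>On the last vector a gives zero, while the recurrence for d continues to the index
  \<open>t\<close>; the hypothesis on \<open>beta\<close> reconciles the two. The bound
  \<open>t \<le> n\<close> gives a^n = 0 and d^n = 0, as both shift the basis.\<close>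

lemma string_module:
  assumes t: "t \<le> n" "beta q (x + y) t = 0"
  shows "H_module n q (string_mod q t x y)"
proof -
  let ?a = "mat t t (\<lambda>(i, j). if i = Suc j then 1 else 0) :: 'k mat"
  let ?b = "mat t t (\<lambda>(i, j). if i = j then q powi (x + int j) else 0) :: 'k mat"
  let ?c = "mat t t (\<lambda>(i, j). if i = j then q powi (y + int j) else 0) :: 'k mat"
  let ?d = "mat t t (\<lambda>(i, j). if j = Suc i then beta q (x + y) j else 0) :: 'k mat"
  have es: "q powi (z + (1 + int j)) = q * q powi (z + int j)" for z j
    using q_powi_Suc[of "z + int j"] by (simp add: algebra_simps)
  note s = scalar_prod_def sum_singles
  have 1: "?b * ?a = q \<cdot>\<^sub>m (?a * ?b)" "?c * ?a = q \<cdot>\<^sub>m (?a * ?c)"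
    by (rule eq_matI; auto simp: s es)+
  have 2: "?d * ?b = q \<cdot>\<^sub>m (?b * ?d)" "?d * ?c = q \<cdot>\<^sub>m (?c * ?d)"
    by (rule eq_matI; auto simp: s es)+
  have 3: "?b * ?c = ?c * ?b" by (rule eq_matI) (auto simp: s)
  have pb: "mat t t (\<lambda>(i, j). if i = j then q powi (z + int j) else 0) ^\<^sub>m n = 1\<^sub>m t" for z
  proof -
    have "mat t t (\<lambda>(i, j). if i = j then q powi (z + int j) else 0) ^\<^sub>m k =
      mat t t (\<lambda>(i, j). if i = j then (q powi (z + int j)) ^ k else 0)" for k
    proof (induction k)
      case (Suc k)
      then show ?case by (simp add: Suc) (rule eq_matI; auto simp: s)
    qed (auto intro!: eq_matI)
    moreover have "(q powi w) ^ n = 1" for w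
      using q_pow_n by (metis power_int_mult power_int_of_nat mult.commute power_int_1_left)
    ultimately show ?thesis by (auto intro!: eq_matI)
  qed
  have pa: "(?a ^\<^sub>m k) $$ (i, j) = (if i = j + k then 1 else 0)" if "i < t" "j < t" for k i j
    using that
  proof (induction k arbitrary: i j)
    case (Suc k)
    have "(?a ^\<^sub>m Suc k) $$ (i, j) = (\<Sum>l = 0..<t. (?a ^\<^sub>m k) $$ (i, l) * ?a $$ (l, j))"
      using Suc.prems by (simp add: scalar_prod_def)
    also have "\<dots> = (\<Sum>l = 0..<t. (if i = l + k then 1 else 0) * (if l = Suc j then 1 else 0))"
      using Suc by (intro sum.cong) auto
    also have "\<dots> = (if i = j + Suc k then 1 else 0)" using Suc.prems by (simp add: sum_singles)
    finally show ?case .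
  qed auto
  have pd: "(?d ^\<^sub>m k) $$ (i, j) = 0" if "i < t" "j < t" "j \<noteq> i + k" for k i j
    using that
  proof (induction k arbitrary: i j)
    case (Suc k)
    have "(?d ^\<^sub>m Suc k) $$ (i, j) = (\<Sum>l = 0..<t. (?d ^\<^sub>m k) $$ (i, l) * ?d $$ (l, j))"
      using Suc.prems by (simp add: scalar_prod_def)
    also have "\<dots> = 0"
    proof (rule sum.neutral, rule ballI)
      fix l assume l: "l \<in> {0..<t}"
      show "(?d ^\<^sub>m k) $$ (i, l) * ?d $$ (l, j) = 0"
        using Suc.IH[of i l] Suc.prems l by (cases "l = i + k") auto
    qed
    finally show ?case .
  qed auto
  have 4: "?a ^\<^sub>m n = 0\<^sub>m t t" "?d ^\<^sub>m n = 0\<^sub>m t t"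
    by (rule eq_matI; use t in \<open>auto simp: pa intro!: pd\<close>)+
  have "?d * ?a - q \<cdot>\<^sub>m (?a * ?d) = 1\<^sub>m t - ?b * ?c"
  proof (rule eq_matI)
    fix i j assume "i < dim_row (1\<^sub>m t - ?b * ?c)" "j < dim_col (1\<^sub>m t - ?b * ?c)"
    then have ij: "i < t" "j < t" by auto
    show "(?d * ?a - q \<cdot>\<^sub>m (?a * ?d)) $$ (i, j) = (1\<^sub>m t - ?b * ?c) $$ (i, j)"
    proof (cases "i = j")
      case False
      then show ?thesis using ij by (auto simp: s)
    next
      case True
      have da: "(?d * ?a) $$ (j, j) = beta q (x + y) (Suc j)"
      proof (cases "Suc j < t")
        case False
        then have "t = Suc j" using ij by simp
        then show ?thesis using t ij by (simp add: s)
      qed (use ij in \<open>simp add: s\<close>)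
      have ad: "(?a * ?d) $$ (j, j) = beta q (x + y) j" using ij by (cases j) (auto simp: s)
      have bc: "(?b * ?c) $$ (j, j) = q powi (x + y + 2 * int j)"
        using ij by (simp add: s) (simp add: q_powi_add[symmetric] algebra_simps)
      have "(?d * ?a - q \<cdot>\<^sub>m (?a * ?d)) $$ (j, j) = (?d * ?a) $$ (j, j) - q * (?a * ?d) $$ (j, j)"
        using ij by simp
      also have "\<dots> = 1 - (?b * ?c) $$ (j, j)" unfolding da ad bc beta_Suc by simp
      finally show ?thesis using ij True by simp
    qed
  qed auto
  then show ?thesis
    unfolding H_module_def Let_def string_mod_def using 1 2 3 4 pb[of x] pb[of y] by simp
qed

lemma V_module: "m \<le> n \<Longrightarrow> H_module n q (V q m s)"
  unfolding V_string by (rule string_module) (simp_all add: beta_eq_0_iff)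

text \<open>In V(m, x) the c-weight exponent of the first vector is 1 - x - m, and exponents of q
  matter only modulo n.\<close>

lemma string_eq_V:
  assumes "int n dvd x + y + int m - 1"
  shows "string_mod q m x y = V q m x"
proof -
  have 1: "q powi (y + int j) = q powi (1 - x - int m + int j)" for j
    using assms unfolding q_powi_eq_iff by (simp add: algebra_simps)
  have 2: "q powi (x + y + int j - 1) = q powi (x + (1 - x - int m) + int j - 1)" for j
    using assms unfolding q_powi_eq_iff by (simp add: algebra_simps)
  show ?thesis unfolding V_string string_mod_def 1 beta_def 2 ..
qed

lemma V_cong:
  assumes "int n dvd s - s'"
  shows "V q m s = V q m s'"
proof -
  have 1: "q powi (s + int j) = q powi (s' + int j)" for j using assms unfolding q_powi_eq_iff by simp
  have "int n dvd s' - s" using assms by (simp add: dvd_diff_commute)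
  then have 2: "q powi (1 - s - int m + int j) = q powi (1 - s' - int m + int j)" for j
    unfolding q_powi_eq_iff by simp
  have 3: "s + (1 - s - int m) = s' + (1 - s' - int m)" by simp
  show ?thesis unfolding V_string string_mod_def 1 2 3 ..
qed

end

subsection \<open>Singular vectors\<close>

lemma H_hom_vec:
  assumes F: "F \<in> H_hom M N" and w: "wf_hmod M" "wf_hmod N" and v: "v \<in> carrier_vec (hdim M)"
  shows "F *\<^sub>v (act M g *\<^sub>v v) = act N g *\<^sub>v (F *\<^sub>v v)"
proof -
  have c: "F \<in> carrier_mat (hdim N) (hdim M)" "act M g \<in> carrier_mat (hdim M) (hdim M)"
    "act N g \<in> carrier_mat (hdim N) (hdim N)" using F w by (auto simp: H_hom_def wf_hmod_def)
  show ?thesis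
    using assoc_mult_mat_vec[OF c(1,2) v] assoc_mult_mat_vec[OF c(3,1) v] H_hom_act[OF F, of g] by simp
qed

lemma act_closed: "wf_hmod M \<Longrightarrow> v \<in> carrier_vec (hdim M) \<Longrightarrow> act M g *\<^sub>v v \<in> carrier_vec (hdim M)"
  by (auto simp: wf_hmod_def intro: mult_mat_vec_carrier)

lemma mult_mat_vec_smult:
  fixes A :: "'k::comm_ring_1 mat"
  shows "dim_vec v = dim_col A \<Longrightarrow> A *\<^sub>v (k \<cdot>\<^sub>v v) = k \<cdot>\<^sub>v (A *\<^sub>v v)"
  by (auto intro!: eq_vecI simp: scalar_prod_def sum_distrib_left mult_ac)

lemma mult_mat_vec_add:
  fixes A :: "'k::comm_ring_1 mat"
  shows "dim_vec v = dim_col A \<Longrightarrow> dim_vec w = dim_col A \<Longrightarrow> A *\<^sub>v (v + w) = A *\<^sub>v v + A *\<^sub>v w"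
  by (auto intro!: eq_vecI simp: scalar_prod_def sum.distrib algebra_simps)

lemma mult_mat_vec_zero:
  fixes A :: "'k::comm_ring_1 mat"
  shows "dim_col A = k \<Longrightarrow> A *\<^sub>v 0\<^sub>v k = 0\<^sub>v (dim_row A)"
  by (auto intro!: eq_vecI simp: scalar_prod_def)

lemma smult_mat_mult_vec:
  fixes A :: "'k::comm_ring_1 mat"
  shows "dim_vec v = dim_col A \<Longrightarrow> (k \<cdot>\<^sub>m A) *\<^sub>v v = k \<cdot>\<^sub>v (A *\<^sub>v v)"
  by (auto intro!: eq_vecI simp: scalar_prod_def sum_distrib_left mult_ac)

lemma smult_zero_vecs [simp]:
  fixes v :: "'k::comm_ring_1 vec"
  shows "0 \<cdot>\<^sub>v v = 0\<^sub>v (dim_vec v)" "k \<cdot>\<^sub>v 0\<^sub>v m = (0\<^sub>v m :: 'k vec)"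
  by (auto intro!: eq_vecI)

lemma pow_mat_vec_Suc:
  fixes A :: "'k::comm_ring_1 mat"
  assumes "A \<in> carrier_mat r r" "v \<in> carrier_vec r"
  shows "A ^\<^sub>m Suc k *\<^sub>v v = A *\<^sub>v (A ^\<^sub>m k *\<^sub>v v)" "A ^\<^sub>m k *\<^sub>v v \<in> carrier_vec r"
proof -
  have c: "A ^\<^sub>m k \<in> carrier_mat r r" using assms by simp
  show "A ^\<^sub>m k *\<^sub>v v \<in> carrier_vec r" by (rule mult_mat_vec_carrier[OF c assms(2)])
  show "A ^\<^sub>m Suc k *\<^sub>v v = A *\<^sub>v (A ^\<^sub>m k *\<^sub>v v)"
    unfolding pow_mat_Suc_left[OF assms(1)] using assms c by (simp add: assoc_mult_mat_vec[of _ r r _ r])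
qed

lemma nilpotent_last:
  fixes A :: "'k::comm_ring_1 mat"
  assumes A: "A \<in> carrier_mat r r" "A ^\<^sub>m N = 0\<^sub>m r r" and v: "v \<in> carrier_vec r" "v \<noteq> 0\<^sub>v r"
  obtains k where "A ^\<^sub>m k *\<^sub>v v \<noteq> 0\<^sub>v r" "A *\<^sub>v (A ^\<^sub>m k *\<^sub>v v) = 0\<^sub>v r" "k < N"
proof -
  let ?P = "\<lambda>k. A ^\<^sub>m k *\<^sub>v v = 0\<^sub>v r"
  have PN: "?P N" unfolding A(2) using v by (auto intro!: eq_vecI simp: scalar_prod_def)
  have P0: "\<not> ?P 0" using A v by simp
  define k where "k = (LEAST k. ?P k)"
  have Pk: "?P k" unfolding k_def by (rule LeastI[of ?P, OF PN])
  then have "k \<noteq> 0" using P0 by metis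
  then obtain l where l: "k = Suc l" by (cases k) auto
  have "\<not> ?P l" using not_less_Least[of l ?P] l unfolding k_def by simp
  moreover have "A *\<^sub>v (A ^\<^sub>m l *\<^sub>v v) = 0\<^sub>v r" using Pk pow_mat_vec_Suc(1)[OF A(1) v(1)] unfolding l by simp
  moreover have "k \<le> N" unfolding k_def by (rule Least_le[of ?P, OF PN])
  ultimately show thesis using that[of l] l by simp
qed

text \<open>The geometric sum of the powers of A and of c maps onto the c-eigenspace if A and c have the
  same k-th power.\<close>

primrec eigproj :: "'k::field mat \<Rightarrow> 'k \<Rightarrow> nat \<Rightarrow> 'k vec \<Rightarrow> 'k vec" where
  "eigproj A c 0 v = 0\<^sub>v (dim_vec v)"
| "eigproj A c (Suc k) v = c \<cdot>\<^sub>v eigproj A c k v + A ^\<^sub>m k *\<^sub>v v"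

context
  fixes A :: "'k::field mat" and r :: nat
  assumes A: "A \<in> carrier_mat r r"
begin

lemma eigproj_closed: "v \<in> carrier_vec r \<Longrightarrow> eigproj A c k v \<in> carrier_vec r"
  by (induction k) (use pow_mat_vec_Suc(2)[OF A, of v] in simp_all)

lemma eigproj_dim [simp]: "v \<in> carrier_vec r \<Longrightarrow> dim_vec (eigproj A c k v) = r"
  using eigproj_closed[of v] by simp

lemma pow_dims [simp]: "dim_row (A ^\<^sub>m k) = r" "dim_col (A ^\<^sub>m k) = r" "dim_row A = r" "dim_col A = r"
  using A by auto

text \<open>The telescoping identity (A - c) (sum of A^j c^(k-1-j)) = A^k - c^k, arranged without
  subtraction.\<close>

lemma mult_eigproj:
  assumes v: "v \<in> carrier_vec r"
  shows "A *\<^sub>v eigproj A c k v + c ^ k \<cdot>\<^sub>v v = c \<cdot>\<^sub>v eigproj A c k v + A ^\<^sub>m k *\<^sub>v v"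
proof (induction k)
  case 0
  then show ?case using v by (auto simp: mult_mat_vec_zero)
next
  case (Suc k)
  let ?P = "eigproj A c k v"
  have d: "dim_vec v = r" using v by simp
  have "A *\<^sub>v eigproj A c (Suc k) v = c \<cdot>\<^sub>v (A *\<^sub>v ?P) + A ^\<^sub>m Suc k *\<^sub>v v"
    unfolding pow_mat_vec_Suc(1)[OF A v] using v
    by (simp add: mult_mat_vec_add mult_mat_vec_smult)
  then have "A *\<^sub>v eigproj A c (Suc k) v + c ^ Suc k \<cdot>\<^sub>v v =
      c \<cdot>\<^sub>v (A *\<^sub>v ?P + c ^ k \<cdot>\<^sub>v v) + A ^\<^sub>m Suc k *\<^sub>v v"
    using d by (auto intro!: eq_vecI simp: algebra_simps simp del: pow_mat.simps)
  also have "\<dots> = c \<cdot>\<^sub>v eigproj A c (Suc k) v + A ^\<^sub>m Suc k *\<^sub>v v"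
    unfolding Suc by simp
  finally show ?case .
qed

lemma eigproj_eigenvector:
  assumes v: "v \<in> carrier_vec r" and "A ^\<^sub>m k = 1\<^sub>m r" "c ^ k = 1"
  shows "A *\<^sub>v eigproj A c k v = c \<cdot>\<^sub>v eigproj A c k v"
proof (rule eq_vecI)
  fix i assume i: "i < dim_vec (c \<cdot>\<^sub>v eigproj A c k v)"
  have "(A *\<^sub>v eigproj A c k v + v) $ i = (c \<cdot>\<^sub>v eigproj A c k v + v) $ i"
    using mult_eigproj[OF v, of c k] assms by simp
  then show "(A *\<^sub>v eigproj A c k v) $ i = (c \<cdot>\<^sub>v eigproj A c k v) $ i"
    using v i by simp
qed (use v in auto)

lemma eigproj_index:
  assumes v: "v \<in> carrier_vec r" and i: "i < r"
  shows "eigproj A c k v $ i = (\<Sum>j<k. c ^ (k - 1 - j) * (A ^\<^sub>m j *\<^sub>v v) $ i)"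
proof (induction k)
  case 0
  then show ?case using v i by auto
next
  case (Suc k)
  have "eigproj A c (Suc k) v $ i = c * eigproj A c k v $ i + (A ^\<^sub>m k *\<^sub>v v) $ i"
    using v i by simp
  also have "c * eigproj A c k v $ i = (\<Sum>j<k. c ^ (Suc k - 1 - j) * (A ^\<^sub>m j *\<^sub>v v) $ i)"
    unfolding Suc sum_distrib_left
  proof (rule sum.cong[OF refl])
    fix j assume "j \<in> {..<k}"
    then have "Suc k - 1 - j = Suc (k - 1 - j)" by auto
    then show "c * (c ^ (k - 1 - j) * (A ^\<^sub>m j *\<^sub>v v) $ i) = c ^ (Suc k - 1 - j) * (A ^\<^sub>m j *\<^sub>v v) $ i"
      by simp
  qed
  finally show ?case by simp
qed

text \<open>On a c-eigenvector all summands coincide. Once \<open>of_nat n\<close> is known to be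
  invertible, this keeps the image of a lifted weight vector nonzero when the lift is projected to a
  weight space.\<close>

lemma eigproj_fixed:
  assumes v: "v \<in> carrier_vec r" and Av: "A *\<^sub>v v = c \<cdot>\<^sub>v v"
  shows "eigproj A c (Suc k) v = (of_nat (Suc k) * c ^ k) \<cdot>\<^sub>v v"
proof -
  have p: "A ^\<^sub>m k *\<^sub>v v = c ^ k \<cdot>\<^sub>v v" for k
  proof (induction k)
    case (Suc k)
    have "A ^\<^sub>m Suc k *\<^sub>v v = A *\<^sub>v (c ^ k \<cdot>\<^sub>v v)"
      unfolding pow_mat_vec_Suc(1)[OF A v] Suc ..
    then show ?case using v by (simp add: mult_mat_vec_smult Av smult_smult_assoc mult.commute)
  qed (use v in simp)
  show ?thesis
  proof (induction k)
    case 0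
    then show ?case using v by auto
  next
    case (Suc k)
    have "eigproj A c (Suc (Suc k)) v = c \<cdot>\<^sub>v ((of_nat (Suc k) * c ^ k) \<cdot>\<^sub>v v) + c ^ Suc k \<cdot>\<^sub>v v"
      unfolding eigproj.simps(2)[of A c "Suc k"] Suc p ..
    also have "\<dots> = (of_nat (Suc (Suc k)) * c ^ Suc k) \<cdot>\<^sub>v v"
      using v by (intro eq_vecI) (auto simp: algebra_simps)
    finally show ?case .
  qed
qed

text \<open>The twist \<open>p\<close> accommodates d, which commutes with b and c only up to the
  factor q.\<close>

lemma eigproj_hom:
  assumes v: "v \<in> carrier_vec r" and F: "F \<in> carrier_mat s r" and B: "B \<in> carrier_mat s s" and FA: "F * A = p \<cdot>\<^sub>m (B * F)"
  shows "F *\<^sub>v (A ^\<^sub>m k *\<^sub>v v) = p ^ k \<cdot>\<^sub>v (B ^\<^sub>m k *\<^sub>v (F *\<^sub>v v))"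
proof (induction k)
  case 0
  then show ?case using v F B by auto
next
  case (Suc k)
  have w: "A ^\<^sub>m k *\<^sub>v v \<in> carrier_vec r" by (rule pow_mat_vec_Suc(2)[OF A v])
  have Fv: "F *\<^sub>v v \<in> carrier_vec s" using F v by auto
  have "F *\<^sub>v (A ^\<^sub>m Suc k *\<^sub>v v) = (F * A) *\<^sub>v (A ^\<^sub>m k *\<^sub>v v)"
    unfolding pow_mat_vec_Suc(1)[OF A v] using assoc_mult_mat_vec[OF F A w] by simp
  also have "\<dots> = p \<cdot>\<^sub>v (B *\<^sub>v (F *\<^sub>v (A ^\<^sub>m k *\<^sub>v v)))"
    unfolding FA using carrier_vecD[OF w] F B
    by (simp only: smult_mat_mult_vec[of "A ^\<^sub>m k *\<^sub>v v" "B * F"] index_mult_mat carrier_matD assoc_mult_mat_vec[OF B F w])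
  also have "\<dots> = p ^ Suc k \<cdot>\<^sub>v (B *\<^sub>v (B ^\<^sub>m k *\<^sub>v (F *\<^sub>v v)))"
    unfolding Suc using B pow_mat_vec_Suc(2)[OF B Fv]
    by (simp add: mult_mat_vec_smult smult_smult_assoc)
  finally show ?case unfolding pow_mat_vec_Suc(1)[OF B Fv] .
qed

lemma eigproj_commute:
  assumes v: "v \<in> carrier_vec r" and F: "F \<in> carrier_mat s r" and B: "B \<in> carrier_mat s s" and FA: "F * A = B * F"
  shows "F *\<^sub>v eigproj A c k v = eigproj B c k (F *\<^sub>v v)"
proof (induction k)
  case 0
  then show ?case using v F by (simp add: mult_mat_vec_zero)
next
  case (Suc k)
  have "F *\<^sub>v (A ^\<^sub>m k *\<^sub>v v) = B ^\<^sub>m k *\<^sub>v (F *\<^sub>v v)"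
  proof -
    have "1 \<cdot>\<^sub>m (B * F) = B * F" by (auto intro!: eq_matI)
    then show ?thesis using eigproj_hom[OF v F B, of 1 k] FA by simp
  qed
  then show ?case using Suc v F by (simp add: mult_mat_vec_add mult_mat_vec_smult)
qed

lemma eigproj_kills:
  assumes v: "v \<in> carrier_vec r" and F: "F \<in> carrier_mat r r" and FA: "F * A = p \<cdot>\<^sub>m (A * F)" and Fv: "F *\<^sub>v v = 0\<^sub>v r"
  shows "F *\<^sub>v eigproj A c k v = 0\<^sub>v r"
proof (induction k)
  case 0
  then show ?case using v F by (simp add: mult_mat_vec_zero)
next
  case (Suc k)
  have "F *\<^sub>v (A ^\<^sub>m k *\<^sub>v v) = 0\<^sub>v r"
    using eigproj_hom[OF v F A FA, of k] Fv by (simp add: mult_mat_vec_zero)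
  then show ?case using Suc v F by (simp add: mult_mat_vec_add mult_mat_vec_smult)
qed

lemma eigproj_eigen:
  assumes v: "v \<in> carrier_vec r" and F: "F \<in> carrier_mat r r" and FA: "F * A = A * F" and Fv: "F *\<^sub>v v = p \<cdot>\<^sub>v v"
  shows "F *\<^sub>v eigproj A c k v = p \<cdot>\<^sub>v eigproj A c k v"
proof -
  have "eigproj A c k (p \<cdot>\<^sub>v v) = p \<cdot>\<^sub>v eigproj A c k v"
  proof (rule eq_vecI)
    fix i assume "i < dim_vec (p \<cdot>\<^sub>v eigproj A c k v)"
    then have i: "i < r" using v by simp
    have "(A ^\<^sub>m j *\<^sub>v (p \<cdot>\<^sub>v v)) $ i = p * (A ^\<^sub>m j *\<^sub>v v) $ i" for j
      using v i by (simp add: mult_mat_vec_smult)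
    then show "eigproj A c k (p \<cdot>\<^sub>v v) $ i = (p \<cdot>\<^sub>v eigproj A c k v) $ i"
      using v i by (simp add: eigproj_index sum_distrib_left mult_ac)
  qed (use v in auto)
  then show ?thesis using eigproj_commute[OF v F A FA] Fv by simp
qed

end

context root_of_unity
begin

text \<open>The \<open>g j\<close> are the coefficients of a polynomial of degree below n that
  vanishes at the n distinct powers of q.\<close>

lemma vandermonde:
  assumes "\<And>x. x < n \<Longrightarrow> (\<Sum>j<n. g j * (q ^ x) ^ j) = 0" and j: "j < n"
  shows "g j = 0"
proof -
  define p where "p = (\<Sum>j<n. monom (g j) j)"
  have ev: "poly p z = (\<Sum>j<n. g j * z ^ j)" for z
    by (simp add: p_def poly_sum poly_monom)
  have inj: "inj_on (\<lambda>x. q ^ x) {..<n}"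
  proof (rule inj_onI)
    fix x y assume xy: "x \<in> {..<n}" "y \<in> {..<n}" "q ^ x = q ^ y"
    then have "int n dvd int x - int y" using q_powi_eq_iff[of "int x" "int y"] by (simp add: power_int_def)
    moreover have "\<bar>int x - int y\<bar> < int n" using xy by auto
    ultimately show "x = y" using dvd_imp_le_int[of "int x - int y" "int n"] by fastforce
  qed
  have "p = 0"
  proof (rule ccontr)
    assume p: "p \<noteq> 0"
    have sub: "(\<lambda>x. q ^ x) ` {..<n} \<subseteq> {z. poly p z = 0}" using assms(1) by (auto simp: ev)
    have "n = card ((\<lambda>x. q ^ x) ` {..<n})" by (simp add: card_image[OF inj])
    also have "\<dots> \<le> card {z. poly p z = 0}" by (rule card_mono[OF poly_roots_finite[OF p] sub])
    also have "\<dots> \<le> degree p" by (rule card_poly_roots_bound[OF p])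
    also have "degree p \<le> n - 1"
      unfolding p_def by (intro degree_sum_le) (auto intro!: order_trans[OF degree_monom_le])
    finally show False using n2 by simp
  qed
  then have "coeff p j = 0" by simp
  moreover have "coeff p j = g j" using j by (simp add: p_def coeff_sum if_distrib cong: if_cong)
  ultimately show ?thesis by simp
qed

text \<open>The polynomial 1 + z + ... + z^(n-1) vanishes at all powers of q other than 1. If it
  also vanished at 1, it would have n roots and be zero. So a primitive n-th root of unity excludes
  characteristics dividing n.\<close>

lemma of_nat_n: "of_nat n \<noteq> (0 :: 'k)"
proof
  assume n0: "of_nat n = (0 :: 'k)"
  have "(\<Sum>j<n. (\<lambda>_. 1) j * (q ^ x) ^ j) = 0" if x: "x < n" for x
  proof (cases "x = 0")
    case False
    have "q ^ x \<noteq> 1" using x False prim unfolding primitive_root_of_unity_def by auto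
    moreover have "(q ^ x) ^ n = 1" using q_pow_n by (metis mult.commute power_mult power_one)
    ultimately show ?thesis using qint_geometric[of "q ^ x" n] by (simp add: qint_def)
  qed (use n0 in simp)
  moreover have "0 < n" using n2 by simp
  ultimately have "(1 :: 'k) = 0" by (rule vandermonde[of "\<lambda>_. 1" 0])
  then show False by simp
qed

text \<open>Each coordinate of the projections, as a function of the eigenvalue, is a polynomial of
  degree below n with coefficients taken from the vectors A^j v. If all projections vanished, so
  would all of these vectors, among them v.\<close>

lemma eigproj_nonzero:
  assumes A: "A \<in> carrier_mat r r" and v: "v \<in> carrier_vec r" "v \<noteq> 0\<^sub>v r"
  obtains x where "eigproj A (q ^ x) n v \<noteq> 0\<^sub>v r"
proof (rule ccontr)
  assume "\<not> thesis"
  then have z: "eigproj A (q ^ x) n v = 0\<^sub>v r" for x using that by blast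
  have "v $ i = 0" if i: "i < r" for i
  proof -
    have "(\<Sum>j<n. (A ^\<^sub>m (n - 1 - j) *\<^sub>v v) $ i * (q ^ x) ^ j) = 0" for x
    proof -
      have "(\<Sum>j<n. (A ^\<^sub>m (n - 1 - j) *\<^sub>v v) $ i * (q ^ x) ^ j) =
          (\<Sum>j<n. (q ^ x) ^ (n - 1 - j) * (A ^\<^sub>m j *\<^sub>v v) $ i)"
        by (rule sum.reindex_bij_witness[where i = "\<lambda>j. n - 1 - j" and j = "\<lambda>j. n - 1 - j"])
           (auto simp: mult.commute)
      then show ?thesis using eigproj_index[OF A v(1) i, of "q ^ x" n] z[of x] i by simp
    qed
    \<comment> \<open>The sum was reversed so that the exponent of \<open>q ^ x\<close> is the
      summation index; the vector v itself is then the coefficient at n - 1.\<close>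
    then have "(A ^\<^sub>m (n - 1 - (n - 1)) *\<^sub>v v) $ i = 0"
      using vandermonde[of "\<lambda>j. (A ^\<^sub>m (n - 1 - j) *\<^sub>v v) $ i" "n - 1"] n2 by simp
    then show ?thesis using A v by simp
  qed
  then have "v = 0\<^sub>v r" using v(1) by (intro eq_vecI) auto
  then show False using v(2) by simp
qed

lemma string_act:
  assumes "j < t"
  shows "act (string_mod q t x y) GA *\<^sub>v unit_vec t j = (if Suc j < t then unit_vec t (Suc j) else 0\<^sub>v t)"
    "act (string_mod q t x y) GB *\<^sub>v unit_vec t j = q powi (x + int j) \<cdot>\<^sub>v unit_vec t j"
    "act (string_mod q t x y) GC *\<^sub>v unit_vec t j = q powi (y + int j) \<cdot>\<^sub>v unit_vec t j"
    "act (string_mod q t x y) GD *\<^sub>v unit_vec t j = beta q (x + y) j \<cdot>\<^sub>v unit_vec t (j - 1)"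
proof -
  note m = mult_mat_unit[of j "act (string_mod q t x y) g" for g, simplified wf_hmodD[OF wf_string] hdim_string]
  show "act (string_mod q t x y) GA *\<^sub>v unit_vec t j = (if Suc j < t then unit_vec t (Suc j) else 0\<^sub>v t)"
    "act (string_mod q t x y) GB *\<^sub>v unit_vec t j = q powi (x + int j) \<cdot>\<^sub>v unit_vec t j"
    "act (string_mod q t x y) GC *\<^sub>v unit_vec t j = q powi (y + int j) \<cdot>\<^sub>v unit_vec t j"
    unfolding m[OF assms] using assms by (auto intro!: eq_vecI simp: string_mod_def)
  show "act (string_mod q t x y) GD *\<^sub>v unit_vec t j = beta q (x + y) j \<cdot>\<^sub>v unit_vec t (j - 1)"
    unfolding m[OF assms] using assms by (cases j) (auto intro!: eq_vecI simp: string_mod_def)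
qed

definition singular :: "'k hmod \<Rightarrow> int \<Rightarrow> int \<Rightarrow> 'k vec \<Rightarrow> bool" where
  "singular X x y u \<longleftrightarrow> u \<in> carrier_vec (hdim X) \<and> act_d X *\<^sub>v u = 0\<^sub>v (hdim X) \<and>
     act_b X *\<^sub>v u = q powi x \<cdot>\<^sub>v u \<and> act_c X *\<^sub>v u = q powi y \<cdot>\<^sub>v u"

text \<open>Induction along \<open>beta_Suc\<close>. At \<open>j = 0\<close> the index
  \<open>j - 1\<close> is truncated to 0, which is harmless because \<open>beta_0\<close> makes the
  coefficient zero.\<close>

lemma string_in_module:
  assumes X: "H_module n q X" and u: "singular X x y u"
  shows "act_a X ^\<^sub>m j *\<^sub>v u \<in> carrier_vec (hdim X)"
    "act_b X *\<^sub>v (act_a X ^\<^sub>m j *\<^sub>v u) = q powi (x + int j) \<cdot>\<^sub>v (act_a X ^\<^sub>m j *\<^sub>v u)"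
    "act_c X *\<^sub>v (act_a X ^\<^sub>m j *\<^sub>v u) = q powi (y + int j) \<cdot>\<^sub>v (act_a X ^\<^sub>m j *\<^sub>v u)"
    "act_d X *\<^sub>v (act_a X ^\<^sub>m j *\<^sub>v u) = beta q (x + y) j \<cdot>\<^sub>v (act_a X ^\<^sub>m (j - 1) *\<^sub>v u)"
proof -
  let ?w = "\<lambda>j. act_a X ^\<^sub>m j *\<^sub>v u"
  note wX = H_module_wf[OF X]
  have c: "act_a X \<in> carrier_mat (hdim X) (hdim X)" "act_b X \<in> carrier_mat (hdim X) (hdim X)"
    "act_c X \<in> carrier_mat (hdim X) (hdim X)" "act_d X \<in> carrier_mat (hdim X) (hdim X)"
    using wX by (auto simp: wf_hmod_def all_gen)
  note dm = carrier_matD[OF c(1)] carrier_matD[OF c(2)] carrier_matD[OF c(3)] carrier_matD[OF c(4)]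
  have uc: "u \<in> carrier_vec (hdim X)" using u by (simp add: singular_def)
  have wc: "?w j \<in> carrier_vec (hdim X)" for j by (rule pow_mat_vec_Suc(2)[OF c(1) uc])
  have wd: "dim_vec (?w j) = hdim X" "dim_row (act_a X ^\<^sub>m j) = hdim X" for j
    using carrier_vecD[OF wc[of j]] by simp_all
  have wS: "?w (Suc j) = act_a X *\<^sub>v ?w j" for j by (rule pow_mat_vec_Suc(1)[OF c(1) uc])
  have w0: "?w 0 = u" using uc c by simp
  have es: "q powi (z + (1 + int j)) = q * q powi (z + int j)" for z j
    using q_powi_Suc[of "z + int j"] by (simp add: algebra_simps)
  have b: "act_b X *\<^sub>v ?w j = q powi (x + int j) \<cdot>\<^sub>v ?w j" for j
  proof (induction j)
    case (Suc j)
    show ?case unfolding wS H_module_vec(1)[OF X wc] Suc using dm wd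
      by (simp add: mult_mat_vec_smult smult_smult_assoc es)
  qed (use u w0 in \<open>simp add: singular_def\<close>)
  have cc: "act_c X *\<^sub>v ?w j = q powi (y + int j) \<cdot>\<^sub>v ?w j" for j
  proof (induction j)
    case (Suc j)
    show ?case unfolding wS H_module_vec(3)[OF X wc] Suc using dm wd
      by (simp add: mult_mat_vec_smult smult_smult_assoc es)
  qed (use u w0 in \<open>simp add: singular_def\<close>)
  have d: "act_d X *\<^sub>v ?w j = beta q (x + y) j \<cdot>\<^sub>v ?w (j - 1)" for j
  proof (induction j)
    case 0
    show ?case using u w0 uc by (simp add: singular_def)
  next
    case (Suc j)
    have 1: "act_a X *\<^sub>v (beta q (x + y) j \<cdot>\<^sub>v ?w (j - 1)) = beta q (x + y) j \<cdot>\<^sub>v ?w j"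
    proof (cases j)
      case 0
      then show ?thesis using dm uc w0 by (simp add: mult_mat_vec_smult mult_mat_vec_zero)
    next
      case (Suc k)
      then show ?thesis using dm wd wS by (simp add: mult_mat_vec_smult del: pow_mat.simps)
    qed
    have 2: "act_b X *\<^sub>v (act_c X *\<^sub>v ?w j) = q powi (x + y + 2 * int j) \<cdot>\<^sub>v ?w j"
      unfolding cc using dm wd
      by (simp add: mult_mat_vec_smult b smult_smult_assoc q_powi_add[symmetric] algebra_simps)
    show ?case unfolding wS H_module_vec(6)[OF X wc] Suc 1 2
      using wd by (auto intro!: eq_vecI simp: beta_Suc algebra_simps)
  qed
  show "?w j \<in> carrier_vec (hdim X)" "act_b X *\<^sub>v ?w j = q powi (x + int j) \<cdot>\<^sub>v ?w j"
    "act_c X *\<^sub>v ?w j = q powi (y + int j) \<cdot>\<^sub>v ?w j"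
    "act_d X *\<^sub>v ?w j = beta q (x + y) j \<cdot>\<^sub>v ?w (j - 1)" by (rule wc b cc d)+
qed

text \<open>The universal property of strings: on the vectors a^j u inside \<open>X\<close> the
  generators b, c, d act by the same formulas as on the basis of the string, and the hypothesis on
  a^t settles the action of a at the end.\<close>

lemma string_hom:
  assumes X: "H_module n q X" and u: "singular X x y u" and top: "act_a X ^\<^sub>m t *\<^sub>v u = 0\<^sub>v (hdim X)"
  obtains F where "F \<in> H_hom (string_mod q t x y) X"
    "\<And>j. j < t \<Longrightarrow> F *\<^sub>v unit_vec t j = act_a X ^\<^sub>m j *\<^sub>v u"
proof -
  let ?w = "\<lambda>j. act_a X ^\<^sub>m j *\<^sub>v u" and ?S = "string_mod q t x y"
  note w = string_in_module[OF X u]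
  note wX = H_module_wf[OF X]
  define F where "F = mat (hdim X) t (\<lambda>(i, j). ?w j $ i)"
  have Fc: "F \<in> carrier_mat (hdim X) t" by (simp add: F_def)
  have Fd: "dim_row F = hdim X" "dim_col F = t" by (simp_all add: F_def)
  have Fu: "F *\<^sub>v unit_vec t j = ?w j" if "j < t" for j
  proof -
    have "F *\<^sub>v unit_vec t j = col F j" using that mult_mat_unit[of j F] by (simp add: F_def)
    also have "\<dots> = ?w j"
    proof (rule eq_vecI)
      fix i assume "i < dim_vec (?w j)"
      then have "i < hdim X" using carrier_vecD[OF w(1)[of j]] by simp
      then show "col F j $ i = ?w j $ i" using that by (simp add: F_def)
    qed (use carrier_vecD[OF w(1)[of j]] Fd in simp)
    finally show ?thesis .
  qed
  have ac: "act_a X \<in> carrier_mat (hdim X) (hdim X)" using wX by (simp add: wf_hmod_def all_gen)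
  have wS: "?w (Suc j) = act_a X *\<^sub>v ?w j" for j
    by (rule pow_mat_vec_Suc(1)[OF ac]) (use u in \<open>simp add: singular_def\<close>)
  have key: "F *\<^sub>v (act ?S g *\<^sub>v unit_vec t j) = act X g *\<^sub>v ?w j" if j: "j < t" for g j
  proof (cases g)
    case GA
    have "?w (Suc j) = 0\<^sub>v (hdim X)" if "\<not> Suc j < t"
      using that j top by (metis Suc_lessI)
    then show ?thesis unfolding GA string_act[OF j] using Fu Fd wS
      by (auto simp: mult_mat_vec_zero)
  next
    case GB
    then show ?thesis unfolding GB string_act[OF j] using Fu[OF j] Fd w by (simp add: mult_mat_vec_smult)
  next
    case GC
    then show ?thesis unfolding GC string_act[OF j] using Fu[OF j] Fd w by (simp add: mult_mat_vec_smult)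
  next
    case GD
    have "j - 1 < t" using j by simp
    then show ?thesis unfolding GD string_act[OF j] using Fu Fd w by (simp add: mult_mat_vec_smult)
  qed
  have "F \<in> H_hom ?S X"
  proof (rule H_homI)
    fix g
    have Sc: "act ?S g \<in> carrier_mat t t" and Xc: "act X g \<in> carrier_mat (hdim X) (hdim X)"
      using wf_string[of q t x y] wX by (auto simp: wf_hmod_def)
    show "F * act ?S g = act X g * F"
    proof (rule mat_eq_vecI[of _ "hdim X" t])
      fix j assume j: "j < t"
      show "F * act ?S g *\<^sub>v unit_vec t j = act X g * F *\<^sub>v unit_vec t j"
        using key[OF j] Fu[OF j] assoc_mult_mat_vec[OF Fc Sc] assoc_mult_mat_vec[OF Xc Fc] by simp
    qed (use Fc Sc Xc in auto)
  qed (use Fd in auto)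
  then show thesis using that Fu by blast
qed

lemma hom_string_vec:
  assumes F: "F \<in> H_hom (string_mod q t x y) X" and wX: "wf_hmod X" and j: "j < t"
  shows "F *\<^sub>v unit_vec t j = act_a X ^\<^sub>m j *\<^sub>v (F *\<^sub>v unit_vec t 0)"
  using j
proof (induction j)
  case 0
  have "act_a X \<in> carrier_mat (hdim X) (hdim X)" using wX by (simp add: wf_hmod_def all_gen)
  then show ?case using F by (auto simp: H_hom_def intro!: one_mult_mat_vec[symmetric])
next
  case (Suc j)
  have ac: "act_a X \<in> carrier_mat (hdim X) (hdim X)" using wX by (simp add: wf_hmod_def all_gen)
  have u: "F *\<^sub>v unit_vec t 0 \<in> carrier_vec (hdim X)" using F by (auto simp: H_hom_def)
  have "F *\<^sub>v unit_vec t (Suc j) = F *\<^sub>v (act (string_mod q t x y) GA *\<^sub>v unit_vec t j)"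
    using string_act(1)[of j t x y] Suc.prems by simp
  also have "\<dots> = act_a X *\<^sub>v (F *\<^sub>v unit_vec t j)"
    using H_hom_vec[OF F wf_string wX, of "unit_vec t j" GA] by simp
  also have "\<dots> = act_a X ^\<^sub>m Suc j *\<^sub>v (F *\<^sub>v unit_vec t 0)"
    using Suc pow_mat_vec_Suc(1)[OF ac u] by simp
  finally show ?case .
qed

lemma hom_string_singular:
  assumes F: "F \<in> H_hom (string_mod q t x y) X" and wX: "wf_hmod X" and t: "0 < t"
  shows "singular X x y (F *\<^sub>v unit_vec t 0)"
proof -
  have d: "dim_row F = hdim X" "dim_col F = t" using H_homD[OF F] by simp_all
  let ?e = "unit_vec t 0 :: 'k vec" and ?S = "string_mod q t x y"
  have h: "act X g *\<^sub>v (F *\<^sub>v ?e) = F *\<^sub>v (act ?S g *\<^sub>v ?e)" for g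
    by (rule H_hom_vec[OF F wf_string wX, symmetric]) simp
  have "F *\<^sub>v ?e \<in> carrier_vec (hdim X)" by (rule carrier_vecI) (simp add: d)
  moreover have "act_b X *\<^sub>v (F *\<^sub>v ?e) = q powi x \<cdot>\<^sub>v (F *\<^sub>v ?e)"
    using h[of GB] d unfolding string_act(2)[OF t] by (simp add: mult_mat_vec_smult)
  moreover have "act_c X *\<^sub>v (F *\<^sub>v ?e) = q powi y \<cdot>\<^sub>v (F *\<^sub>v ?e)"
    using h[of GC] d unfolding string_act(3)[OF t] by (simp add: mult_mat_vec_smult)
  moreover have "act_d X *\<^sub>v (F *\<^sub>v ?e) = 0\<^sub>v (hdim X)"
    using h[of GD] d unfolding string_act(4)[OF t] by (simp add: mult_mat_vec_zero)
  ultimately show ?thesis unfolding singular_def by blast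
qed

end

section \<open>Simplicity of V(m, s) and homomorphisms between simple modules\<close>

context root_of_unity
begin

text \<open>Both j and m - j lie strictly between 0 and n, so neither factor of \<open>beta\<close>
  vanishes. This is what makes V(m, s) simple.\<close>

lemma beta_V_nonzero: "0 < j \<Longrightarrow> j < m \<Longrightarrow> m \<le> n \<Longrightarrow> beta q (s + (1 - s - int m)) j \<noteq> 0"
proof
  assume j: "0 < j" "j < m" "m \<le> n" and "beta q (s + (1 - s - int m)) j = 0"
  then have "n dvd j \<or> int n dvd int j - int m" unfolding beta_eq_0_iff by simp
  then have "n dvd j \<or> int n dvd int (m - j)" using j by (simp add: of_nat_diff dvd_diff_commute)
  then have "n dvd j \<or> n dvd m - j" by (simp only: int_dvd_int_iff)
  then show False using j by (auto dest: dvd_imp_le)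
qed

lemma act_d_V_index:
  assumes "u \<in> carrier_vec m" "i < m"
  shows "(act_d (V q m s) *\<^sub>v u) $ i = (if Suc i < m then beta q (s + (1 - s - int m)) (Suc i) * u $ Suc i else 0)"
proof -
  have "(act_d (V q m s) *\<^sub>v u) $ i =
      (\<Sum>k = 0..<m. (if k = Suc i then beta q (s + (1 - s - int m)) k else 0) * u $ k)"
    using assms unfolding V_string by (simp add: string_mod_def scalar_prod_def)
  then show ?thesis by (simp add: sum_single)
qed

lemma act_d_V_kernel:
  assumes u: "u \<in> carrier_vec m" and z: "act_d (V q m s) *\<^sub>v u = 0\<^sub>v m" and m: "m \<le> n"
  shows "u = u $ 0 \<cdot>\<^sub>v unit_vec m 0"
proof (rule eq_vecI)
  fix i assume "i < dim_vec (u $ 0 \<cdot>\<^sub>v unit_vec m 0)"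
  then have i: "i < m" by simp
  show "u $ i = (u $ 0 \<cdot>\<^sub>v unit_vec m 0) $ i"
  proof (cases i)
    case 0
    then show ?thesis using i by simp
  next
    case (Suc j)
    have "beta q (s + (1 - s - int m)) (Suc j) * u $ Suc j = 0"
      using act_d_V_index[OF u, of j s] z Suc i by simp
    then show ?thesis using beta_V_nonzero[of "Suc j" m s] Suc i m by simp
  qed
qed (use u in simp)

text \<open>Simplicity of V(m, s): applying d to a nonzero vector as long as the result is nonzero
  ends in the line of the first basis vector, the kernel of d, and a produces the other basis
  vectors from there.\<close>

lemma V_invariant_subspace:
  assumes W: "W \<subseteq> carrier_vec m" "0\<^sub>v m \<in> W" "\<And>u v. u \<in> W \<Longrightarrow> v \<in> W \<Longrightarrow> u + v \<in> W" "\<And>c u. u \<in> W \<Longrightarrow> c \<cdot>\<^sub>v u \<in> W"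
    "\<And>g u. u \<in> W \<Longrightarrow> act (V q m s) g *\<^sub>v u \<in> W"
    and y: "y \<in> W" "y \<noteq> 0\<^sub>v m" and m: "m \<le> n"
  shows "W = carrier_vec m"
proof -
  let ?V = "V q m s"
  have VM: "H_module n q ?V" by (rule V_module[OF m])
  have dc: "act_d ?V \<in> carrier_mat m m" "act_d ?V ^\<^sub>m n = 0\<^sub>m m m"
    using VM by (auto simp: H_module_def Let_def)
  obtain k where k: "act_d ?V ^\<^sub>m k *\<^sub>v y \<noteq> 0\<^sub>v m" "act_d ?V *\<^sub>v (act_d ?V ^\<^sub>m k *\<^sub>v y) = 0\<^sub>v m"
    using nilpotent_last[OF dc _ y(2)] W(1) y(1) by blast
  have yc: "y \<in> carrier_vec m" using W y by blast
  have dW: "act_d ?V ^\<^sub>m j *\<^sub>v y \<in> W" for j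
  proof (induction j)
    case (Suc j)
    then show ?case using W(5)[of _ GD] pow_mat_vec_Suc(1)[OF dc(1) yc] by simp
  qed (use y yc dc in simp)
  let ?u = "act_d ?V ^\<^sub>m k *\<^sub>v y"
  have uc: "?u \<in> carrier_vec m" by (rule pow_mat_vec_Suc(2)[OF dc(1) yc])
  have u: "?u = ?u $ 0 \<cdot>\<^sub>v unit_vec m 0" by (rule act_d_V_kernel[OF uc k(2) m])
  have u0: "?u $ 0 \<noteq> 0"
  proof
    assume "?u $ 0 = 0"
    then have "?u = 0 \<cdot>\<^sub>v unit_vec m 0" using u by metis
    then show False using k(1) by simp
  qed
  have "inverse (?u $ 0) \<cdot>\<^sub>v (?u $ 0 \<cdot>\<^sub>v unit_vec m 0) \<in> W"
    using W(4)[OF dW[of k], of "inverse (?u $ 0)"] u by simp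
  then have e0: "unit_vec m 0 \<in> W" using u0 by (simp add: smult_smult_assoc)
  have e: "unit_vec m j \<in> W" if "j < m" for j
    using that
  proof (induction j)
    case (Suc j)
    then show ?case using W(5)[of "unit_vec m j" GA] string_act(1)[of j m s "1 - s - int m"]
      unfolding V_string by simp
  qed (use e0 in simp)
  have "v \<in> W" if v: "v \<in> carrier_vec m" for v
  proof -
    have "vec m (\<lambda>i. if i < j then v $ i else 0) \<in> W" if "j \<le> m" for j
      using that
    proof (induction j)
      case 0
      have "vec m (\<lambda>i. if i < 0 then v $ i else 0) = 0\<^sub>v m" by auto
      then show ?case using W(2) by simp
    next
      case (Suc j)
      have "vec m (\<lambda>i. if i < Suc j then v $ i else 0) =
          vec m (\<lambda>i. if i < j then v $ i else 0) + v $ j \<cdot>\<^sub>v unit_vec m j"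
        using Suc.prems by (intro eq_vecI) (auto simp: less_Suc_eq)
      then show ?case using Suc W(3) W(4) e by simp
    qed
    from this[of m] have "vec m (\<lambda>i. if i < m then v $ i else 0) \<in> W" by simp
    also have "vec m (\<lambda>i. if i < m then v $ i else 0) = v" using v by (intro eq_vecI) auto
    finally show ?thesis .
  qed
  then show ?thesis using W(1) by blast
qed

lemma image_act_closed:
  assumes F: "F \<in> H_hom M N" and w: "wf_hmod M" "wf_hmod N"
    and K: "K \<subseteq> carrier_vec (hdim M)" "0\<^sub>v (hdim M) \<in> K" "\<And>u v. u \<in> K \<Longrightarrow> v \<in> K \<Longrightarrow> u + v \<in> K"
      "\<And>c u. u \<in> K \<Longrightarrow> c \<cdot>\<^sub>v u \<in> K" "\<And>g u. u \<in> K \<Longrightarrow> act M g *\<^sub>v u \<in> K"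
  shows "(\<lambda>v. F *\<^sub>v v) ` K \<subseteq> carrier_vec (hdim N)" "0\<^sub>v (hdim N) \<in> (\<lambda>v. F *\<^sub>v v) ` K"
    "u \<in> (\<lambda>v. F *\<^sub>v v) ` K \<Longrightarrow> v \<in> (\<lambda>v. F *\<^sub>v v) ` K \<Longrightarrow> u + v \<in> (\<lambda>v. F *\<^sub>v v) ` K"
    "u \<in> (\<lambda>v. F *\<^sub>v v) ` K \<Longrightarrow> c \<cdot>\<^sub>v u \<in> (\<lambda>v. F *\<^sub>v v) ` K"
    "u \<in> (\<lambda>v. F *\<^sub>v v) ` K \<Longrightarrow> act N g *\<^sub>v u \<in> (\<lambda>v. F *\<^sub>v v) ` K"
proof -
  have d: "dim_row F = hdim N" "dim_col F = hdim M" and Fc: "F \<in> carrier_mat (hdim N) (hdim M)"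
    using F by (auto simp: H_hom_def)
  show "(\<lambda>v. F *\<^sub>v v) ` K \<subseteq> carrier_vec (hdim N)" using Fc K(1) by auto
  show "0\<^sub>v (hdim N) \<in> (\<lambda>v. F *\<^sub>v v) ` K"
    using K(2) d by (intro image_eqI[of _ _ "0\<^sub>v (hdim M)"]) (simp_all add: mult_mat_vec_zero)
  show "u + v \<in> (\<lambda>v. F *\<^sub>v v) ` K" if uv: "u \<in> (\<lambda>v. F *\<^sub>v v) ` K" "v \<in> (\<lambda>v. F *\<^sub>v v) ` K" for u v
  proof -
    obtain x y where xy: "x \<in> K" "y \<in> K" "u = F *\<^sub>v x" "v = F *\<^sub>v y" using uv by blast
    then have "u + v = F *\<^sub>v (x + y)" using K(1) d by (subst mult_mat_vec_add) auto
    then show ?thesis using K(3)[OF xy(1,2)] by blast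
  qed
  show "c \<cdot>\<^sub>v u \<in> (\<lambda>v. F *\<^sub>v v) ` K" if u: "u \<in> (\<lambda>v. F *\<^sub>v v) ` K" for u c
  proof -
    obtain x where x: "x \<in> K" "u = F *\<^sub>v x" using u by blast
    then have "c \<cdot>\<^sub>v u = F *\<^sub>v (c \<cdot>\<^sub>v x)" using K(1) d by (subst mult_mat_vec_smult) auto
    then show ?thesis using K(4)[OF x(1)] by blast
  qed
  show "act N g *\<^sub>v u \<in> (\<lambda>v. F *\<^sub>v v) ` K" if u: "u \<in> (\<lambda>v. F *\<^sub>v v) ` K" for u g
  proof -
    obtain x where x: "x \<in> K" "u = F *\<^sub>v x" using u by blast
    then have "act N g *\<^sub>v u = F *\<^sub>v (act M g *\<^sub>v x)" using H_hom_vec[OF F w] K(1) by auto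
    then show ?thesis using K(5)[OF x(1)] by blast
  qed
qed

lemma mat_nonzero_vec:
  fixes F :: "'k mat"
  assumes "F \<in> carrier_mat r c" "F \<noteq> 0\<^sub>m r c"
  shows "\<exists>j<c. F *\<^sub>v unit_vec c j \<noteq> 0\<^sub>v r"
proof (rule ccontr)
  assume no: "\<not> ?thesis"
  have "F *\<^sub>v unit_vec c j = 0\<^sub>v r" if j: "j < c" for j using no j by blast
  then have "F = 0\<^sub>m r c"
    by (intro mat_eq_vecI[OF assms(1)]) (auto intro!: eq_vecI simp: scalar_prod_def)
  then show False using assms by simp
qed

lemma hom_to_V_epi:
  assumes M: "wf_hmod M" and F: "F \<in> H_hom M (V q m s)" "F \<noteq> 0\<^sub>m m (hdim M)" and m: "m \<le> n"
  shows "F \<in> H_epi M (V q m s)"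
proof -
  have Fc: "F \<in> carrier_mat m (hdim M)" using F(1) by (simp add: H_hom_def)
  obtain j where j: "j < hdim M" "F *\<^sub>v unit_vec (hdim M) j \<noteq> 0\<^sub>v m"
    using mat_nonzero_vec[OF Fc F(2)] by blast
  let ?K = "carrier_vec (hdim M) :: 'k vec set"
  have Mc: "act M g \<in> carrier_mat (hdim M) (hdim M)" for g using M by (simp add: wf_hmod_def)
  note ic = image_act_closed[OF F(1) M wf_V, of ?K, unfolded hdim_V]
  have "(\<lambda>v. F *\<^sub>v v) ` ?K = carrier_vec m"
    by (rule V_invariant_subspace[of _ m s "F *\<^sub>v unit_vec (hdim M) j"])
       (use ic j m mult_mat_vec_carrier[OF Mc] in \<open>auto simp del: act.simps\<close>)
  then show ?thesis using F(1) by (simp add: H_epi_def)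
qed

lemma smult_unit_eq:
  assumes "c \<cdot>\<^sub>v unit_vec m 0 = c' \<cdot>\<^sub>v unit_vec m 0" "0 < m"
  shows "c = (c' :: 'k)"
proof -
  have "(c \<cdot>\<^sub>v unit_vec m 0) $ 0 = (c' \<cdot>\<^sub>v unit_vec m 0) $ 0" using assms by simp
  then show ?thesis using assms(2) by simp
qed

text \<open>Schur's lemma with parameters. The image of the first basis vector is killed by d, hence
  a multiple of the first basis vector of the target; its b-weight determines s modulo n, and its
  c-weight then determines m.\<close>

lemma hom_V_V:
  assumes m: "0 < m" "m \<le> n" "0 < m'" "m' \<le> n" and F: "F \<in> H_hom (V q m s) (V q m' s')" "F \<noteq> 0\<^sub>m m' m"
  shows "m = m'" "int n dvd s - s'" "\<exists>k. F = k \<cdot>\<^sub>m 1\<^sub>m m"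
proof -
  have Fc: "F \<in> carrier_mat m' m" using F by (simp add: H_hom_def)
  let ?X = "V q m' s'"
  let ?u = "F *\<^sub>v unit_vec m 0"
  have F': "F \<in> H_hom (string_mod q m s (1 - s - int m)) ?X" using F(1) by (simp add: V_string)
  have sing: "singular ?X s (1 - s - int m) ?u" by (rule hom_string_singular[OF F' wf_V m(1)])
  have uc: "?u \<in> carrier_vec m'" using Fc by simp
  define k where "k = ?u $ 0"
  have u: "?u = k \<cdot>\<^sub>v unit_vec m' 0"
    unfolding k_def by (rule act_d_V_kernel[OF uc _ m(4), where s = s']) (use sing in \<open>simp add: singular_def\<close>)
  have ac: "act_a ?X \<in> carrier_mat m' m'" using wf_V[of q m' s'] by (simp add: wf_hmod_def all_gen)
  have Fj: "F *\<^sub>v unit_vec m j = k \<cdot>\<^sub>v (act_a ?X ^\<^sub>m j *\<^sub>v unit_vec m' 0)" if "j < m" for j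
  proof -
    have "dim_col (act_a ?X ^\<^sub>m j) = m'" using ac by simp
    then show ?thesis using hom_string_vec[OF F' wf_V that] u by (simp add: mult_mat_vec_smult)
  qed
  have k0: "k \<noteq> 0"
  proof
    assume "k = 0"
    then have "F *\<^sub>v unit_vec m j = 0\<^sub>v m'" if "j < m" for j using Fj[OF that] ac by simp
    then show False using mat_nonzero_vec[OF Fc F(2)] by blast
  qed
  have b: "act_b ?X *\<^sub>v unit_vec m' 0 = q powi s' \<cdot>\<^sub>v unit_vec m' 0"
    "act_c ?X *\<^sub>v unit_vec m' 0 = q powi (1 - s' - int m') \<cdot>\<^sub>v unit_vec m' 0"
    using string_act(2,3)[OF m(3), of s' "1 - s' - int m'"] unfolding V_string by simp_all
  have bc: "dim_col (act_b ?X) = m'" "dim_col (act_c ?X) = m'"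
    using wf_hmodD(2)[OF wf_V, of q m' s' GB] wf_hmodD(2)[OF wf_V, of q m' s' GC] by simp_all
  have "k * q powi s' = k * q powi s"
    using sing m(3) b bc unfolding singular_def u
    by (intro smult_unit_eq[of _ m']) (auto simp: mult_mat_vec_smult smult_smult_assoc mult.commute)
  then have 1: "int n dvd s' - s" using k0 q_powi_eq_iff by simp
  then show 2: "int n dvd s - s'" by (simp add: dvd_diff_commute)
  have "k * q powi (1 - s' - int m') = k * q powi (1 - s - int m)"
    using sing m(3) b bc unfolding singular_def u
    by (intro smult_unit_eq[of _ m']) (auto simp: mult_mat_vec_smult smult_smult_assoc mult.commute)
  then have "int n dvd (1 - s' - int m') - (1 - s - int m)" using k0 q_powi_eq_iff by simp
  \<comment> \<open>Adding the two congruences eliminates s and s'. Since m and m' lie between 1 and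
    n, a difference divisible by n is zero.\<close>
  from dvd_add[OF this 1] have "int n dvd int m - int m'" by simp
  moreover have "\<bar>int m - int m'\<bar> < int n" using m by auto
  ultimately show mm: "m = m'" using dvd_imp_le_int[of "int m - int m'" "int n"] by fastforce
  have X: "?X = V q m s" using V_cong[OF 2] mm by simp
  have one: "1\<^sub>m m \<in> H_hom (string_mod q m s (1 - s - int m)) (V q m s)"
    using H_hom_one[OF wf_V, of q m s] by (simp add: V_string)
  have "F = k \<cdot>\<^sub>m 1\<^sub>m m"
  proof (rule mat_eq_vecI)
    fix j assume j: "j < m"
    have e: "act_a (V q m s) ^\<^sub>m j *\<^sub>v unit_vec m 0 = unit_vec m j"
      using hom_string_vec[OF one wf_V j] m(1) j by simp
    have "F *\<^sub>v unit_vec m j = k \<cdot>\<^sub>v unit_vec m j"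
      using Fj[OF j] unfolding X unfolding mm[symmetric] e .
    then show "F *\<^sub>v unit_vec m j = (k \<cdot>\<^sub>m 1\<^sub>m m) *\<^sub>v unit_vec m j"
      by (simp add: smult_mat_mult_vec)
  qed (use Fc mm in auto)
  then show "\<exists>k. F = k \<cdot>\<^sub>m 1\<^sub>m m" by blast
qed

lemma one_mat_nonzero: "0 < m \<Longrightarrow> (1\<^sub>m m :: 'k mat) \<noteq> 0\<^sub>m m m"
proof
  assume "0 < m" "(1\<^sub>m m :: 'k mat) = 0\<^sub>m m m"
  then have "(1\<^sub>m m :: 'k mat) $$ (0, 0) = 0\<^sub>m m m $$ (0, 0)" by simp
  then show False using \<open>0 < m\<close> by simp
qed

lemma hom_dim_V_V:
  assumes m: "0 < m" "m \<le> n" "0 < m'" "m' \<le> n"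
  shows "hom_dim (V q m s) (V q m' s') = (if m = m' \<and> int n dvd s - s' then 1 else 0)"
proof (cases "m = m' \<and> int n dvd s - s'")
  case True
  then have X: "V q m' s' = V q m s" using V_cong[of s s' m] by simp
  have "hom_dim (V q m s) (V q m s) = 1"
    unfolding hom_dim_def hdim_V
  proof (rule sdim_one[of _ _ _ "1\<^sub>m m"])
    show "msub m m (H_hom (V q m s) (V q m s))" using H_hom_msub[OF wf_V wf_V, of q m s q m s] by simp
    show "1\<^sub>m m \<in> H_hom (V q m s) (V q m s)" using H_hom_one[OF wf_V, of q m s] by simp
    fix F assume F: "F \<in> H_hom (V q m s) (V q m s)"
    show "\<exists>k. F = k \<cdot>\<^sub>m 1\<^sub>m m"
    proof (cases "F = 0\<^sub>m m m")
      case True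
      then have "F = 0 \<cdot>\<^sub>m 1\<^sub>m m" by (auto intro!: eq_matI)
      then show ?thesis by blast
    next
      case False
      show ?thesis by (rule hom_V_V(3)[OF m(1,2,1,2) F False])
    qed
  qed (use m one_mat_nonzero in auto)
  then show ?thesis using True X by simp
next
  case False
  have "H_hom (V q m s) (V q m' s') = {0\<^sub>m m' m}"
  proof -
    have "F = 0\<^sub>m m' m" if "F \<in> H_hom (V q m s) (V q m' s')" for F
      using hom_V_V(1,2)[OF m that] False by blast
    moreover have "0\<^sub>m m' m \<in> H_hom (V q m s) (V q m' s')"
      using H_hom_zero[OF wf_V wf_V, of q m' s' q m s] by simp
    ultimately show ?thesis by blast
  qed
  then show ?thesis using False by (simp add: hom_dim_def sdim_zero)
qed

text \<open>Weight spaces of the kernel of d contain singular vectors; a string generated by one breaks off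
  exactly where the coefficient of d vanishes, and there a simple module starts.\<close>

lemma exists_singular:
  assumes X: "H_module n q X" and X0: "0 < hdim X"
  obtains u x y where "singular X x y u" "u \<noteq> 0\<^sub>v (hdim X)"
proof -
  let ?r = "hdim X"
  have c: "act_a X \<in> carrier_mat ?r ?r" "act_b X \<in> carrier_mat ?r ?r" "act_c X \<in> carrier_mat ?r ?r" "act_d X \<in> carrier_mat ?r ?r"
    and rel: "act_d X * act_b X = q \<cdot>\<^sub>m (act_b X * act_d X)" "act_d X * act_c X = q \<cdot>\<^sub>m (act_c X * act_d X)"
      "act_b X * act_c X = act_c X * act_b X" "act_d X ^\<^sub>m n = 0\<^sub>m ?r ?r" "act_b X ^\<^sub>m n = 1\<^sub>m ?r" "act_c X ^\<^sub>m n = 1\<^sub>m ?r"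
    using X by (auto simp: H_module_def Let_def)
  have v0: "unit_vec ?r 0 \<in> carrier_vec ?r" "unit_vec ?r 0 \<noteq> (0\<^sub>v ?r :: 'k vec)"
    using X0 by auto
  obtain k where k: "act_d X ^\<^sub>m k *\<^sub>v unit_vec ?r 0 \<noteq> 0\<^sub>v ?r" "act_d X *\<^sub>v (act_d X ^\<^sub>m k *\<^sub>v unit_vec ?r 0) = 0\<^sub>v ?r"
    using nilpotent_last[OF c(4) rel(4) v0] by blast
  define v where "v = act_d X ^\<^sub>m k *\<^sub>v unit_vec ?r 0"
  have v: "v \<in> carrier_vec ?r" "v \<noteq> 0\<^sub>v ?r" "act_d X *\<^sub>v v = 0\<^sub>v ?r"
    using k pow_mat_vec_Suc(2)[OF c(4) v0(1)] by (auto simp: v_def)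
  \<comment> \<open>Projecting first to a b-weight space and then to a c-weight space does not leave
    the kernel of d, because d commutes with b and c up to q; the second projection keeps the
    b-weight because b and c commute.\<close>
  obtain x where x: "eigproj (act_b X) (q ^ x) n v \<noteq> 0\<^sub>v ?r" by (rule eigproj_nonzero[OF c(2) v(1,2)])
  define w where "w = eigproj (act_b X) (q ^ x) n v"
  have qx: "(q ^ x) ^ n = 1" for x using q_pow_n by (metis mult.commute power_mult power_one)
  have w: "w \<in> carrier_vec ?r" "w \<noteq> 0\<^sub>v ?r" "act_d X *\<^sub>v w = 0\<^sub>v ?r" "act_b X *\<^sub>v w = q ^ x \<cdot>\<^sub>v w"
    using x eigproj_closed[OF c(2) v(1)] eigproj_kills[OF c(2) v(1) c(4) rel(1) v(3)]
      eigproj_eigenvector[OF c(2) v(1) rel(5) qx] by (auto simp: w_def)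
  obtain y where y: "eigproj (act_c X) (q ^ y) n w \<noteq> 0\<^sub>v ?r" by (rule eigproj_nonzero[OF c(3) w(1,2)])
  define u where "u = eigproj (act_c X) (q ^ y) n w"
  have u: "u \<in> carrier_vec ?r" "u \<noteq> 0\<^sub>v ?r" "act_d X *\<^sub>v u = 0\<^sub>v ?r" "act_c X *\<^sub>v u = q ^ y \<cdot>\<^sub>v u" "act_b X *\<^sub>v u = q ^ x \<cdot>\<^sub>v u"
    using y eigproj_closed[OF c(3) w(1)] eigproj_kills[OF c(3) w(1) c(4) rel(2) w(3)]
      eigproj_eigenvector[OF c(3) w(1) rel(6) qx] eigproj_eigen[OF c(3) w(1) c(2) rel(3) w(4)] by (auto simp: u_def)
  then have "singular X (int x) (int y) u" by (simp add: singular_def power_int_def)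
  then show thesis using that u(2) by blast
qed

lemma exists_hom_from_V:
  assumes X: "H_module n q X" and X0: "0 < hdim X"
  obtains m s F where "0 < m" "m \<le> n" "F \<in> H_hom (V q m s) X" "F \<noteq> 0\<^sub>m (hdim X) m"
proof -
  note result = that
  let ?r = "hdim X"
  obtain u x y where u: "singular X x y u" "u \<noteq> 0\<^sub>v ?r" by (rule exists_singular[OF X X0])
  have uc: "u \<in> carrier_vec ?r" using u by (simp add: singular_def)
  have ac: "act_a X \<in> carrier_mat ?r ?r" "act_a X ^\<^sub>m n = 0\<^sub>m ?r ?r" using X by (auto simp: H_module_def Let_def)
  \<comment> \<open>It remains to find a nonzero singular vector killed by a^m whose weights satisfy
    the congruence under which a string of length m is V(m, x').\<close>
  have conclude: thesis if w: "singular X x' y' w" "w \<noteq> 0\<^sub>v ?r" and m: "0 < m" "m \<le> n"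
    "act_a X ^\<^sub>m m *\<^sub>v w = 0\<^sub>v ?r" and z: "int n dvd x' + y' + int m - 1" for x' y' w m
  proof -
    obtain F where F: "F \<in> H_hom (string_mod q m x' y') X"
      "\<And>j. j < m \<Longrightarrow> F *\<^sub>v unit_vec m j = act_a X ^\<^sub>m j *\<^sub>v w"
      using string_hom[OF X w(1) m(3)] by metis
    have wc: "w \<in> carrier_vec ?r" using w by (simp add: singular_def)
    have "F *\<^sub>v unit_vec m 0 = w" using F(2)[OF m(1)] ac wc by simp
    then have "F \<noteq> 0\<^sub>m ?r m" using w(2) m by (auto simp: scalar_prod_def)
    then show thesis using result[OF m(1,2)] F(1) unfolding string_eq_V[OF z] by blast
  qed
  obtain k where k: "act_a X ^\<^sub>m k *\<^sub>v u \<noteq> 0\<^sub>v ?r" "act_a X *\<^sub>v (act_a X ^\<^sub>m k *\<^sub>v u) = 0\<^sub>v ?r" "k < n"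
    by (rule nilpotent_last[OF ac uc u(2)])
  have Sk: "act_a X ^\<^sub>m Suc k *\<^sub>v u = 0\<^sub>v ?r" using k pow_mat_vec_Suc(1)[OF ac(1) uc] by simp
  have nz: "act_a X ^\<^sub>m i *\<^sub>v u \<noteq> 0\<^sub>v ?r" if "i \<le> k" for i
  proof
    assume z: "act_a X ^\<^sub>m i *\<^sub>v u = 0\<^sub>v ?r"
    have "act_a X ^\<^sub>m (i + j) *\<^sub>v u = 0\<^sub>v ?r" for j
    proof (induction j)
      case (Suc j)
      then show ?case using pow_mat_vec_Suc(1)[OF ac(1) uc, of "i + j"] ac by (simp add: mult_mat_vec_zero)
    qed (use z in simp)
    from this[of "k - i"] show False using k that by simp
  qed
  \<comment> \<open>d maps a^(k+1) u = 0 to this multiple of a^k u, which is nonzero by the choice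
    of k; so the coefficient must vanish.\<close>
  have "beta q (x + y) (Suc k) \<cdot>\<^sub>v (act_a X ^\<^sub>m k *\<^sub>v u) = 0\<^sub>v ?r"
    using string_in_module(4)[OF X u(1), of "Suc k"] Sk wf_hmodD[OF H_module_wf[OF X], of GD]
    by (simp add: mult_mat_vec_zero del: pow_mat.simps)
  then have "beta q (x + y) (Suc k) = 0"
  proof -
    assume z: "beta q (x + y) (Suc k) \<cdot>\<^sub>v (act_a X ^\<^sub>m k *\<^sub>v u) = 0\<^sub>v ?r"
    show ?thesis
    proof (rule ccontr)
      assume b: "beta q (x + y) (Suc k) \<noteq> 0"
      have "act_a X ^\<^sub>m k *\<^sub>v u = inverse (beta q (x + y) (Suc k)) \<cdot>\<^sub>v (beta q (x + y) (Suc k) \<cdot>\<^sub>v (act_a X ^\<^sub>m k *\<^sub>v u))"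
        using b by (simp add: smult_smult_assoc)
      then show False using k(1) unfolding z by simp
    qed
  qed
  then have "n dvd Suc k \<or> int n dvd x + y + int (Suc k) - 1" unfolding beta_eq_0_iff by simp
  then show thesis
  proof
    assume "int n dvd x + y + int (Suc k) - 1"
    then show thesis using conclude[OF u _ _ Sk] k by simp
  next
    assume "n dvd Suc k"
    then have kn: "Suc k = n" using k by (auto dest: dvd_imp_le)
    \<comment> \<open>The string has full length n, and its weights need not be those of a simple
      module. Here \<open>i\<close> is the place below n where the second factor of
      \<open>beta\<close> vanishes: a^i u is again singular, and the rest of the string, of length n
      - i, satisfies the congruence, since passing from u to a^i u adds 2i to the sum of the
      weights.\<close>
    define i where "i = nat ((1 - x - y) mod int n)"
    have i: "i < n" "int n dvd x + y + int i - 1"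
    proof -
      have pos: "0 \<le> (1 - x - y) mod int n" "(1 - x - y) mod int n < int n" using n2 by auto
      then show "i < n" unfolding i_def by linarith
      have "(x + y + int i - 1) mod int n = ((x + y - 1) + (1 - x - y) mod int n) mod int n"
        unfolding i_def using pos by (simp add: algebra_simps)
      also have "\<dots> = 0" unfolding mod_add_right_eq by simp
      finally show "int n dvd x + y + int i - 1" by (simp add: mod_eq_0_iff_dvd)
    qed
    let ?w = "act_a X ^\<^sub>m i *\<^sub>v u"
    note st = string_in_module[OF X u(1), of i]
    have "beta q (x + y) i = 0" using i(2) by (simp add: beta_eq_0_iff)
    then have "singular X (x + int i) (y + int i) ?w"
      using st pow_mat_vec_Suc(2)[OF ac(1) uc, of "i - 1"] ac unfolding singular_def by auto
    moreover have "?w \<noteq> 0\<^sub>v ?r" using nz i kn by simp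
    moreover have "0 < n - i" "n - i \<le> n" using i by auto
    moreover have "act_a X ^\<^sub>m (n - i) *\<^sub>v ?w = 0\<^sub>v ?r"
    proof -
      have "act_a X ^\<^sub>m j *\<^sub>v ?w = act_a X ^\<^sub>m (i + j) *\<^sub>v u" for j
      proof (induction j)
        case (Suc j)
        then show ?case using pow_mat_vec_Suc(1)[OF ac(1) st(1)] pow_mat_vec_Suc(1)[OF ac(1) uc, of "i + j"] by simp
      qed (use st ac in simp)
      then show ?thesis using i Sk kn by simp
    qed
    moreover have "int n dvd (x + int i) + (y + int i) + int (n - i) - 1"
    proof -
      have eq: "(x + int i) + (y + int i) + int (n - i) - 1 = (x + y + int i - 1) + int n"
        using i by (simp add: of_nat_diff)
      show ?thesis unfolding eq by (rule dvd_add[OF i(2) dvd_refl])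
    qed
    ultimately show thesis by (rule conclude)
  qed
qed

end

subsection \<open>Duality by transposition\<close>

text \<open>Transposition, exchanging the roles of a and d, is a duality on modules; it turns maps out of a
  module into maps from simple modules.\<close>

definition opp :: "'k hmod \<Rightarrow> 'k hmod" where
  "opp M = \<lparr>hdim = hdim M, act_a = transpose_mat (act_d M), act_b = transpose_mat (act_b M),
    act_c = transpose_mat (act_c M), act_d = transpose_mat (act_a M)\<rparr>"

lemma hdim_opp [simp]: "hdim (opp M) = hdim M"
  by (simp add: opp_def)

lemma opp_opp: "opp (opp (M :: 'k hmod)) = M"
  by (simp add: opp_def)

lemma transpose_mult_dim:
  fixes A B :: "'k::comm_ring_1 mat"
  assumes "dim_col A = dim_row B"
  shows "transpose_mat (A * B) = transpose_mat B * transpose_mat A"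
  by (rule transpose_mult[of _ "dim_row A" "dim_col A" _ "dim_col B"]) (use assms in auto)

lemma transpose_pow:
  fixes A :: "'k::comm_ring_1 mat"
  assumes "A \<in> carrier_mat r r"
  shows "transpose_mat A ^\<^sub>m k = transpose_mat (A ^\<^sub>m k)"
proof (induction k)
  case (Suc k)
  have "transpose_mat (A ^\<^sub>m Suc k) = transpose_mat (A ^\<^sub>m k) * transpose_mat A"
    unfolding pow_mat_Suc_left[OF assms] using assms by (intro transpose_mult_dim) auto
  then show ?case using Suc by simp
qed (use assms in simp)

text \<open>Transposition reverses products, so exchanging a with d turns each relation into another
  one of the list; for the last relation it is used that b and c commute.\<close>

lemma opp_module:
  assumes M: "H_module n q M"
  shows "H_module n q (opp M)"
proof -
  define a b c d where ab: "a = act_a M" "b = act_b M" "c = act_c M" "d = act_d M"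
  let ?m = "hdim M"
  note M' = M[unfolded H_module_def Let_def, folded ab]
  have car: "a \<in> carrier_mat ?m ?m" "b \<in> carrier_mat ?m ?m" "c \<in> carrier_mat ?m ?m" "d \<in> carrier_mat ?m ?m"
    using M' by auto
  note dm = carrier_matD[OF car(1)] carrier_matD[OF car(2)] carrier_matD[OF car(3)] carrier_matD[OF car(4)]
  have t: "transpose_mat B * transpose_mat A = transpose_mat (A * B)"
    if "A \<in> carrier_mat ?m ?m" "B \<in> carrier_mat ?m ?m" for A B :: "'a mat"
    using that by (intro transpose_mult_dim[symmetric]) auto
  have ts: "transpose_mat (k \<cdot>\<^sub>m A) = k \<cdot>\<^sub>m transpose_mat A" for k and A :: "'a mat"
    by (auto intro!: eq_matI)
  have tm: "transpose_mat (A - B) = transpose_mat A - transpose_mat B" if "A \<in> carrier_mat ?m ?m" "B \<in> carrier_mat ?m ?m" for A B :: "'a mat"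
    using that by (auto intro!: eq_matI)
  have r: "b * a = q \<cdot>\<^sub>m (a * b)" "d * b = q \<cdot>\<^sub>m (b * d)" "c * a = q \<cdot>\<^sub>m (a * c)" "d * c = q \<cdot>\<^sub>m (c * d)"
    "b * c = c * b" "d * a - q \<cdot>\<^sub>m (a * d) = 1\<^sub>m ?m - b * c"
    "a ^\<^sub>m n = 0\<^sub>m ?m ?m" "b ^\<^sub>m n = 1\<^sub>m ?m" "c ^\<^sub>m n = 1\<^sub>m ?m" "d ^\<^sub>m n = 0\<^sub>m ?m ?m" using M' by auto
  have pr: "X * Y \<in> carrier_mat ?m ?m" if "X \<in> carrier_mat ?m ?m" "Y \<in> carrier_mat ?m ?m" for X Y :: "'a mat"
    using that by auto
  have acts: "act_a (opp M) = transpose_mat d" "act_b (opp M) = transpose_mat b" "act_c (opp M) = transpose_mat c"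
    "act_d (opp M) = transpose_mat a" by (simp_all add: opp_def ab)
  have tc: "transpose_mat a \<in> carrier_mat ?m ?m" "transpose_mat b \<in> carrier_mat ?m ?m"
    "transpose_mat c \<in> carrier_mat ?m ?m" "transpose_mat d \<in> carrier_mat ?m ?m" using car by auto
  have 1: "transpose_mat b * transpose_mat d = q \<cdot>\<^sub>m (transpose_mat d * transpose_mat b)"
    "transpose_mat a * transpose_mat b = q \<cdot>\<^sub>m (transpose_mat b * transpose_mat a)"
    "transpose_mat c * transpose_mat d = q \<cdot>\<^sub>m (transpose_mat d * transpose_mat c)"
    "transpose_mat a * transpose_mat c = q \<cdot>\<^sub>m (transpose_mat c * transpose_mat a)"
    "transpose_mat b * transpose_mat c = transpose_mat c * transpose_mat b"
    by (simp_all only: t car ts[symmetric] r)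
  have 2: "transpose_mat d ^\<^sub>m n = 0\<^sub>m ?m ?m" "transpose_mat b ^\<^sub>m n = 1\<^sub>m ?m" "transpose_mat c ^\<^sub>m n = 1\<^sub>m ?m"
    "transpose_mat a ^\<^sub>m n = 0\<^sub>m ?m ?m"
    using r by (simp_all add: transpose_pow[OF car(1)] transpose_pow[OF car(2)] transpose_pow[OF car(3)] transpose_pow[OF car(4)])
  have "transpose_mat a * transpose_mat d - q \<cdot>\<^sub>m (transpose_mat d * transpose_mat a) = transpose_mat (d * a - q \<cdot>\<^sub>m (a * d))"
    using car by (simp add: t ts tm)
  also have "\<dots> = 1\<^sub>m ?m - transpose_mat (c * b)" unfolding r(6) r(5) using car by (simp add: tm)
  also have "transpose_mat (c * b) = transpose_mat b * transpose_mat c" using car by (simp add: t)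
  finally have 3: "transpose_mat a * transpose_mat d - q \<cdot>\<^sub>m (transpose_mat d * transpose_mat a) = 1\<^sub>m ?m - transpose_mat b * transpose_mat c" .
  show ?thesis
    unfolding H_module_def Let_def acts hdim_opp using tc 1 2 3 by blast
qed

lemma transpose_hom:
  assumes F: "F \<in> H_hom M N" and w: "wf_hmod M" "wf_hmod N"
  shows "transpose_mat F \<in> H_hom (opp N) (opp M)"
proof -
  have d: "dim_row F = hdim N" "dim_col F = hdim M" using F by auto
  have "transpose_mat F * transpose_mat (act N g) = transpose_mat (act M g) * transpose_mat F" for g
    using H_hom_act[OF F, of g] w d by (simp add: transpose_mult_dim[symmetric])
  from this[of GA] this[of GB] this[of GC] this[of GD]
  have "\<forall>g. transpose_mat F * act (opp N) g = act (opp M) g * transpose_mat F"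
    unfolding all_gen by (simp add: opp_def)
  then show ?thesis using d by (intro H_homI) simp_all
qed

lemma H_hom_pow_vec:
  fixes F :: "'k::field mat"
  assumes F: "F \<in> H_hom M N" and w: "wf_hmod M" "wf_hmod N" and v: "v \<in> carrier_vec (hdim M)"
  shows "F *\<^sub>v (act M g ^\<^sub>m k *\<^sub>v v) = act N g ^\<^sub>m k *\<^sub>v (F *\<^sub>v v)"
proof -
  have c: "F \<in> carrier_mat (hdim N) (hdim M)" "act M g \<in> carrier_mat (hdim M) (hdim M)"
    "act N g \<in> carrier_mat (hdim N) (hdim N)" using F w by (auto simp: H_hom_def wf_hmod_def)
  have "F * act M g = 1 \<cdot>\<^sub>m (act N g * F)" using H_hom_act[OF F, of g] by (auto intro!: eq_matI)
  from eigproj_hom[OF c(2) v c(1,3) this, of k] show ?thesis by simp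
qed

context root_of_unity
begin

text \<open>A nonzero map from V(m, s) to the dual of \<open>X\<close> transposes to a nonzero map
  from \<open>X\<close> to the dual of V(m, s), and a diagonal matrix identifies this dual with V(m,
  s).\<close>

lemma exists_hom_to_V:
  assumes X: "H_module n q X" and X0: "0 < hdim X"
  shows "\<exists>m s F. 0 < m \<and> m \<le> n \<and> F \<in> H_hom X (V q m s) \<and> F \<noteq> 0\<^sub>m m (hdim X)"
proof -
  obtain m s F where F: "0 < m" "m \<le> n" "F \<in> H_hom (V q m s) (opp X)" "F \<noteq> 0\<^sub>m (hdim X) m"
    using exists_hom_from_V[OF opp_module[OF X]] X0 unfolding hdim_opp by metis
  have wX: "wf_hmod (opp X)" by (rule H_module_wf[OF opp_module[OF X]])
  have Ft: "transpose_mat F \<in> H_hom X (opp (V q m s))"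
    using transpose_hom[OF F(3) wf_V wX] by (simp add: opp_opp)
  have wo: "wf_hmod (opp (V q m s))" by (rule H_module_wf[OF opp_module[OF V_module[OF F(2)]]])
  define \<beta> where "\<beta> = beta q (s + (1 - s - int m))"
  \<comment> \<open>In the dual, a carries the coefficients \<open>\<beta>\<close> and d has
    coefficients 1. A diagonal matrix intertwines this with V(m, s) when
    \<open>\<kappa> j = \<beta> (Suc j) * \<kappa> (Suc j)\<close>, whence the product of the later
    coefficients.\<close>
  define \<kappa> where "\<kappa> j = prod \<beta> {Suc j..<m}" for j
  have \<kappa>: "\<kappa> j = \<beta> (Suc j) * \<kappa> (Suc j)" if "Suc j < m" for j
    unfolding \<kappa>_def using prod.atLeast_Suc_lessThan[OF that, of \<beta>] by simp
  have \<kappa>0: "\<kappa> j \<noteq> 0" for j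
    unfolding \<kappa>_def \<beta>_def using beta_V_nonzero F(2) by (auto simp: prod_zero_iff)
  define T where "T = mat m m (\<lambda>(i, j). if i = j then \<kappa> j else 0)"
  have Tc: "T \<in> carrier_mat m m" by (simp add: T_def)
  have acts: "act (V q m s) GA = mat m m (\<lambda>(i, j). if i = Suc j then 1 else 0)"
    "act (V q m s) GB = mat m m (\<lambda>(i, j). if i = j then q powi (s + int j) else 0)"
    "act (V q m s) GC = mat m m (\<lambda>(i, j). if i = j then q powi (1 - s - int m + int j) else 0)"
    "act (V q m s) GD = mat m m (\<lambda>(i, j). if j = Suc i then \<beta> j else 0)"
    unfolding V_string \<beta>_def by (simp_all add: string_mod_def)
  have acts': "act (opp (V q m s)) GA = mat m m (\<lambda>(i, j). if i = Suc j then \<beta> i else 0)"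
    "act (opp (V q m s)) GB = mat m m (\<lambda>(i, j). if i = j then q powi (s + int j) else 0)"
    "act (opp (V q m s)) GC = mat m m (\<lambda>(i, j). if i = j then q powi (1 - s - int m + int j) else 0)"
    "act (opp (V q m s)) GD = mat m m (\<lambda>(i, j). if j = Suc i then 1 else 0)"
    using acts by (auto simp: opp_def intro!: eq_matI)
  have "\<forall>g. T * act (opp (V q m s)) g = act (V q m s) g * T"
    unfolding all_gen acts acts' T_def
    by (intro conjI; rule eq_matI; auto simp: scalar_prod_def sum_singles \<kappa>)
  then have T: "T \<in> H_hom (opp (V q m s)) (V q m s)" using Tc by (auto simp: H_hom_iff)
  have "T * transpose_mat F \<in> H_hom X (V q m s)"
    by (rule H_hom_comp[OF T Ft H_module_wf[OF X] wo wf_V])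
  moreover have "T * transpose_mat F \<noteq> 0\<^sub>m m (hdim X)"
  proof
    assume z: "T * transpose_mat F = 0\<^sub>m m (hdim X)"
    have Fc: "F \<in> carrier_mat (hdim X) m" using F(3) by (simp add: H_hom_def)
    have "F $$ (i, j) = 0" if ij: "i < hdim X" "j < m" for i j
    proof -
      have "(T * transpose_mat F) $$ (j, i) = \<kappa> j * F $$ (i, j)"
        using ij Fc by (simp add: T_def scalar_prod_def sum_singles)
      then show ?thesis using z ij \<kappa>0 by simp
    qed
    then have "F = 0\<^sub>m (hdim X) m" using Fc by (intro eq_matI) auto
    then show False using F(4) by simp
  qed
  ultimately show ?thesis using F(1,2) by blast
qed

lemma singular_smult:
  assumes u: "singular X x y u" and wX: "wf_hmod X"
  shows "singular X x y (k \<cdot>\<^sub>v u)"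
proof -
  have d: "dim_col (act_b X) = hdim X" "dim_col (act_c X) = hdim X" "dim_col (act_d X) = hdim X" "dim_vec u = hdim X"
    using u wf_hmodD(2)[OF wX, of GB] wf_hmodD(2)[OF wX, of GC] wf_hmodD(2)[OF wX, of GD] by (auto simp: singular_def)
  show ?thesis using u d unfolding singular_def
    by (simp add: mult_mat_vec_smult smult_smult_assoc mult.commute)
qed

text \<open>d b = q b d and d c = q c d, solved for b d and c d: each application of d multiplies
  both weights by 1/q.\<close>

lemma weight_lowering:
  assumes X: "H_module n q X" and v: "v \<in> carrier_vec (hdim X)"
    and b: "act_b X *\<^sub>v v = q powi x \<cdot>\<^sub>v v" and c: "act_c X *\<^sub>v v = q powi y \<cdot>\<^sub>v v"
  shows "act_b X *\<^sub>v (act_d X ^\<^sub>m k *\<^sub>v v) = q powi (x - int k) \<cdot>\<^sub>v (act_d X ^\<^sub>m k *\<^sub>v v)"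
    "act_c X *\<^sub>v (act_d X ^\<^sub>m k *\<^sub>v v) = q powi (y - int k) \<cdot>\<^sub>v (act_d X ^\<^sub>m k *\<^sub>v v)"
proof -
  have wX: "wf_hmod X" by (rule H_module_wf[OF X])
  have dc: "act_d X \<in> carrier_mat (hdim X) (hdim X)" using wX by (simp add: wf_hmod_def all_gen)
  have dd: "dim_col (act_d X) = hdim X" using dc by simp
  let ?w = "\<lambda>k. act_d X ^\<^sub>m k *\<^sub>v v"
  have wc: "?w k \<in> carrier_vec (hdim X)" for k by (rule pow_mat_vec_Suc(2)[OF dc v])
  have wS: "?w (Suc k) = act_d X *\<^sub>v ?w k" for k by (rule pow_mat_vec_Suc(1)[OF dc v])
  have step: "A *\<^sub>v (act_d X *\<^sub>v u) = q powi (z - 1) \<cdot>\<^sub>v (act_d X *\<^sub>v u)"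
    if u: "u \<in> carrier_vec (hdim X)" and A: "act_d X *\<^sub>v (A *\<^sub>v u) = q \<cdot>\<^sub>v (A *\<^sub>v (act_d X *\<^sub>v u))"
      and e: "A *\<^sub>v u = q powi z \<cdot>\<^sub>v u" for A u z
  proof -
    have 1: "q powi z \<cdot>\<^sub>v (act_d X *\<^sub>v u) = q \<cdot>\<^sub>v (A *\<^sub>v (act_d X *\<^sub>v u))"
      using A u dd unfolding e by (simp add: mult_mat_vec_smult)
    have 2: "inverse q * q powi z = q powi (z - 1)" using q_powi_Suc[of "z - 1"] q0 by simp
    have "A *\<^sub>v (act_d X *\<^sub>v u) = inverse q \<cdot>\<^sub>v (q \<cdot>\<^sub>v (A *\<^sub>v (act_d X *\<^sub>v u)))"
      using q0 by (simp add: smult_smult_assoc)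
    also have "\<dots> = q powi (z - 1) \<cdot>\<^sub>v (act_d X *\<^sub>v u)" unfolding 1[symmetric] by (simp add: smult_smult_assoc 2)
    finally show ?thesis .
  qed
  show "act_b X *\<^sub>v ?w k = q powi (x - int k) \<cdot>\<^sub>v ?w k"
  proof (induction k)
    case (Suc k)
    show ?case unfolding wS using step[OF wc H_module_vec(2)[OF X wc] Suc] by (simp add: algebra_simps)
  qed (use b v dc in simp)
  show "act_c X *\<^sub>v ?w k = q powi (y - int k) \<cdot>\<^sub>v ?w k"
  proof (induction k)
    case (Suc k)
    show ?case unfolding wS using step[OF wc H_module_vec(4)[OF X wc] Suc] by (simp add: algebra_simps)
  qed (use c v dc in simp)
qed

lemma V_n_lowering:
  assumes "k < n"
  shows "\<exists>\<mu>. \<mu> \<noteq> 0 \<and> act_d (V q n s) ^\<^sub>m k *\<^sub>v unit_vec n (n - 1) = \<mu> \<cdot>\<^sub>v unit_vec n (n - 1 - k)"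
  using assms
proof (induction k)
  case 0
  have "dim_row (act_d (V q n s)) = n" using wf_hmodD(1)[OF wf_V, of q n s GD] by simp
  then show ?case by (intro exI[of _ 1]) simp
next
  case (Suc k)
  then obtain \<mu> where \<mu>: "\<mu> \<noteq> 0" "act_d (V q n s) ^\<^sub>m k *\<^sub>v unit_vec n (n - 1) = \<mu> \<cdot>\<^sub>v unit_vec n (n - 1 - k)" by auto
  have dc: "act_d (V q n s) \<in> carrier_mat n n" using wf_V[of q n s] by (simp add: wf_hmod_def all_gen)
  let ?b = "beta q (s + (1 - s - int n)) (n - 1 - k)"
  have "act_d (V q n s) ^\<^sub>m Suc k *\<^sub>v unit_vec n (n - 1) = act_d (V q n s) *\<^sub>v (\<mu> \<cdot>\<^sub>v unit_vec n (n - 1 - k))"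
    unfolding pow_mat_vec_Suc(1)[OF dc unit_vec_carrier] \<mu>(2) ..
  also have "\<dots> = \<mu> \<cdot>\<^sub>v (?b \<cdot>\<^sub>v unit_vec n (n - 1 - k - 1))"
    using string_act(4)[of "n - 1 - k" n s "1 - s - int n"] Suc.prems dc
    by (simp add: mult_mat_vec_smult V_string)
  finally have "act_d (V q n s) ^\<^sub>m Suc k *\<^sub>v unit_vec n (n - 1) = (\<mu> * ?b) \<cdot>\<^sub>v unit_vec n (n - 1 - Suc k)"
    by (simp add: smult_smult_assoc)
  moreover have "\<mu> * ?b \<noteq> 0" using \<mu>(1) beta_V_nonzero[of "n - 1 - k" n s] Suc.prems by simp
  ultimately show ?case by blast
qed

lemma power_int_pow_n: "(q powi x) ^ n = 1"
  using q_pow_n by (metis power_int_mult power_int_of_nat mult.commute power_int_1_left)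

text \<open>A lift of the last vector of V(n, s) is moved by d^(n-1) to a lift of the first one, which is
  singular because d^n = 0.\<close>

lemma V_n_projective: "H_projective n q (V q n s)"
proof (rule projectiveI[OF V_module[OF order_refl]])
  fix A B F R G
  assume A: "H_module n q A" and B: "H_module n q B" and F: "F \<in> H_hom A B"
    and R: "R \<in> carrier_mat (hdim A) (hdim B)" "F * R = 1\<^sub>m (hdim B)" and G: "G \<in> H_hom (V q n s) B"
  note wA = H_module_wf[OF A] and wB = H_module_wf[OF B]
  let ?y = "1 - s - int n"
  have n0: "0 < n" using n2 by simp
  have G': "G \<in> H_hom (string_mod q n s ?y) B" using G by (simp add: V_string)
  have Fc: "F \<in> carrier_mat (hdim B) (hdim A)" and Gc: "G \<in> carrier_mat (hdim B) n"
    using F G by (auto simp: H_hom_def)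
  have cA: "act_b A \<in> carrier_mat (hdim A) (hdim A)" "act_c A \<in> carrier_mat (hdim A) (hdim A)" "act_d A \<in> carrier_mat (hdim A) (hdim A)"
    "act_a A \<in> carrier_mat (hdim A) (hdim A)"
    and cB: "act_b B \<in> carrier_mat (hdim B) (hdim B)" "act_c B \<in> carrier_mat (hdim B) (hdim B)" "act_d B \<in> carrier_mat (hdim B) (hdim B)"
    using wA wB by (auto simp: wf_hmod_def all_gen)
  have rA: "act_b A ^\<^sub>m n = 1\<^sub>m (hdim A)" "act_c A ^\<^sub>m n = 1\<^sub>m (hdim A)" "act_b A * act_c A = act_c A * act_b A"
    "act_d A ^\<^sub>m n = 0\<^sub>m (hdim A) (hdim A)" "act_a A ^\<^sub>m n = 0\<^sub>m (hdim A) (hdim A)"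
    using A by (auto simp: H_module_def Let_def)
  define w where "w = G *\<^sub>v unit_vec n 0"
  define w' where "w' = G *\<^sub>v unit_vec n (n - 1)"
  have wc: "w \<in> carrier_vec (hdim B)" "w' \<in> carrier_vec (hdim B)" using Gc by (auto simp: w_def w'_def)
  have sw: "singular B s ?y w" unfolding w_def by (rule hom_string_singular[OF G' wB n0])
  have w': "w' = act_a B ^\<^sub>m (n - 1) *\<^sub>v w"
    unfolding w_def w'_def using hom_string_vec[OF G' wB, of "n - 1"] n0 by simp
  have bw: "act_b B *\<^sub>v w' = q powi (s + int (n - 1)) \<cdot>\<^sub>v w'" "act_c B *\<^sub>v w' = q powi (?y + int (n - 1)) \<cdot>\<^sub>v w'"
    unfolding w' using string_in_module[OF B sw, of "n - 1"] by auto
  obtain \<mu> where \<mu>: "\<mu> \<noteq> 0" "act_d B ^\<^sub>m (n - 1) *\<^sub>v w' = \<mu> \<cdot>\<^sub>v w"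
  proof -
    obtain \<mu> where \<mu>: "\<mu> \<noteq> 0" "act_d (V q n s) ^\<^sub>m (n - 1) *\<^sub>v unit_vec n (n - 1) = \<mu> \<cdot>\<^sub>v unit_vec n 0"
      using V_n_lowering[of "n - 1" s] n0 by auto
    have "act_d B ^\<^sub>m (n - 1) *\<^sub>v w' = G *\<^sub>v (\<mu> \<cdot>\<^sub>v unit_vec n 0)"
      unfolding w'_def \<mu>(2)[symmetric]
      using H_hom_pow_vec[OF G wf_V wB, of "unit_vec n (n - 1)" GD "n - 1"] by simp
    then have "act_d B ^\<^sub>m (n - 1) *\<^sub>v w' = \<mu> \<cdot>\<^sub>v w" using Gc by (simp add: w_def mult_mat_vec_smult)
    then show thesis using that \<mu>(1) by blast
  qed
  let ?p = "q powi (s + int (n - 1))" and ?r = "q powi (?y + int (n - 1))"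
  define u0 where "u0 = R *\<^sub>v w'"
  have u0: "u0 \<in> carrier_vec (hdim A)" "F *\<^sub>v u0 = w'"
  proof -
    show "u0 \<in> carrier_vec (hdim A)" using R wc by (simp add: u0_def)
    have "F *\<^sub>v u0 = (F * R) *\<^sub>v w'" unfolding u0_def by (rule assoc_mult_mat_vec[OF Fc R(1) wc(2), symmetric])
    then show "F *\<^sub>v u0 = w'" using R wc by simp
  qed
  \<comment> \<open>The linear lift \<open>u0\<close> of the last vector need not be a weight
    vector. The projections to the b- and c-weight spaces commute with \<open>F\<close> and multiply
    \<open>w'\<close> by the nonzero scalar \<open>\<nu>\<close>, so \<open>u2\<close> is a weight
    vector that lifts \<open>\<nu>\<close> times \<open>w'\<close>.\<close>
  define u1 where "u1 = eigproj (act_b A) ?p n u0"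
  define u2 where "u2 = eigproj (act_c A) ?r n u1"
  obtain k where k: "n = Suc k" using n0 by (cases n) auto
  define \<nu> where "\<nu> = (of_nat n * ?r ^ k) * (of_nat n * ?p ^ k)"
  have \<nu>0: "\<nu> \<noteq> 0" unfolding \<nu>_def using of_nat_n q0 by simp
  have u1: "u1 \<in> carrier_vec (hdim A)" "act_b A *\<^sub>v u1 = ?p \<cdot>\<^sub>v u1" "F *\<^sub>v u1 = (of_nat n * ?p ^ k) \<cdot>\<^sub>v w'"
  proof -
    show "u1 \<in> carrier_vec (hdim A)" unfolding u1_def by (rule eigproj_closed[OF cA(1) u0(1)])
    show "act_b A *\<^sub>v u1 = ?p \<cdot>\<^sub>v u1" unfolding u1_def
      by (rule eigproj_eigenvector[OF cA(1) u0(1) rA(1) power_int_pow_n])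
    have "F *\<^sub>v u1 = eigproj (act_b B) ?p n w'" unfolding u1_def u0(2)[symmetric]
      by (rule eigproj_commute[OF cA(1) u0(1) Fc cB(1)]) (use H_hom_act[OF F, of GB] in simp)
    then show "F *\<^sub>v u1 = (of_nat n * ?p ^ k) \<cdot>\<^sub>v w'"
      using eigproj_fixed[OF cB(1) wc(2) bw(1), of k] unfolding k[symmetric] by simp
  qed
  have u2: "u2 \<in> carrier_vec (hdim A)" "act_b A *\<^sub>v u2 = ?p \<cdot>\<^sub>v u2" "act_c A *\<^sub>v u2 = ?r \<cdot>\<^sub>v u2" "F *\<^sub>v u2 = \<nu> \<cdot>\<^sub>v w'"
  proof -
    show "u2 \<in> carrier_vec (hdim A)" unfolding u2_def by (rule eigproj_closed[OF cA(2) u1(1)])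
    show "act_b A *\<^sub>v u2 = ?p \<cdot>\<^sub>v u2" unfolding u2_def
      by (rule eigproj_eigen[OF cA(2) u1(1) cA(1) rA(3) u1(2)])
    show "act_c A *\<^sub>v u2 = ?r \<cdot>\<^sub>v u2" unfolding u2_def
      by (rule eigproj_eigenvector[OF cA(2) u1(1) rA(2) power_int_pow_n])
    let ?z = "(of_nat n * ?p ^ k) \<cdot>\<^sub>v w'"
    have z: "?z \<in> carrier_vec (hdim B)" using wc by simp
    have cz: "act_c B *\<^sub>v ?z = ?r \<cdot>\<^sub>v ?z"
      using bw(2) wc cB by (simp add: mult_mat_vec_smult smult_smult_assoc mult.commute)
    have "F *\<^sub>v u2 = eigproj (act_c B) ?r n ?z" unfolding u2_def u1(3)[symmetric]
      by (rule eigproj_commute[OF cA(2) u1(1) Fc cB(2)]) (use H_hom_act[OF F, of GC] in simp)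
    then have "F *\<^sub>v u2 = (of_nat n * ?r ^ k) \<cdot>\<^sub>v ?z"
      using eigproj_fixed[OF cB(2) z cz, of k] unfolding k[symmetric] by simp
    then show "F *\<^sub>v u2 = \<nu> \<cdot>\<^sub>v w'" by (simp add: smult_smult_assoc \<nu>_def)
  qed
  define u3 where "u3 = act_d A ^\<^sub>m (n - 1) *\<^sub>v u2"
  have n1: "Suc (n - 1) = n" using n0 by simp
  have s3: "singular A s ?y u3"
  proof -
    have "act_d A *\<^sub>v u3 = act_d A ^\<^sub>m n *\<^sub>v u2"
      unfolding u3_def using pow_mat_vec_Suc(1)[OF cA(3) u2(1), of "n - 1"] unfolding n1 by simp
    also have "\<dots> = 0\<^sub>v (hdim A)" unfolding rA using u2(1) by (auto intro!: eq_vecI simp: scalar_prod_def)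
    finally have "act_d A *\<^sub>v u3 = 0\<^sub>v (hdim A)" .
    then show ?thesis
      using weight_lowering[OF A u2(1-3), of "n - 1"] pow_mat_vec_Suc(2)[OF cA(3) u2(1)]
      by (simp add: singular_def u3_def)
  qed
  have u3c: "u3 \<in> carrier_vec (hdim A)" using s3 by (simp add: singular_def)
  have F3: "F *\<^sub>v u3 = (\<nu> * \<mu>) \<cdot>\<^sub>v w"
  proof -
    have "F *\<^sub>v u3 = act_d B ^\<^sub>m (n - 1) *\<^sub>v (\<nu> \<cdot>\<^sub>v w')"
      unfolding u3_def u2(4)[symmetric] using H_hom_pow_vec[OF F wA wB u2(1), of GD "n - 1"] by simp
    also have "\<dots> = \<nu> \<cdot>\<^sub>v (act_d B ^\<^sub>m (n - 1) *\<^sub>v w')"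
      using cB wc by (intro mult_mat_vec_smult) simp
    also have "\<dots> = (\<nu> * \<mu>) \<cdot>\<^sub>v w" unfolding \<mu>(2) by (simp add: smult_smult_assoc)
    finally show ?thesis .
  qed
  define u where "u = inverse (\<nu> * \<mu>) \<cdot>\<^sub>v u3"
  have su: "singular A s ?y u" unfolding u_def by (rule singular_smult[OF s3 wA])
  have uc: "u \<in> carrier_vec (hdim A)" using su by (simp add: singular_def)
  have Fu: "F *\<^sub>v u = w"
  proof -
    have "F *\<^sub>v u = inverse (\<nu> * \<mu>) \<cdot>\<^sub>v ((\<nu> * \<mu>) \<cdot>\<^sub>v w)"
      unfolding u_def F3[symmetric] using Fc u3c by (intro mult_mat_vec_smult) simp
    also have "\<dots> = (inverse (\<nu> * \<mu>) * (\<nu> * \<mu>)) \<cdot>\<^sub>v w" by (simp only: smult_smult_assoc)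
    also have "inverse (\<nu> * \<mu>) * (\<nu> * \<mu>) = 1" using \<nu>0 \<mu>(1) by (intro left_inverse) simp
    also have "1 \<cdot>\<^sub>v w = w" by simp
    finally show ?thesis .
  qed
  \<comment> \<open>As a^n = 0, any singular vector with these weights receives a map from the
    string of length n, which is V(n, s); a shorter string would need a vanishing condition on
    u.\<close>
  have "act_a A ^\<^sub>m n *\<^sub>v u = 0\<^sub>v (hdim A)" unfolding rA using uc by (auto intro!: eq_vecI simp: scalar_prod_def)
  from string_hom[OF A su this] obtain L where L: "L \<in> H_hom (string_mod q n s ?y) A"
    "\<And>j. j < n \<Longrightarrow> L *\<^sub>v unit_vec n j = act_a A ^\<^sub>m j *\<^sub>v u" by metis
  have Lc: "L \<in> carrier_mat (hdim A) n" using L(1) by (simp add: H_hom_def)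
  have "F * L = G"
  proof (rule mat_eq_vecI[of _ "hdim B" n])
    fix j assume j: "j < n"
    have "F * L *\<^sub>v unit_vec n j = F *\<^sub>v (act_a A ^\<^sub>m j *\<^sub>v u)"
      using L(2)[OF j] assoc_mult_mat_vec[OF Fc Lc unit_vec_carrier] by simp
    also have "\<dots> = act_a B ^\<^sub>m j *\<^sub>v w" using H_hom_pow_vec[OF F wA wB uc, of GA j] Fu by simp
    also have "\<dots> = G *\<^sub>v unit_vec n j" unfolding w_def using hom_string_vec[OF G' wB j] by simp
    finally show "F * L *\<^sub>v unit_vec n j = G *\<^sub>v unit_vec n j" .
  qed (use Fc Lc Gc in auto)
  then show "\<exists>L\<in>H_hom (V q n s) A. F * L = G" using L(1) unfolding V_string by blast
qed

section \<open>Projective covers, and projective modules determined by their multiplicities\<close>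

lemma V_n_cover: "H_projective_cover n q (V q n s) (V q n s)"
proof -
  have one: "1\<^sub>m n \<in> H_hom (V q n s) (V q n s)" using H_hom_one[OF wf_V, of q n s] by simp
  then have "1\<^sub>m n \<in> H_epi (V q n s) (V q n s)"
    unfolding H_epi_iff[OF wf_V wf_V] by (auto intro!: bexI[of _ "1\<^sub>m n"])
  moreover have "1\<^sub>m n * G = G" if "G \<in> H_hom X (V q n s)" for G X using that by (simp add: mone)
  ultimately show ?thesis
    unfolding H_projective_cover_def using V_n_projective V_module[OF order_refl]
    by (intro conjI bexI[of _ "1\<^sub>m n"]) simp_all
qed

text \<open>If \<open>f\<close> did not vanish on the kernel of \<open>E\<close>, it would map this
  kernel onto V(m', s'), and (E, f) would map \<open>P\<close> onto the direct sum of the two simple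
  modules. Lifting (E, 0) along it gives an endomorphism \<open>L\<close> with
  \<open>E * L = E\<close> and \<open>f * L = 0\<close>. As \<open>E\<close> is essential,
  \<open>L\<close> is surjective, so f = 0, a contradiction.\<close>

lemma cover_hom_factors:
  assumes P: "H_projective n q P" and m: "m \<le> n" "m' \<le> n"
    and E: "E \<in> H_hom P (V q m s)" "R \<in> carrier_mat (hdim P) m" "E * R = 1\<^sub>m m"
    and ess: "\<And>X G. H_module n q X \<Longrightarrow> G \<in> H_hom X P \<Longrightarrow> E * G \<in> H_epi X (V q m s) \<Longrightarrow> G \<in> H_epi X P"
    and f: "f \<in> H_hom P (V q m' s')"
  shows "f * R * E = f"
proof (rule ccontr)
  assume ne: "f * R * E \<noteq> f"
  let ?V = "V q m s" and ?V' = "V q m' s'"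
  note wP = projective_wf[OF P]
  have c: "E \<in> carrier_mat m (hdim P)" "f \<in> carrier_mat m' (hdim P)" using E f by (auto simp: H_hom_def)
  note d = carrier_matD[OF c(1)] carrier_matD[OF c(2)] carrier_matD[OF E(2)]
  define K where "K = {v \<in> carrier_vec (hdim P). E *\<^sub>v v = 0\<^sub>v m}"
  \<comment> \<open>The linear projection onto the kernel of \<open>E\<close> along the image of
    \<open>R\<close>. The claim \<open>f * R * E = f\<close> says that \<open>f\<close> vanishes on
    this kernel.\<close>
  let ?N = "1\<^sub>m (hdim P) - R * E"
  have Nc: "?N \<in> carrier_mat (hdim P) (hdim P)" using d by auto
  have EN: "E * ?N = 0\<^sub>m m (hdim P)" using d by (simp add: malg mult_cancel_assoc[OF E(3)])
  have "f * ?N \<noteq> 0\<^sub>m m' (hdim P)"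
  proof
    assume z: "f * ?N = 0\<^sub>m m' (hdim P)"
    have fN: "f * ?N = f - f * R * E" using d by (simp add: malg)
    have "f * R * E = f"
    proof (rule eq_matI)
      fix i j assume ij: "i < dim_row f" "j < dim_col f"
      have "(f - f * R * E) $$ (i, j) = 0" using z fN ij d by simp
      then show "(f * R * E) $$ (i, j) = f $$ (i, j)" using ij d by simp
    qed (use d in auto)
    then show False using ne by simp
  qed
  then obtain j where j: "j < hdim P" "(f * ?N) *\<^sub>v unit_vec (hdim P) j \<noteq> 0\<^sub>v m'"
    using mat_nonzero_vec[of "f * ?N" m' "hdim P"] c Nc by auto
  define x where "x = ?N *\<^sub>v unit_vec (hdim P) j"
  have xK: "x \<in> K"
  proof -
    have "E *\<^sub>v x = (E * ?N) *\<^sub>v unit_vec (hdim P) j" unfolding x_def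
      by (rule assoc_mult_mat_vec[OF c(1) Nc unit_vec_carrier, symmetric])
    also have "\<dots> = 0\<^sub>v m" unfolding EN by (auto intro!: eq_vecI simp: scalar_prod_def)
    finally have "E *\<^sub>v x = 0\<^sub>v m" .
    moreover have "x \<in> carrier_vec (hdim P)" unfolding x_def by (rule mult_mat_vec_carrier[OF Nc unit_vec_carrier])
    ultimately show ?thesis by (simp add: K_def)
  qed
  have fx: "f *\<^sub>v x \<noteq> 0\<^sub>v m'"
    using j(2) assoc_mult_mat_vec[OF c(2) Nc unit_vec_carrier] unfolding x_def by simp
  have K: "K \<subseteq> carrier_vec (hdim P)" "0\<^sub>v (hdim P) \<in> K" "u \<in> K \<Longrightarrow> v \<in> K \<Longrightarrow> u + v \<in> K"
      "u \<in> K \<Longrightarrow> k \<cdot>\<^sub>v u \<in> K" "u \<in> K \<Longrightarrow> act P g *\<^sub>v u \<in> K" for u v k g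
  proof -
    show "K \<subseteq> carrier_vec (hdim P)" by (auto simp: K_def)
    show "0\<^sub>v (hdim P) \<in> K" using d by (simp add: K_def mult_mat_vec_zero)
    show "u \<in> K \<Longrightarrow> v \<in> K \<Longrightarrow> u + v \<in> K" using d by (simp add: K_def mult_mat_vec_add)
    show "u \<in> K \<Longrightarrow> k \<cdot>\<^sub>v u \<in> K" using d by (simp add: K_def mult_mat_vec_smult)
    assume u: "u \<in> K"
    have "E *\<^sub>v (act P g *\<^sub>v u) = act ?V g *\<^sub>v (E *\<^sub>v u)"
      using H_hom_vec[OF E(1) wP wf_V] u by (simp add: K_def del: act.simps)
    also have "\<dots> = 0\<^sub>v m" using u wf_hmodD[OF wf_V, of q m s g] by (simp add: K_def mult_mat_vec_zero del: act.simps)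
    finally show "act P g *\<^sub>v u \<in> K" using act_closed[OF wP, of u g] u by (simp add: K_def del: act.simps)
  qed
  note ic = image_act_closed[OF f wP wf_V K, unfolded hdim_V]
  have im: "(\<lambda>v. f *\<^sub>v v) ` K = carrier_vec m'"
    by (rule V_invariant_subspace[OF ic _ fx m(2)]) (use xK in auto)
  have "\<exists>v. v \<in> K \<and> f *\<^sub>v v = unit_vec m' j" for j
  proof -
    have "unit_vec m' j \<in> (\<lambda>v. f *\<^sub>v v) ` K" unfolding im by simp
    then obtain v where "v \<in> K" "unit_vec m' j = f *\<^sub>v v" by blast
    then show ?thesis by metis
  qed
  then obtain z where z: "z j \<in> K" "f *\<^sub>v z j = unit_vec m' j" for j by metis
  \<comment> \<open>A linear section of \<open>f\<close> with values in the kernel of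
    \<open>E\<close>.\<close>
  define R' where "R' = mat (hdim P) m' (\<lambda>(i, j). z j $ i)"
  have R'c: "R' \<in> carrier_mat (hdim P) m'" by (simp add: R'_def)
  note d = d carrier_matD[OF R'c]
  have R'u: "R' *\<^sub>v unit_vec m' j = z j" if "j < m'" for j
  proof -
    have "dim_vec (z j) = hdim P" using z(1)[of j] by (simp add: K_def)
    then have "col R' j = z j" using that by (auto intro!: eq_vecI simp: R'_def)
    then show ?thesis using mult_mat_unit[of j R'] that d by simp
  qed
  have fR': "f * R' = 1\<^sub>m m'"
  proof (rule mat_eq_vecI[of _ m' m'])
    fix j assume j: "j < m'"
    show "f * R' *\<^sub>v unit_vec m' j = 1\<^sub>m m' *\<^sub>v unit_vec m' j"
      using assoc_mult_mat_vec[OF c(2) R'c unit_vec_carrier] R'u[OF j] z by simp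
  qed (use c R'c in auto)
  have ER': "E * R' = 0\<^sub>m m m'"
  proof (rule mat_eq_vecI[of _ m m'])
    fix j assume j: "j < m'"
    have "E * R' *\<^sub>v unit_vec m' j = 0\<^sub>v m"
      using assoc_mult_mat_vec[OF c(1) R'c unit_vec_carrier] R'u[OF j] z(1)[of j] by (simp add: K_def)
    then show "E * R' *\<^sub>v unit_vec m' j = 0\<^sub>m m m' *\<^sub>v unit_vec m' j"
      by (auto intro!: eq_vecI simp: scalar_prod_def)
  qed (use c R'c in auto)
  let ?D = "H_dsum [?V, ?V']"
  have bp: "biprod ?D ?V (H_dsum [?V'])" by (rule biprod_H_dsum_Cons) (auto simp: wf_V)
  have D1: "H_dsum [?V'] = ?V'"
  proof (rule hmod_eqI)
    show "act (H_dsum [?V']) g = act ?V' g" for g by (simp only: act_H_dsum list.map diag_block_mat_singleton)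
  qed (simp add: H_dsum_def)
  obtain f1 g1 p i where b: "f1 \<in> H_hom ?D ?V" "g1 \<in> H_hom ?V ?D" "p \<in> H_hom ?D ?V'" "i \<in> H_hom ?V' ?D"
    "f1 * g1 = 1\<^sub>m m" "p * i = 1\<^sub>m m'" "g1 * f1 + i * p = 1\<^sub>m (hdim ?D)"
    "f1 * i = 0\<^sub>m m m'" "p * g1 = 0\<^sub>m m' m" "wf_hmod ?D"
    using bp unfolding D1 biprod_def by auto
  have DM: "H_module n q ?D"
    by (rule jointly_monic_H_module[OF V_module[OF m(1)] V_module[OF m(2)] b(10) b(1,3), of g1 i])
       (use b in \<open>auto simp: H_hom_def\<close>)
  \<comment> \<open>\<open>?S\<close> is the map (E, f). Subtracting \<open>R' * (f * R)\<close>
    from \<open>R\<close> gives a section of \<open>E\<close> on which \<open>f\<close> vanishes;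
    together with \<open>R'\<close> this makes \<open>?T\<close> a right inverse of
    \<open>?S\<close>.\<close>
  let ?S = "g1 * E + i * f" and ?T = "(R - R' * (f * R)) * f1 + R' * p"
  have S: "?S \<in> H_hom P ?D"
    by (intro H_hom_add(1) H_hom_comp[OF b(2) E(1)] H_hom_comp[OF b(4) f]) (simp_all add: wP wf_V b(10))
  note d = d H_homD[OF b(1), unfolded hdim_V] H_homD[OF b(2), unfolded hdim_V] H_homD[OF b(3), unfolded hdim_V] H_homD[OF b(4), unfolded hdim_V]
  have Tc: "?T \<in> carrier_mat (hdim P) (hdim ?D)" using d by auto
  have "?S * ?T = g1 * f1 + i * p"
    using d by (simp add: malg E(3) fR' ER' mult_cancel_assoc[OF E(3)] mult_cancel_assoc[OF fR'] mult_cancel_assoc[OF ER'])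
      (intro eq_matI; simp)
  then have ST: "?S * ?T = 1\<^sub>m (hdim ?D)" using b(7) by simp
  have gE: "g1 * E \<in> H_hom P ?D" by (rule H_hom_comp[OF b(2) E(1) wP wf_V b(10)])
  obtain L where L: "L \<in> H_hom P P" "?S * L = g1 * E"
    using projective_lift[OF P projective_module[OF P] DM S Tc ST gE] by blast
  note d = d H_homD[OF L(1)]
  have EL: "E * L = E"
  proof -
    have "f1 * (?S * L) = E * L" using d by (simp add: malg mult_cancel_assoc[OF b(5)] mult_cancel_assoc[OF b(8)])
    moreover have "f1 * (?S * L) = E" unfolding L(2) using d by (simp add: malg mult_cancel_assoc[OF b(5)])
    ultimately show ?thesis by simp
  qed
  have fL: "f * L = 0\<^sub>m m' (hdim P)"
  proof -
    have "p * (?S * L) = f * L" using d by (simp add: malg mult_cancel_assoc[OF b(6)] mult_cancel_assoc[OF b(9)])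
    moreover have "p * (?S * L) = 0\<^sub>m m' (hdim P)" unfolding L(2) using d by (simp add: malg mult_cancel_assoc[OF b(9)])
    ultimately show ?thesis by simp
  qed
  have "E \<in> H_epi P ?V" unfolding H_epi_iff[OF wP wf_V] using E by auto
  then have "L \<in> H_epi P P" using ess[OF projective_module[OF P] L(1)] EL by simp
  then obtain L' where L': "L' \<in> carrier_mat (hdim P) (hdim P)" "L * L' = 1\<^sub>m (hdim P)"
    unfolding H_epi_iff[OF wP wP] by blast
  have "f = f * L * L'" using L' d by (simp add: massoc mone)
  also have "\<dots> = 0\<^sub>m m' (hdim P)" unfolding fL using L' by (simp add: mzero)
  finally have "f *\<^sub>v x = 0\<^sub>v m'" using xK by (auto simp: K_def intro!: eq_vecI simp: scalar_prod_def)
  then show False using fx by simp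
qed

text \<open>Composition with \<open>E\<close> is injective because \<open>E\<close> has a right
  inverse, and surjective by \<open>cover_hom_factors\<close>. By \<open>hom_dim_V_V\<close> the
  multiplicities of a cover are therefore 0 or 1.\<close>

lemma cover_hom_dim:
  assumes P: "H_projective_cover n q P (V q m s)" and m: "m \<le> n" "m' \<le> n"
  shows "hom_dim P (V q m' s') = hom_dim (V q m s) (V q m' s')"
proof -
  let ?V = "V q m s" and ?V' = "V q m' s'"
  have pr: "H_projective n q P" using P by (simp add: H_projective_cover_def)
  note wP = projective_wf[OF pr]
  obtain E where E: "E \<in> H_epi P ?V"
    "\<And>X G. H_module n q X \<Longrightarrow> G \<in> H_hom X P \<Longrightarrow> E * G \<in> H_epi X ?V \<Longrightarrow> G \<in> H_epi X P"
    using P unfolding H_projective_cover_def by blast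
  obtain R where R: "E \<in> H_hom P ?V" "R \<in> carrier_mat (hdim P) m" "E * R = 1\<^sub>m m"
    using E(1) unfolding H_epi_iff[OF wP wf_V] by auto
  have fac: "f * R * E = f" if "f \<in> H_hom P ?V'" for f
    by (rule cover_hom_factors[OF pr m R E(2) that])
  note d = H_homD[OF R(1), unfolded hdim_V] carrier_matD[OF R(2)]
  have hR: "f * R \<in> H_hom ?V ?V'" if f: "f \<in> H_hom P ?V'" for f
  proof (rule H_homI)
    fix g
    note df = H_homD[OF f, unfolded hdim_V]
    have "f * R * act ?V g * E = f * R * E * act P g"
      using d df wP wf_V[of q m s] by (simp add: massoc H_hom_act[OF R(1)] del: act.simps)
    also have "\<dots> = act ?V' g * (f * R * E)" using fac[OF f] H_hom_act[OF f, of g] by simp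
    finally have "f * R * act ?V g * E * R = act ?V' g * (f * R * E) * R" by simp
    then show "f * R * act ?V g = act ?V' g * (f * R)"
      using d df R(3) wf_V[of q m s] wf_V[of q m' s'] by (simp add: massoc mone del: act.simps)
  qed (use d H_homD[OF f] in auto)
  have bij: "bij_betw (\<lambda>L. L * E) (H_hom ?V ?V') (H_hom P ?V')"
  proof (rule bij_betw_byWitness[where f' = "\<lambda>f. f * R"])
    show "\<forall>L\<in>H_hom ?V ?V'. L * E * R = L" using d R(3) by (auto simp: massoc mone)
    show "\<forall>f\<in>H_hom P ?V'. f * R * E = f" using fac by blast
    show "(\<lambda>L. L * E) ` H_hom ?V ?V' \<subseteq> H_hom P ?V'" using H_hom_comp[OF _ R(1) wP wf_V wf_V] by blast
    show "(\<lambda>f. f * R) ` H_hom P ?V' \<subseteq> H_hom ?V ?V'" using hR by blast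
  qed
  have "sdim m' m (H_hom ?V ?V') = sdim m' (hdim P) (H_hom P ?V')"
  proof (rule sdim_eq[OF _ _ bij])
    show "msub m' m (H_hom ?V ?V')" "msub m' (hdim P) (H_hom P ?V')"
      using H_hom_msub[OF wf_V wf_V, of q m' s' q m s] H_hom_msub[OF wP wf_V, of q m' s'] H_hom_msub[OF wf_V wf_V, of q m s q m' s'] by simp_all
  qed (use d in \<open>auto simp: mdist_right msmult\<close>)
  then show ?thesis by (simp add: hom_dim_def)
qed

lemma hom_dim_pos_iff:
  assumes "wf_hmod M" "wf_hmod N"
  shows "hom_dim M N > 0 \<longleftrightarrow> (\<exists>F\<in>H_hom M N. F \<noteq> 0\<^sub>m (hdim N) (hdim M))"
proof
  assume h: "hom_dim M N > 0"
  show "\<exists>F\<in>H_hom M N. F \<noteq> 0\<^sub>m (hdim N) (hdim M)"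
  proof (rule ccontr)
    assume "\<not> (\<exists>F\<in>H_hom M N. F \<noteq> 0\<^sub>m (hdim N) (hdim M))"
    then have "H_hom M N = {0\<^sub>m (hdim N) (hdim M)}" using H_hom_zero[OF assms] by blast
    then show False using h by (simp add: hom_dim_def sdim_zero)
  qed
next
  assume "\<exists>F\<in>H_hom M N. F \<noteq> 0\<^sub>m (hdim N) (hdim M)"
  then show "hom_dim M N > 0" unfolding hom_dim_def using sdim_pos[OF H_hom_msub[OF assms]] by blast
qed

text \<open>A nonzero map to V(m, s) is surjective and lifts to a map \<open>L\<close> into
  \<open>P\<close>. As \<open>E\<close> is essential, \<open>L\<close> is surjective, and it splits
  because \<open>P\<close> is projective.\<close>

lemma split_cover:
  assumes M: "H_projective n q M" and P: "H_projective_cover n q P (V q m s)" and m: "m \<le> n"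
    and h: "hom_dim M (V q m s) > 0"
  shows "\<exists>M'. H_module n q M' \<and> biprod M P M'"
proof -
  let ?V = "V q m s"
  have pr: "H_projective n q P" using P by (simp add: H_projective_cover_def)
  note wP = projective_wf[OF pr] and wM = projective_wf[OF M] and MM = projective_module[OF M] and PM = projective_module[OF pr]
  obtain E where E: "E \<in> H_epi P ?V"
    "\<And>X G. H_module n q X \<Longrightarrow> G \<in> H_hom X P \<Longrightarrow> E * G \<in> H_epi X ?V \<Longrightarrow> G \<in> H_epi X P"
    using P unfolding H_projective_cover_def by blast
  obtain R where R: "E \<in> H_hom P ?V" "R \<in> carrier_mat (hdim P) (hdim ?V)" "E * R = 1\<^sub>m (hdim ?V)"
    using E(1) unfolding H_epi_iff[OF wP wf_V] by auto
  obtain f where f: "f \<in> H_hom M ?V" "f \<noteq> 0\<^sub>m m (hdim M)"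
    using h unfolding hom_dim_pos_iff[OF wM wf_V] by auto
  have fe: "f \<in> H_epi M ?V" by (rule hom_to_V_epi[OF wM f m])
  obtain L where L: "L \<in> H_hom M P" "E * L = f"
    using projective_lift[OF M PM V_module[OF m] R f(1)] by blast
  have "L \<in> H_epi M P" using E(2)[OF MM L(1)] L(2) fe by simp
  then obtain K where K: "K \<in> carrier_mat (hdim M) (hdim P)" "L * K = 1\<^sub>m (hdim P)"
    unfolding H_epi_iff[OF wM wP] by blast
  obtain g where g: "g \<in> H_hom P M" "L * g = 1\<^sub>m (hdim P)"
    using projective_lift[OF pr MM PM L(1) K H_hom_one[OF wP]] by blast
  show ?thesis using hom_split[OF MM wP L(1) g] by blast
qed

lemma hom_dim_empty:
  assumes "hdim M = 0 \<or> hdim N = 0"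
  shows "wf_hmod M \<Longrightarrow> wf_hmod N \<Longrightarrow> hom_dim M N = 0"
proof -
  assume w: "wf_hmod M" "wf_hmod N"
  have "F = 0\<^sub>m (hdim N) (hdim M)" if "F \<in> H_hom M N" for F
    using H_homD[OF that] assms by (intro eq_matI) auto
  then show ?thesis using hom_dim_pos_iff[OF w] by (metis gr0I)
qed

lemma projective_iso:
  assumes P: "\<And>m s. 0 < m \<Longrightarrow> m \<le> n \<Longrightarrow> H_projective_cover n q (P m s) (V q m s)"
    and M: "H_projective n q M" and N: "H_projective n q N"
    and h: "\<And>m s. 0 < m \<Longrightarrow> m \<le> n \<Longrightarrow> hom_dim M (V q m s) = hom_dim N (V q m s)"
  shows "H_iso n q M N"
  using M N h
proof (induction "hdim M" arbitrary: M N rule: less_induct)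
  case less
  note wM = projective_wf[OF less.prems(1)] and wN = projective_wf[OF less.prems(2)]
  note MM = projective_module[OF less.prems(1)] and NM = projective_module[OF less.prems(2)]
  show ?case
  proof (cases "hdim M = 0")
    case True
    have N0: "hdim N = 0"
    proof (rule ccontr)
      assume "hdim N \<noteq> 0"
      then obtain m s F where F: "0 < m" "m \<le> n" "F \<in> H_hom N (V q m s)" "F \<noteq> 0\<^sub>m m (hdim N)"
        using exists_hom_to_V[OF NM] by blast
      then have "hom_dim N (V q m s) > 0" unfolding hom_dim_pos_iff[OF wN wf_V] by auto
      moreover have "hom_dim M (V q m s) = 0" using hom_dim_empty[of M] True wM wf_V by blast
      ultimately show False using less.prems(3)[OF F(1,2), of s] by simp
    qed
    have z: "0\<^sub>m 0 0 \<in> H_hom M N" "0\<^sub>m 0 0 \<in> H_hom N M"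
      using H_hom_zero[OF wM wN] H_hom_zero[OF wN wM] True N0 by simp_all
    have "0\<^sub>m 0 0 * 0\<^sub>m 0 0 = (1\<^sub>m 0 :: 'k mat)" by (auto intro!: eq_matI)
    then show ?thesis unfolding H_iso_def using z MM NM True N0 by metis
  next
    case False
    then obtain m s F where F: "0 < m" "m \<le> n" "F \<in> H_hom M (V q m s)" "F \<noteq> 0\<^sub>m m (hdim M)"
      using exists_hom_to_V[OF MM] by blast
    then have hM: "hom_dim M (V q m s) > 0" unfolding hom_dim_pos_iff[OF wM wf_V] by auto
    then have hN: "hom_dim N (V q m s) > 0" using less.prems(3)[OF F(1,2), of s] by simp
    note Pms = P[OF F(1,2), of s]
    obtain M' where M': "H_module n q M'" "biprod M (P m s) M'"
      using split_cover[OF less.prems(1) Pms F(2) hM] by blast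
    obtain N' where N': "H_module n q N'" "biprod N (P m s) N'"
      using split_cover[OF less.prems(2) Pms F(2) hN] by blast
    have pP: "H_projective n q (P m s)" using Pms by (simp add: H_projective_cover_def)
    have P0: "0 < hdim (P m s)"
    proof -
      obtain E where "E \<in> H_epi (P m s) (V q m s)" using Pms unfolding H_projective_cover_def by blast
      then obtain R where "E \<in> carrier_mat m (hdim (P m s))" "R \<in> carrier_mat (hdim (P m s)) m" "E * R = 1\<^sub>m m"
        unfolding H_epi_iff[OF projective_wf[OF pP] wf_V] by (auto simp: H_hom_def)
      then show ?thesis using mult_one_imp_le F(1) by (metis leD neq0_conv)
    qed
    \<comment> \<open>Multiplicities are additive, and the same P(m, s) has been removed from both
      modules, so the complements again have equal multiplicities.\<close>
    have "H_iso n q M' N'"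
    proof (rule less.hyps)
      show "hdim M' < hdim M" by (rule biprod_hdim_less[OF M'(2) P0])
      show "H_projective n q M'" by (rule projective_summand[OF less.prems(1) biprod_sym[OF M'(2)]])
      show "H_projective n q N'" by (rule projective_summand[OF less.prems(2) biprod_sym[OF N'(2)]])
      fix m' s' assume m': "0 < m'" "m' \<le> n"
      show "hom_dim M' (V q m' s') = hom_dim N' (V q m' s')"
        using less.prems(3)[OF m', of s'] hom_dim_biprod[OF M'(2) wf_V, of q m' s'] hom_dim_biprod[OF N'(2) wf_V, of q m' s'] by simp
    qed
    then show ?thesis by (rule H_iso_biprod[OF MM NM M'(2) N'(2)])
  qed
qed

end

section \<open>Extensions of strings, and the tensor product of V(2, r) with a string\<close>

lemma sum_single_add:
  fixes f X :: "nat \<Rightarrow> 'a::comm_ring_1"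
  shows "(\<Sum>k = 0..<N. (if u = k + w then f k else 0) * X k) = (if w \<le> u \<and> u - w < N then f (u - w) * X (u - w) else 0)"
    "(\<Sum>k = 0..<N. X k * (if u = k + w then f k else 0)) = (if w \<le> u \<and> u - w < N then X (u - w) * f (u - w) else 0)"
    "(\<Sum>k = 0..<N. (if k + w = u then f k else 0) * X k) = (if w \<le> u \<and> u - w < N then f (u - w) * X (u - w) else 0)"
    "(\<Sum>k = 0..<N. X k * (if k + w = u then f k else 0)) = (if w \<le> u \<and> u - w < N then X (u - w) * f (u - w) else 0)"
proof -
  have e: "(u = k + w) = (w \<le> u \<and> k = u - w)" "(k + w = u) = (w \<le> u \<and> k = u - w)" for k by auto
  show "(\<Sum>k = 0..<N. (if u = k + w then f k else 0) * X k) = (if w \<le> u \<and> u - w < N then f (u - w) * X (u - w) else 0)"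
    "(\<Sum>k = 0..<N. X k * (if u = k + w then f k else 0)) = (if w \<le> u \<and> u - w < N then X (u - w) * f (u - w) else 0)"
    "(\<Sum>k = 0..<N. (if k + w = u then f k else 0) * X k) = (if w \<le> u \<and> u - w < N then f (u - w) * X (u - w) else 0)"
    "(\<Sum>k = 0..<N. X k * (if k + w = u then f k else 0)) = (if w \<le> u \<and> u - w < N then X (u - w) * f (u - w) else 0)"
    unfolding e by (cases "w \<le> u"; simp add: sum_single)+
qed

lemma sum_single_Suc':
  fixes f X :: "nat \<Rightarrow> 'a::comm_ring_1"
  shows "(\<Sum>k = 0..<N. X k * (if Suc k = u then f k else 0)) = (if 0 < u \<and> u - 1 < N then X (u - 1) * f (u - 1) else 0)"
proof -
  have "(Suc k = u) = (0 < u \<and> k = u - 1)" for k by auto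
  then show ?thesis by (cases u; simp add: sum_single)
qed

context root_of_unity
begin

text \<open>Both sides satisfy the recurrence \<open>beta_Suc\<close>, and the hypothesis makes them
  agree at j = 0. So a string that restarts at a zero of \<open>beta\<close> is a string again, with
  both weights raised by i.\<close>

lemma beta_shift:
  assumes "beta q z i = 0"
  shows "beta q z (j + i) = beta q (z + 2 * int i) j"
proof (induction j)
  case (Suc j)
  have "beta q z (Suc j + i) = q * beta q z (j + i) + (1 - q powi (z + 2 * int (j + i)))"
    using beta_Suc[of z "j + i"] by simp
  also have "\<dots> = beta q (z + 2 * int i) (Suc j)"
    unfolding Suc beta_Suc by (simp add: algebra_simps)
  finally show ?case .
qed (use assms in simp)

lemma string_acts:
  "act (string_mod q t x y) GA = mat t t (\<lambda>(i, j). if i = Suc j then 1 else 0)"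
  "act (string_mod q t x y) GB = mat t t (\<lambda>(i, j). if i = j then q powi (x + int j) else 0)"
  "act (string_mod q t x y) GC = mat t t (\<lambda>(i, j). if i = j then q powi (y + int j) else 0)"
  "act (string_mod q t x y) GD = mat t t (\<lambda>(i, j). if j = Suc i then beta q (x + y) j else 0)"
  by (simp_all add: string_mod_def)

text \<open>The last t - i basis vectors span a subspace closed under d precisely because the
  coefficient of d vanishes at index i; the quotient is the string of the first i vectors.\<close>

lemma ses_string:
  assumes i: "i \<le> t" and b: "beta q (x + y) i = 0"
  shows "ses (string_mod q (t - i) (x + int i) (y + int i)) (string_mod q t x y) (string_mod q i x y)"
proof -
  define F :: "'k mat" where "F = mat t (t - i) (\<lambda>(r, c). if r = c + i then 1 else 0)"
  define p :: "'k mat" where "p = mat i t (\<lambda>(r, c). if r = c then 1 else 0)"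
  define R :: "'k mat" where "R = mat (t - i) t (\<lambda>(r, c). if r + i = c then 1 else 0)"
  define s :: "'k mat" where "s = mat t i (\<lambda>(r, c). if r = c then 1 else 0)"
  let ?A = "string_mod q (t - i) (x + int i) (y + int i)" and ?X = "string_mod q t x y" and ?B = "string_mod q i x y"
  note sp = scalar_prod_def sum_singles sum_single_add sum_single_Suc'
  have bs: "beta q (x + int i + (y + int i)) j = beta q (x + y) (j + i)" for j
    using beta_shift[OF b, of j] by (simp add: algebra_simps)
  have "\<forall>g. F * act ?A g = act ?X g * F"
    unfolding all_gen string_acts F_def bs
    by (intro conjI; rule eq_matI; use b i in \<open>auto simp: sp algebra_simps\<close>)
  then have hF: "F \<in> H_hom ?A ?X" by (auto simp: H_hom_iff F_def)
  have edge: "beta q (x + y) (Suc j) = 0" if "j < i" "\<not> Suc j < i" for j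
    using b that by (metis Suc_lessI)
  have "\<forall>g. p * act ?X g = act ?B g * p"
    unfolding all_gen string_acts p_def
    by (intro conjI; rule eq_matI; use i in \<open>auto simp: sp edge\<close>)
  then have hp: "p \<in> H_hom ?X ?B" by (auto simp: H_hom_iff p_def)
  have 1: "R * F = 1\<^sub>m (t - i)" "p * s = 1\<^sub>m i" "p * F = 0\<^sub>m i (t - i)" "F * R + s * p = 1\<^sub>m t"
    unfolding R_def F_def p_def s_def by (rule eq_matI; use i in \<open>auto simp: sp\<close>)+
  show ?thesis
    unfolding ses_def using hF hp 1 by (intro conjI wf_string bexI[OF _ hF] bexI[OF _ hp] bexI[of _ R] bexI[of _ s])
      (auto simp: R_def s_def)
qed

text \<open>Unit columns and rows of k^2. \<open>kron\<close> with them inserts and extracts blocks,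
  so that maps on V(2, r) tensor X can be computed by algebraic rules instead of indices.\<close>

definition E1 :: "'k mat" where "E1 = mat 2 1 (\<lambda>(i, j). if i = 0 then 1 else 0)"
definition E2 :: "'k mat" where "E2 = mat 2 1 (\<lambda>(i, j). if i = 1 then 1 else 0)"
definition F1 :: "'k mat" where "F1 = mat 1 2 (\<lambda>(i, j). if j = 0 then 1 else 0)"
definition F2 :: "'k mat" where "F2 = mat 1 2 (\<lambda>(i, j). if j = 1 then 1 else 0)"

lemma E_dims [simp]: "dim_row E1 = 2" "dim_col E1 = 1" "dim_row E2 = 2" "dim_col E2 = 1"
  "dim_row F1 = 1" "dim_col F1 = 2" "dim_row F2 = 1" "dim_col F2 = 2"
  by (simp_all add: E1_def E2_def F1_def F2_def)

lemma E_algebra: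
  "F1 * E1 = 1\<^sub>m 1" "F2 * E2 = 1\<^sub>m 1" "F1 * E2 = 0\<^sub>m 1 1" "F2 * E1 = 0\<^sub>m 1 1" "E1 * F1 + E2 * F2 = 1\<^sub>m 2"
  by (rule eq_matI; auto simp: E1_def E2_def F1_def F2_def scalar_prod_def sum_singles)+

lemma V2_acts:
  "act (V q 2 r) GA * E1 = E2" "act (V q 2 r) GA * E2 = 0\<^sub>m 2 1"
  "act (V q 2 r) GB * E1 = q powi r \<cdot>\<^sub>m E1" "act (V q 2 r) GB * E2 = q powi (r + 1) \<cdot>\<^sub>m E2"
  "act (V q 2 r) GC * E1 = q powi (- 1 - r) \<cdot>\<^sub>m E1" "act (V q 2 r) GC * E2 = q powi (- r) \<cdot>\<^sub>m E2"
  "act (V q 2 r) GD * E1 = 0\<^sub>m 2 1" "act (V q 2 r) GD * E2 = (1 - inverse q) \<cdot>\<^sub>m E1"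
  "F1 * act (V q 2 r) GA = 0\<^sub>m 1 2" "F2 * act (V q 2 r) GA = F1"
  "F1 * act (V q 2 r) GB = q powi r \<cdot>\<^sub>m F1" "F2 * act (V q 2 r) GB = q powi (r + 1) \<cdot>\<^sub>m F2"
  "F1 * act (V q 2 r) GC = q powi (- 1 - r) \<cdot>\<^sub>m F1" "F2 * act (V q 2 r) GC = q powi (- r) \<cdot>\<^sub>m F2"
  "F1 * act (V q 2 r) GD = (1 - inverse q) \<cdot>\<^sub>m F2" "F2 * act (V q 2 r) GD = 0\<^sub>m 1 2"
proof -
  have b1: "beta q (r + (1 - r - int 2)) (Suc 0) = 1 - inverse q"
    by (simp add: beta_def qint_def power_int_minus)
  show
  "act (V q 2 r) GA * E1 = E2" "act (V q 2 r) GA * E2 = 0\<^sub>m 2 1"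
  "act (V q 2 r) GB * E1 = q powi r \<cdot>\<^sub>m E1" "act (V q 2 r) GB * E2 = q powi (r + 1) \<cdot>\<^sub>m E2"
  "act (V q 2 r) GC * E1 = q powi (- 1 - r) \<cdot>\<^sub>m E1" "act (V q 2 r) GC * E2 = q powi (- r) \<cdot>\<^sub>m E2"
  "act (V q 2 r) GD * E1 = 0\<^sub>m 2 1" "act (V q 2 r) GD * E2 = (1 - inverse q) \<cdot>\<^sub>m E1"
  "F1 * act (V q 2 r) GA = 0\<^sub>m 1 2" "F2 * act (V q 2 r) GA = F1"
  "F1 * act (V q 2 r) GB = q powi r \<cdot>\<^sub>m F1" "F2 * act (V q 2 r) GB = q powi (r + 1) \<cdot>\<^sub>m F2"
  "F1 * act (V q 2 r) GC = q powi (- 1 - r) \<cdot>\<^sub>m F1" "F2 * act (V q 2 r) GC = q powi (- r) \<cdot>\<^sub>m F2"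
  "F1 * act (V q 2 r) GD = (1 - inverse q) \<cdot>\<^sub>m F2" "F2 * act (V q 2 r) GD = 0\<^sub>m 1 2"
    unfolding V_string string_acts E1_def E2_def F1_def F2_def
    by (rule eq_matI; use b1 in \<open>auto simp: scalar_prod_def sum_singles less_2_cases_iff algebra_simps\<close>)+
qed

lemma V2_square: "act_a (V q 2 r) * act_a (V q 2 r) = 0\<^sub>m (hdim (V q 2 r)) (hdim (V q 2 r))"
  "act_d (V q 2 r) * act_d (V q 2 r) = 0\<^sub>m (hdim (V q 2 r)) (hdim (V q 2 r))"
  unfolding V_string string_mod_def by (rule eq_matI; auto simp: scalar_prod_def sum_singles)+

lemma V2_tensor_module: "H_module n q X \<Longrightarrow> H_module n q (H_tensor (V q 2 r) X)"
  using n2 by (intro tensor_module[OF prim _ V_module _ V2_square]) simp_all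

text \<open>The submodule is generated by the tensor product of the first basis vectors.  For t = n its
  string breaks off one step early because (n)_q = 0.\<close>

lemma ses_V2_string:
  assumes t: "0 < t" and b: "beta q (x + y) t = 0"
    and c: "t < n \<and> t'' = Suc t \<and> t' = t - 1 \<and> beta q (x + y + 1) (t - 1) = 0 \<or> t = n \<and> t'' = n \<and> t' = n"
  shows "ses (string_mod q t'' (r + x) (y - 1 - r)) (H_tensor (V q 2 r) (string_mod q t x y))
    (string_mod q t' (r + 1 + x) (y - r))"
proof -
  let ?A = "string_mod q t'' (r + x) (y - 1 - r)" and ?S = "string_mod q t x y"
    and ?B = "string_mod q t' (r + 1 + x) (y - r)"
  let ?X = "H_tensor (V q 2 r) ?S"
  \<comment> \<open>Let e1, e2 be the basis of V(2, r) and v_0, v_1, ... that of the string. Since a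
    acts by a (x) b + 1 (x) a, induction gives a^k (e1 (x) v_0) = e1 (x) v_k + \<gamma>_k e2 (x)
    v_(k-1) with \<gamma>_(k+1) = \<gamma>_k + q^(x+k).\<close>
  define \<gamma> where "\<gamma> k = q powi x * qint q k" for k
  have \<gamma>0: "\<gamma> 0 = 0" by (simp add: \<gamma>_def)
  have \<gamma>S: "\<gamma> (Suc k) = \<gamma> k + q powi (x + int k)" for k
  proof -
    have "qint q (Suc k) = qint q k + q ^ k" by (simp add: qint_def)
    then show ?thesis by (simp add: \<gamma>_def q_powi_add algebra_simps)
  qed
  have \<gamma>n: "\<gamma> n = 0" using qint_eq_0_iff[of n] by (simp add: \<gamma>_def)
  have \<gamma>t: "t < n \<Longrightarrow> \<gamma> t \<noteq> 0" using qint_eq_0_iff[of t] q0 t by (auto simp: \<gamma>_def dest: dvd_imp_le)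
  let ?\<alpha> = "1 - inverse q"
  have eq1: "q powi (z + int k) * inverse q = q powi (z + int k - 1)" for z k
    using q_powi_Suc[of "z + int k - 1"] q0 by (simp add: mult.commute)
  \<comment> \<open>The subobject and the quotient have weight exponents adding up to x + y - 1 and
    x + y + 1. \<open>b1\<close> and \<open>b2\<close> compare their coefficients of d with those of
    the given string; the difference comes from d (x) c, where \<open>?\<alpha>\<close> is the
    coefficient of d on e2.\<close>
  have b1: "beta q (x + y - 1) k = beta q (x + y) k + ?\<alpha> * (q powi (y + int k - 1) * \<gamma> k)" for k
  proof -
    have "q powi (y + int k - 1) * q powi x = q powi (x + y + int k - 1)" by (simp add: q_powi_add[symmetric] algebra_simps)
    moreover have "q powi (x + y + int k - 1) * inverse q = q powi (x + y - 1 + int k - 1)"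
      using q_powi_Suc[of "x + y - 1 + int k - 1"] q0 by (simp add: mult.commute algebra_simps)
    ultimately show ?thesis unfolding beta_def \<gamma>_def by (simp add: algebra_simps)
  qed
  have b2: "beta q (x + y + 1) k = beta q (x + y) k - ?\<alpha> * (\<gamma> k * q powi (y + int k))" for k
  proof -
    have "q powi x * q powi (y + int k) = q powi (x + y + int k)" by (simp add: q_powi_add[symmetric] algebra_simps)
    moreover have "q powi (x + y + int k) * inverse q = q powi (x + y + int k - 1)" by (rule eq1)
    ultimately show ?thesis unfolding beta_def \<gamma>_def by (simp add: algebra_simps)
  qed
  have b3: "beta q z (Suc k) * \<gamma> (Suc (Suc k)) = \<gamma> (Suc k) * beta q (z - 1) (Suc (Suc k))" for z k
    unfolding beta_def \<gamma>_def by (simp add: algebra_simps)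
  have b4: "\<gamma> (Suc k) * beta q z (Suc (Suc k)) = beta q (z + 1) (Suc k) * \<gamma> (Suc (Suc k))" for z k
    unfolding beta_def \<gamma>_def by (simp add: algebra_simps)
  have b2': "beta q (x + y) (Suc k) - ?\<alpha> * (\<gamma> (Suc k) * q powi (y + (1 + int k))) = beta q (x + y + 1) (Suc k)" for k
    using b2[of "Suc k"] by simp
  have edge: "beta q (x + y) (Suc j) = 0" if "j < t" "\<not> Suc j < t" for j
    using b that by (metis Suc_lessI)
  have edge': "beta q (x + y + 1) (Suc j) = 0" if "t < n" "j < t - Suc 0" "\<not> Suc j < t - Suc 0" for j
  proof -
    have j: "Suc j = t - 1" using that by simp
    show ?thesis unfolding j using c that(1) by auto
  qed
  have edge'': "beta q (x + y) (Suc j) = ?\<alpha> * (\<gamma> (Suc j) * q powi (y + (1 + int j)))"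
    if "t < n" "j < t - Suc 0" "\<not> Suc j < t - Suc 0" for j
    using edge'[OF that] b2'[of j] by simp
  have edge\<gamma>: "q powi (x + int j) + \<gamma> j = 0" "\<gamma> j + q powi (x + int j) = 0" if "j < n" "\<not> Suc j < n" for j
  proof -
    have "Suc j = n" using that by simp
    then show "\<gamma> j + q powi (x + int j) = 0" using \<gamma>n \<gamma>S[of j] by simp
    then show "q powi (x + int j) + \<gamma> j = 0" by (simp add: add.commute)
  qed
  \<comment> \<open>\<open>I\<close> and \<open>G\<close> are the components of the inclusion, whose
    column j is e1 (x) v_j + \<gamma>_j e2 (x) v_(j-1). The projection has components
    \<open>J\<close> and minus \<open>H\<close>: it sends e2 (x) v_j to w_j and e1 (x) v_j to -
    \<gamma>_j w_(j-1), where w_j = 0 for j not below \<open>t'\<close>.\<close>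
  define I where "I = mat t t'' (\<lambda>(i, j). if i = j then 1 else 0 :: 'k)"
  define G where "G = mat t t'' (\<lambda>(i, j). if j = Suc i then \<gamma> j else 0)"
  define J where "J = mat t' t (\<lambda>(i, j). if i = j then 1 else 0 :: 'k)"
  define H where "H = mat t' t (\<lambda>(i, j). if j = Suc i then \<gamma> j else 0)"
  define I' where "I' = mat t'' t (\<lambda>(i, j). if i = j then 1 else 0 :: 'k)"
  \<comment> \<open>For t < n the last vector of the submodule is \<gamma>_t e2 (x) v_(t-1), because
    there is no v_t; the left inverse recovers it by dividing by \<gamma>_t. For t = n no row has
    index \<open>t\<close>, and \<open>K\<close> is zero.\<close>
  define K where "K = mat t'' t (\<lambda>(i, j). if i = Suc j \<and> i = t then inverse (\<gamma> t) else 0)"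
  define J' where "J' = mat t t' (\<lambda>(i, j). if i = j then 1 else 0 :: 'k)"
  have d: "dim_row I = t" "dim_col I = t''" "dim_row G = t" "dim_col G = t''" "dim_row J = t'" "dim_col J = t"
    "dim_row H = t'" "dim_col H = t" "dim_row I' = t''" "dim_col I' = t" "dim_row K = t''" "dim_col K = t"
    "dim_row J' = t" "dim_col J' = t'"
    by (simp_all add: I_def G_def J_def H_def I'_def K_def J'_def)
  note sp = scalar_prod_def sum_singles sum_single_Suc'
  have ez: "r + x + (y - 1 - r) = x + y - 1" "r + 1 + x + (y - r) = x + y + 1" by simp_all
  have 1: "act ?S GA * I = I * act ?A GA" "act ?S GB * I + act ?S GA * G = G * act ?A GA"
    unfolding string_acts I_def G_def
    by (rule eq_matI; use c n2 \<gamma>0 \<gamma>S in \<open>auto simp: sp edge\<gamma>\<close>)+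
  have 2: "q powi r \<cdot>\<^sub>m (act ?S GB * I) = I * act ?A GB" "q powi (r + 1) \<cdot>\<^sub>m (act ?S GB * G) = G * act ?A GB"
    "q powi (- 1 - r) \<cdot>\<^sub>m (act ?S GC * I) = I * act ?A GC" "q powi (- r) \<cdot>\<^sub>m (act ?S GC * G) = G * act ?A GC"
    unfolding string_acts I_def G_def
    by (rule eq_matI; use c in \<open>auto simp: sp q_powi_add[symmetric] algebra_simps\<close>)+
  have 3: "act ?S GD * I + ?\<alpha> \<cdot>\<^sub>m (act ?S GC * G) = I * act ?A GD" "act ?S GD * G = G * act ?A GD"
    unfolding string_acts I_def G_def ez
    by (rule eq_matI; use c in \<open>auto simp: sp b1 b3 edge\<close>)+
  have 4: "J * act ?S GA = act ?B GA * J" "J * act ?S GB + act ?B GA * H = H * act ?S GA"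
    unfolding string_acts J_def H_def
    by (rule eq_matI; use c n2 \<gamma>0 \<gamma>S in \<open>auto simp: sp edge\<gamma>\<close>)+
  have 5: "q powi (r + 1) \<cdot>\<^sub>m (J * act ?S GB) = act ?B GB * J" "q powi r \<cdot>\<^sub>m (H * act ?S GB) = act ?B GB * H"
    "q powi (- r) \<cdot>\<^sub>m (J * act ?S GC) = act ?B GC * J" "q powi (- 1 - r) \<cdot>\<^sub>m (H * act ?S GC) = act ?B GC * H"
    unfolding string_acts J_def H_def
    by (rule eq_matI; use c in \<open>auto simp: sp q_powi_add[symmetric] algebra_simps\<close>)+
  have 6: "J * act ?S GD - ?\<alpha> \<cdot>\<^sub>m (H * act ?S GC) = act ?B GD * J" "H * act ?S GD = act ?B GD * H"
    unfolding string_acts J_def H_def ez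
    by (rule eq_matI; use c in \<open>auto simp: sp b2' b4 edge' edge''\<close>)+
  let ?i = "kron E1 I + kron E2 G" and ?p = "kron F2 J - kron F1 H"
  let ?R = "kron F1 I' + kron F2 K" and ?s = "kron E2 J'"
  have w: "wf_hmod ?X" by (intro wf_tensor wf_V wf_string)
  have dS: "dim_row (act (string_mod q k z z') g) = k" "dim_col (act (string_mod q k z z') g) = k"
    and dV: "dim_row (act (V q k z) g) = k" "dim_col (act (V q k z) g) = k" for k z z' g
    using wf_hmodD[OF wf_string, of q k z z' g] wf_hmodD[OF wf_V, of q k z g] by simp_all
  have 7: "I' * I + K * G = 1\<^sub>m t''" "J * J' = 1\<^sub>m t'" "I * I' = 1\<^sub>m t" "I * K = 0\<^sub>m t t" "G * I' = J' * H"
    "G * K + J' * J = 1\<^sub>m t"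
    unfolding I_def G_def J_def H_def I'_def K_def J'_def
    by (rule eq_matI; use c \<gamma>t t in \<open>auto simp: sp\<close>)+
  have 8: "J * G - H * I = 0\<^sub>m t' t''"
    unfolding I_def G_def J_def H_def
    by (rule eq_matI; use c in \<open>auto simp: sp\<close>)
  have 9: "act ?B GA * H = H * act ?S GA - J * act ?S GB"
  proof -
    have "Y = Z - W" if "W + Y = Z" "dim_row W = dim_row Y" "dim_col W = dim_col Y" for W Y Z :: "'k mat"
      unfolding that(1)[symmetric] using that(2,3) by (intro eq_matI) auto
    from this[OF 4(2)] show ?thesis using d dS by (simp del: act.simps)
  qed
  have kr: "kron A Z * X = kron A (Z * X)" if "dim_col A = 1" "dim_col Z = dim_row X" for A Z X :: "'k mat"
    using that kron_mult[of A "1\<^sub>m 1" Z X] by (simp only: kron_one_left mone(1)[of A 1] index_one_mat)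
  have kl: "X * kron A Z = kron A (X * Z)" if "dim_row A = 1" "dim_col X = dim_row Z" for A Z X :: "'k mat"
    using that kron_mult[of "1\<^sub>m 1" A X Z] by (simp only: kron_one_left mone(2)[of A 1] index_one_mat)
  note alg = mdist_left mdist_right kron_mult kr kl V2_acts mone kron_smult kron_zero E_algebra kron_add madd0
  have ci: "?i * act ?A GA = act ?X GA * ?i" "?i * act ?A GB = act ?X GB * ?i"
    "?i * act ?A GC = act ?X GC * ?i" "?i * act ?A GD = act ?X GD * ?i"
    subgoal unfolding act_tensor hdim_V using d dS dV
      by (simp add: alg 1[symmetric] 2[symmetric] 3[symmetric] del: act.simps) (intro eq_matI; simp add: algebra_simps del: act.simps index_kron)?
    subgoal unfolding act_tensor hdim_V using d dS dV
      by (simp add: alg 1[symmetric] 2[symmetric] 3[symmetric] del: act.simps) (intro eq_matI; simp add: algebra_simps del: act.simps index_kron)?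
    subgoal unfolding act_tensor hdim_V using d dS dV
      by (simp add: alg 1[symmetric] 2[symmetric] 3[symmetric] del: act.simps) (intro eq_matI; simp add: algebra_simps del: act.simps index_kron)?
    subgoal unfolding act_tensor hdim_V using d dS dV
      by (simp add: alg 1[symmetric] 2[symmetric] 3[symmetric] del: act.simps) (intro eq_matI; simp add: algebra_simps del: act.simps index_kron)?
    done
  then have "\<forall>g. ?i * act ?A g = act ?X g * ?i" unfolding all_gen by blast
  then have hi: "?i \<in> H_hom ?A ?X" using d by (intro H_homI) simp_all
  have cp: "?p * act ?X GA = act ?B GA * ?p" "?p * act ?X GB = act ?B GB * ?p"
    "?p * act ?X GC = act ?B GC * ?p" "?p * act ?X GD = act ?B GD * ?p"
    subgoal unfolding act_tensor hdim_V using d dS dV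
      by (simp add: alg 4(1)[symmetric] 9 5[symmetric] 6[symmetric] del: act.simps) (intro eq_matI; simp add: algebra_simps del: act.simps index_kron)?
    subgoal unfolding act_tensor hdim_V using d dS dV
      by (simp add: alg 4(1)[symmetric] 9 5[symmetric] 6[symmetric] del: act.simps) (intro eq_matI; simp add: algebra_simps del: act.simps index_kron)?
    subgoal unfolding act_tensor hdim_V using d dS dV
      by (simp add: alg 4(1)[symmetric] 9 5[symmetric] 6[symmetric] del: act.simps) (intro eq_matI; simp add: algebra_simps del: act.simps index_kron)?
    subgoal unfolding act_tensor hdim_V using d dS dV
      by (simp add: alg 4(1)[symmetric] 9 5[symmetric] 6[symmetric] del: act.simps) (intro eq_matI; simp add: algebra_simps del: act.simps index_kron)?
    done
  then have "\<forall>g. ?p * act ?X g = act ?B g * ?p" unfolding all_gen by blast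
  then have hp: "?p \<in> H_hom ?X ?B" using d by (intro H_homI) simp_all
  have "?R * ?i = kron (1\<^sub>m 1) (I' * I + K * G)"
    using d by (simp add: alg) (intro eq_matI; simp del: index_kron)?
  then have Ri: "?R * ?i = 1\<^sub>m t''" unfolding 7 kron_one_left .
  have "?p * ?s = kron (1\<^sub>m 1) (J * J')" using d by (simp add: alg) (intro eq_matI; simp del: index_kron)?
  then have ps: "?p * ?s = 1\<^sub>m t'" unfolding 7 kron_one_left .
  have "?p * ?i = kron (1\<^sub>m 1) (J * G - H * I)" using d by (simp add: alg) (intro eq_matI; simp del: index_kron)?
  then have pi: "?p * ?i = 0\<^sub>m t' t''" unfolding 8 kron_one_left .
  have "?i * ?R + ?s * ?p = kron (E1 * F1) (1\<^sub>m t) + kron (E2 * F2) (G * K + J' * J)"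
    using d by (simp add: alg(1-5) kron_zero madd0 7(3-5))
      (intro eq_matI; simp add: algebra_simps kron_add del: index_kron)
  also have "\<dots> = kron (E1 * F1 + E2 * F2) (1\<^sub>m t)" unfolding 7 by (simp add: kron_add)
  also have "\<dots> = 1\<^sub>m (2 * t)" by (simp add: E_algebra kron_one)
  finally have iR: "?i * ?R + ?s * ?p = 1\<^sub>m (2 * t)" .
  show ?thesis
    unfolding ses_def using hi hp Ri ps pi iR d
    by (intro conjI wf_string w bexI[OF _ hi] bexI[OF _ hp] bexI[of _ ?R] bexI[of _ ?s]) auto
qed

end

section \<open>Tensoring projective modules with V(1, r) and V(2, 0)\<close>

context root_of_unity
begin

lemma V1_acts:
  "act (V q 1 r) GA = 0\<^sub>m 1 1" "act (V q 1 r) GB = q powi r \<cdot>\<^sub>m 1\<^sub>m 1"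
  "act (V q 1 r) GC = q powi (- r) \<cdot>\<^sub>m 1\<^sub>m 1" "act (V q 1 r) GD = 0\<^sub>m 1 1"
  unfolding V_string string_acts by (rule eq_matI; auto)+

lemma V1_tensor_acts:
  assumes w: "wf_hmod X"
  shows "act (H_tensor (V q 1 r) X) GA = act X GA" "act (H_tensor (V q 1 r) X) GB = q powi r \<cdot>\<^sub>m act X GB"
    "act (H_tensor (V q 1 r) X) GC = q powi (- r) \<cdot>\<^sub>m act X GC" "act (H_tensor (V q 1 r) X) GD = act X GD"
  unfolding act_tensor hdim_V V1_acts kron_smult kron_zero kron_one_left
  using w by (simp_all add: madd0 del: act.simps)

lemma V1_0_tensor: "wf_hmod X \<Longrightarrow> H_tensor (V q 1 0) X = X"
proof (rule hmod_eqI)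
  fix g assume w: "wf_hmod X"
  have "1 \<cdot>\<^sub>m M = M" for M :: "'k mat" by (auto intro!: eq_matI)
  then have "\<forall>g. act (H_tensor (V q 1 0) X) g = act X g"
    unfolding all_gen V1_tensor_acts[OF w] by simp
  then show "act (H_tensor (V q 1 0) X) g = act X g" by blast
qed simp

lemma V1_tensor_V: "H_tensor (V q 1 r) (V q m s) = V q m (s + r)"
proof (rule hmod_eqI)
  fix g
  have "\<forall>g. act (H_tensor (V q 1 r) (V q m s)) g = act (V q m (s + r)) g"
    unfolding all_gen V1_tensor_acts[OF wf_V] unfolding V_string string_acts
    by (intro conjI; rule eq_matI; auto simp: q_powi_add[symmetric] algebra_simps)
  then show "act (H_tensor (V q 1 r) (V q m s)) g = act (V q m (s + r)) g" by blast
qed simp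

lemma V1_dual: "dual_pair (V q 1 0) (V q 1 r) (V q 1 (- r)) (1\<^sub>m 1) (1\<^sub>m 1)"
proof
  show "H_tensor (V q 1 0) M = M" if "wf_hmod M" for M by (rule V1_0_tensor[OF that])
  show "1\<^sub>m 1 \<in> H_hom (H_tensor (V q 1 r) (V q 1 (- r))) (V q 1 0)"
    "1\<^sub>m 1 \<in> H_hom (V q 1 0) (H_tensor (V q 1 (- r)) (V q 1 r))"
    unfolding V1_tensor_V using H_hom_one[OF wf_V, of q 1 0] by simp_all
qed (simp_all add: wf_V kron_one del: One_nat_def)

lemma V1_tensor_module: "H_module n q X \<Longrightarrow> H_module n q (H_tensor (V q 1 r) X)"
proof -
  assume X: "H_module n q X"
  have "act (V q 1 r) GA * act (V q 1 r) GA = 0\<^sub>m 1 1" "act (V q 1 r) GD * act (V q 1 r) GD = 0\<^sub>m 1 1"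
    unfolding V1_acts by (rule eq_matI; auto simp: scalar_prod_def)+
  then show ?thesis using n2 by (intro tensor_module[OF prim _ V_module X]) simp_all
qed

text \<open>The vectors of trivial weight are spanned by e1 (x) e2 and e2 (x) e1. The ratio in the
  evaluation is forced by vanishing on a (e1 (x) e1), where b acts on e1 of V(2, -1) by 1/q; the
  ratio in the coevaluation by being killed by a, where b acts on e2 of V(2, 0) by q. The snake
  identities fix the common scale.\<close>

lemma V2_dual: "dual_pair (V q 1 0) (V q 2 0) (V q 2 (- 1))
    (kron F2 F1 - inverse q \<cdot>\<^sub>m kron F1 F2) (kron E1 E2 - q \<cdot>\<^sub>m kron E2 E1)"
    (is "dual_pair _ ?V ?W ?ev ?co")
proof
  show "H_tensor (V q 1 0) M = M" if "wf_hmod M" for M by (rule V1_0_tensor[OF that])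
  have dV: "dim_row (act (V q k z) g) = k" "dim_col (act (V q k z) g) = k" for k z g
    using wf_hmodD[OF wf_V, of q k z g] by simp_all
  have kl: "1\<^sub>m 1 * X = X" "X * 1\<^sub>m 1 = X" if "dim_row X = 1" "dim_col X = 1" for X :: "'k mat"
    using that by (simp_all add: mone)
  have T: "act (V q 1 0) GA * X = 0\<^sub>m 1 (dim_col X)" "act (V q 1 0) GB * X = X" "act (V q 1 0) GC * X = X"
    "act (V q 1 0) GD * X = 0\<^sub>m 1 (dim_col X)" if "dim_row X = 1" for X :: "'k mat"
    unfolding V1_acts using that by (auto simp: mzero msmult mone intro!: eq_matI)
  have T': "X * act (V q 1 0) GA = 0\<^sub>m (dim_row X) 1" "X * act (V q 1 0) GB = X" "X * act (V q 1 0) GC = X"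
    "X * act (V q 1 0) GD = 0\<^sub>m (dim_row X) 1" if "dim_col X = 1" for X :: "'k mat"
    unfolding V1_acts using that by (auto simp: mzero msmult mone intro!: eq_matI)
  note alg = mdist_left mdist_right kron_mult V2_acts mone kron_smult kron_zero E_algebra madd0 msmult
  have e: "q powi - 1 = inverse q" by (simp add: power_int_minus)
  have qi: "q * (inverse q * x) = x" "inverse q * (q * x) = x" for x
    using q0 by (simp_all add: mult.assoc[symmetric])
  have "\<forall>g. ?ev * act (H_tensor ?V ?W) g = act (V q 1 0) g * ?ev"
    unfolding all_gen act_tensor hdim_V
    apply (intro conjI)
    subgoal by (simp add: alg dV T e q0 del: act.simps One_nat_def) (intro eq_matI; simp add: algebra_simps q0 qi del: index_kron)?
    subgoal by (simp add: alg dV T e q0 del: act.simps One_nat_def) (intro eq_matI; simp add: algebra_simps q0 qi del: index_kron)?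
    subgoal by (simp add: alg dV T e q0 del: act.simps One_nat_def) (intro eq_matI; simp add: algebra_simps q0 qi del: index_kron)?
    subgoal by (simp add: alg dV T e q0 del: act.simps One_nat_def) (intro eq_matI; simp add: algebra_simps q0 qi del: index_kron)?
    done
  then show "?ev \<in> H_hom (H_tensor ?V ?W) (V q 1 0)" by (intro H_homI) simp_all
  have "\<forall>g. ?co * act (V q 1 0) g = act (H_tensor ?W ?V) g * ?co"
    unfolding all_gen act_tensor hdim_V
    apply (intro conjI)
    subgoal by (simp add: alg dV T' e q0 del: act.simps One_nat_def) (intro eq_matI; simp add: algebra_simps q0 qi del: index_kron)?
    subgoal by (simp add: alg dV T' e q0 del: act.simps One_nat_def) (intro eq_matI; simp add: algebra_simps q0 qi del: index_kron)?
    subgoal by (simp add: alg dV T' e q0 del: act.simps One_nat_def) (intro eq_matI; simp add: algebra_simps q0 qi del: index_kron)?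
    subgoal by (simp add: alg dV T' e q0 del: act.simps One_nat_def) (intro eq_matI; simp add: algebra_simps q0 qi del: index_kron)?
    done
  then show "?co \<in> H_hom (V q 1 0) (H_tensor ?W ?V)" by (intro H_homI) simp_all
  have one: "kron F1 E1 + kron F2 E2 = 1\<^sub>m 2" "kron E1 F1 + kron E2 F2 = 1\<^sub>m 2"
    by (rule eq_matI; auto simp: E1_def E2_def F1_def F2_def less_2_cases_iff)+
  note alg' = mdist_left mdist_right kron_mult mone kron_smult kron_zero E_algebra madd0 msmult kron_add kron_assoc
    kron_one_left
  have "kron ?ev (1\<^sub>m 2) * kron (1\<^sub>m 2) ?co = kron F1 E1 + kron F2 E2"
    by (simp add: alg' del: One_nat_def) (intro eq_matI; simp add: algebra_simps q0 qi del: index_kron)?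
  then show "kron ?ev (1\<^sub>m (hdim ?V)) * kron (1\<^sub>m (hdim ?V)) ?co = 1\<^sub>m (hdim ?V)" by (simp add: one)
  have "kron (1\<^sub>m 2) ?ev * kron ?co (1\<^sub>m 2) = kron E1 F1 + kron E2 F2"
    by (simp add: alg' del: One_nat_def) (intro eq_matI; simp add: algebra_simps q0 qi del: index_kron)?
  then show "kron (1\<^sub>m (hdim ?W)) ?ev * kron ?co (1\<^sub>m (hdim ?W)) = 1\<^sub>m (hdim ?W)" by (simp add: one)
qed (simp_all add: wf_V)

text \<open>The adjunction moves V(2, 0) to the other side as V(2, -1), and V(2, -1) tensor V(m, s)
  is an extension of V(m - 1, s) by V(m + 1, s - 1). For m = 1 the quotient is V(0, s), of dimension
  zero.\<close>

lemma hom_dim_V2_tensor_less: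
  assumes M: "H_projective n q M" and m: "0 < m" "m < n"
  shows "hom_dim (H_tensor (V q 2 0) M) (V q m s) = hom_dim M (V q (Suc m) (s - 1)) + hom_dim M (V q (m - 1) s)"
proof -
  interpret dual_pair "V q 1 0" "V q 2 0" "V q 2 (- 1)" "kron F2 F1 - inverse q \<cdot>\<^sub>m kron F1 F2"
    "kron E1 E2 - q \<cdot>\<^sub>m kron E2 E1" by (rule V2_dual)
  have b: "beta q (s + (1 - s - int m)) m = 0" by (simp add: beta_eq_0_iff)
  have b': "beta q (s + (1 - s - int m) + 1) (m - 1) = 0" using m by (simp add: beta_eq_0_iff of_nat_diff)
  have A: "string_mod q (Suc m) (- 1 + s) (1 - s - int m - 1 - (- 1)) = V q (Suc m) (s - 1)"
    unfolding V_string by (simp add: algebra_simps)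
  have B: "string_mod q (m - 1) (- 1 + 1 + s) (1 - s - int m - (- 1)) = V q (m - 1) s"
    unfolding V_string using m by (simp add: of_nat_diff algebra_simps)
  have "ses (V q (Suc m) (s - 1)) (H_tensor (V q 2 (- 1)) (V q m s)) (V q (m - 1) s)"
    using ses_V2_string[OF m(1) b, of "Suc m" "m - 1" "- 1"] b' m unfolding A B V_string[of q m s, symmetric] by simp
  from hom_dim_ses[OF M this V2_tensor_module[OF V_module] V_module] m
  show ?thesis unfolding hom_dim_adj[OF projective_wf[OF M] wf_V] by simp
qed

text \<open>Here V(2, -1) tensor V(n, s) is an extension of two Verma modules, each with composition
  factors V(n - 1, s) and V(1, s - 1), in opposite orders. This is where the factor 2 comes
  from.\<close>

lemma hom_dim_V2_tensor_n:
  assumes M: "H_projective n q M"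
  shows "hom_dim (H_tensor (V q 2 0) M) (V q n s) = 2 * hom_dim M (V q (n - 1) s) + 2 * hom_dim M (V q 1 (s - 1))"
proof -
  interpret dual_pair "V q 1 0" "V q 2 0" "V q 2 (- 1)" "kron F2 F1 - inverse q \<cdot>\<^sub>m kron F1 F2"
    "kron E1 E2 - q \<cdot>\<^sub>m kron E2 E1" by (rule V2_dual)
  let ?A = "string_mod q n (s - 1) (1 - s - int n)" and ?B = "string_mod q n s (2 - s - int n)"
  have n0: "0 < n" using n2 by simp
  have Am: "H_module n q ?A" and Bm: "H_module n q ?B" by (rule string_module; simp)+
  have b: "beta q (s + (1 - s - int n)) n = 0" by simp
  have "ses ?A (H_tensor (V q 2 (- 1)) (V q n s)) ?B"
    using ses_V2_string[OF n0 b, of n n "- 1"] unfolding V_string[of q n s, symmetric] by (simp add: algebra_simps)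
  from hom_dim_ses[OF M this V2_tensor_module[OF V_module] Bm]
  have 1: "hom_dim M (H_tensor (V q 2 (- 1)) (V q n s)) = hom_dim M ?A + hom_dim M ?B" by simp
  have "ses (string_mod q (n - 1) (s - 1 + int 1) (1 - s - int n + int 1)) ?A (string_mod q 1 (s - 1) (1 - s - int n))"
    by (rule ses_string) (use n2 in \<open>simp_all add: beta_eq_0_iff\<close>)
  moreover have "string_mod q (n - 1) (s - 1 + int 1) (1 - s - int n + int 1) = V q (n - 1) s"
    using string_eq_V[of s "2 - s - int n" "n - 1"] n2 by (simp add: of_nat_diff algebra_simps)
  moreover have "string_mod q 1 (s - 1) (1 - s - int n) = V q 1 (s - 1)"
    by (rule string_eq_V) simp
  ultimately have "ses (V q (n - 1) s) ?A (V q 1 (s - 1))" by simp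
  from hom_dim_ses[OF M this Am V_module] n2
  have 2: "hom_dim M ?A = hom_dim M (V q (n - 1) s) + hom_dim M (V q 1 (s - 1))" by simp
  have "ses (string_mod q (n - (n - 1)) (s + int (n - 1)) (2 - s - int n + int (n - 1))) ?B (string_mod q (n - 1) s (2 - s - int n))"
    by (rule ses_string) (use n2 in \<open>simp_all add: beta_eq_0_iff of_nat_diff\<close>)
  \<comment> \<open>The last vector of the second Verma module has b-weight exponent s + n - 1, the
    same as s - 1 modulo n.\<close>
  moreover have "string_mod q (n - (n - 1)) (s + int (n - 1)) (2 - s - int n + int (n - 1)) = V q 1 (s - 1)"
  proof -
    have "string_mod q 1 (s + int (n - 1)) (2 - s - int n + int (n - 1)) = V q 1 (s + int (n - 1))"
      by (rule string_eq_V) (use n2 in \<open>simp add: of_nat_diff\<close>)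
    moreover have "V q 1 (s + int (n - 1)) = V q 1 (s - 1)"
      by (rule V_cong) (use n2 in \<open>simp add: of_nat_diff\<close>)
    ultimately show ?thesis using n2 by simp
  qed
  moreover have "string_mod q (n - 1) s (2 - s - int n) = V q (n - 1) s"
    by (rule string_eq_V) (use n2 in \<open>simp add: of_nat_diff\<close>)
  ultimately have "ses (V q 1 (s - 1)) ?B (V q (n - 1) s)" by simp
  from hom_dim_ses[OF M this Bm V_module] n2
  have 3: "hom_dim M ?B = hom_dim M (V q (n - 1) s) + hom_dim M (V q 1 (s - 1))" by simp
  show ?thesis unfolding hom_dim_adj[OF projective_wf[OF M] wf_V] 1 2 3 by simp
qed

lemma V2_tensor_projective:
  assumes "H_projective n q M"
  shows "H_projective n q (H_tensor (V q 2 0) M)"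
proof -
  interpret dual_pair "V q 1 0" "V q 2 0" "V q 2 (- 1)" "kron F2 F1 - inverse q \<cdot>\<^sub>m kron F1 F2"
    "kron E1 E2 - q \<cdot>\<^sub>m kron E2 E1" by (rule V2_dual)
  show ?thesis by (rule tensor_projective[OF assms V2_tensor_module[OF projective_module[OF assms]] V2_tensor_module])
qed

lemma V1_tensor_projective:
  assumes M: "H_projective n q M"
  shows "H_projective n q (H_tensor (V q 1 r) M)"
    and "hom_dim (H_tensor (V q 1 r) M) (V q m s) = hom_dim M (V q m (s - r))"
proof -
  interpret dual_pair "V q 1 0" "V q 1 r" "V q 1 (- r)" "1\<^sub>m 1" "1\<^sub>m 1" by (rule V1_dual)
  show "H_projective n q (H_tensor (V q 1 r) M)"
    by (rule tensor_projective[OF M V1_tensor_module[OF projective_module[OF M]] V1_tensor_module])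
  show "hom_dim (H_tensor (V q 1 r) M) (V q m s) = hom_dim M (V q m (s - r))"
    using hom_dim_adj[OF projective_wf[OF M] wf_V, of q m s] unfolding V1_tensor_V by simp
qed

text \<open>Serves tensor products with V(0, r), which start the induction on l, and empty direct
  sums.\<close>

lemma zero_projective:
  assumes w: "wf_hmod M" and z: "hdim M = 0"
  shows "H_projective n q M"
proof (rule projectiveI)
  have c: "act_a M \<in> carrier_mat 0 0" "act_b M \<in> carrier_mat 0 0" "act_c M \<in> carrier_mat 0 0" "act_d M \<in> carrier_mat 0 0"
    using w z by (simp_all add: wf_hmod_def all_gen)
  have eq: "A = B" if "A \<in> carrier_mat 0 0" "B \<in> carrier_mat 0 0" for A B :: "'k mat"
    using that by (intro eq_matI) auto
  show "H_module n q M"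
    unfolding H_module_def Let_def using c z by (auto intro!: eq)
  fix A N F R G
  assume A: "H_module n q A" and N: "H_module n q N" and F: "F \<in> H_hom A N" and G: "G \<in> H_hom M N"
  have "F * 0\<^sub>m (hdim A) 0 = G" using H_homD[OF F] H_homD[OF G] z by (intro eq_matI) simp_all
  then show "\<exists>L\<in>H_hom M A. F * L = G"
    using H_hom_zero[OF w H_module_wf[OF A]] z by (intro bexI[of _ "0\<^sub>m (hdim A) 0"]) simp_all
qed

text \<open>By associativity the middle term of the tensored sequence is V(2, 0) tensor (V(l, r)
  tensor N), whose multiplicities the recurrence gives. The sequence splits because its quotient
  term is projective by hypothesis, so V(l + 1, r) tensor N is a direct summand and hence
  projective.\<close>

lemma V_tensor_step:
  assumes l: "0 < l" "l < n" and N: "wf_hmod N"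
    and p: "H_projective n q (H_tensor (V q l r) N)" "H_projective n q (H_tensor (V q (l - 1) (r + 1)) N)"
  shows "H_projective n q (H_tensor (V q (Suc l) r) N)"
    and "hom_dim (H_tensor (V q (Suc l) r) N) (V q m s) + hom_dim (H_tensor (V q (l - 1) (r + 1)) N) (V q m s) =
      hom_dim (H_tensor (V q 2 0) (H_tensor (V q l r) N)) (V q m s)"
proof -
  have b: "beta q (r + (1 - r - int l)) l = 0" by (simp add: beta_eq_0_iff)
  have b': "beta q (r + (1 - r - int l) + 1) (l - 1) = 0" using l by (simp add: beta_eq_0_iff of_nat_diff)
  have A: "string_mod q (Suc l) (0 + r) (1 - r - int l - 1 - 0) = V q (Suc l) r"
    unfolding V_string by (simp add: algebra_simps)
  have B: "string_mod q (l - 1) (0 + 1 + r) (1 - r - int l - 0) = V q (l - 1) (r + 1)"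
    unfolding V_string using l by (simp add: of_nat_diff algebra_simps)
  have "ses (V q (Suc l) r) (H_tensor (V q 2 0) (V q l r)) (V q (l - 1) (r + 1))"
    using ses_V2_string[OF l(1) b, of "Suc l" "l - 1" 0] b' l unfolding A B V_string[of q l r, symmetric] by simp
  from ses_tensor[OF this N]
  have s: "ses (H_tensor (V q (Suc l) r) N) (H_tensor (V q 2 0) (H_tensor (V q l r) N)) (H_tensor (V q (l - 1) (r + 1)) N)"
    unfolding H_tensor_assoc[OF wf_V wf_V N] .
  have X: "H_projective n q (H_tensor (V q 2 0) (H_tensor (V q l r) N))" by (rule V2_tensor_projective[OF p(1)])
  have bp: "biprod (H_tensor (V q 2 0) (H_tensor (V q l r) N)) (H_tensor (V q (l - 1) (r + 1)) N) (H_tensor (V q (Suc l) r) N)"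
    by (rule ses_biprod[OF p(2) s projective_module[OF X]])
  show "H_projective n q (H_tensor (V q (Suc l) r) N)" by (rule projective_summand[OF X biprod_sym[OF bp]])
  show "hom_dim (H_tensor (V q (Suc l) r) N) (V q m s) + hom_dim (H_tensor (V q (l - 1) (r + 1)) N) (V q m s) =
      hom_dim (H_tensor (V q 2 0) (H_tensor (V q l r) N)) (V q m s)"
    using hom_dim_biprod[OF bp wf_V, of q m s] by simp
qed

section \<open>Multiplicities of formal projectives and their recurrence\<close>

definition mult_P :: "int \<Rightarrow> int \<Rightarrow> nat \<Rightarrow> int \<Rightarrow> int" where
  "mult_P a z m s = of_bool (0 < a \<and> int m = a \<and> int n dvd s - z)"

text \<open>The multiplicities of a formal projective P(j, z) with j ranging over all integers of absolute
  value less than n: tensoring with V(2, 0) sends it to P(j + 1, z) + P(j - 1, z + 1) throughout, so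
  that the decomposition for l > l' is obtained from the one for l \<le> l' by unfolding the nonpositive
  indices.\<close>

definition mult_Z :: "int \<Rightarrow> int \<Rightarrow> nat \<Rightarrow> int \<Rightarrow> int" where
  "mult_Z j z m s = (if 0 < j then mult_P j z m s else 2 * mult_P (int n + j) z m s - mult_P (- j) (z + j) m s)"

text \<open>For |j| >= 2 both sides use the same branch of \<open>mult_Z\<close> and agree term by
  term. At j = 0 the P(1, z) subtracted in \<open>mult_Z (- 1) (z + 1)\<close> cancels
  \<open>mult_Z 1 z\<close>; at j = 1 and j = -1 the index 0 counts as zero and P(n, .) is invisible
  for m < n.\<close>

lemma mult_Z_step_less:
  assumes j: "\<bar>j\<bar> \<le> int n - 2" and m: "0 < m" "m < n"
  shows "mult_Z j z (Suc m) (s - 1) + mult_Z j z (m - 1) s = mult_Z (j + 1) z m s + mult_Z (j - 1) (z + 1) m s"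
proof -
  have i: "int (Suc m) = int m + 1" "int (m - 1) = int m - 1" using m by (simp_all add: of_nat_diff)
  have e: "s - 1 - z = s - (z + 1)" "s - 1 - (z + j) = s - (z + (j + 1))" "z + 1 + (j - 1) = z + j"
    "int m + 1 = j \<longleftrightarrow> int m = j - 1" "int m - 1 = j \<longleftrightarrow> int m = j + 1"
    "int m + 1 = int n + j \<longleftrightarrow> int m = int n + (j - 1)" "int m - 1 = int n + j \<longleftrightarrow> int m = int n + (j + 1)"
    "int m + 1 = - j \<longleftrightarrow> int m = - (j + 1)" "int m - 1 = - j \<longleftrightarrow> int m = - (j - 1)" by linarith+
  note defs = mult_Z_def mult_P_def i e
  consider "2 \<le> j" | "j = 1" | "j = 0" | "j = - 1" | "j \<le> - 2" by linarith
  then show ?thesis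
  proof cases
    case 1
    then have "0 < j" "0 < j - 1" "0 < j + 1" by auto
    then show ?thesis unfolding defs by simp
  next
    case 2
    show ?thesis unfolding defs using m unfolding 2 by simp
  next
    case 3
    show ?thesis unfolding defs using m j unfolding 3 by simp
  next
    case 4
    show ?thesis unfolding defs using m j unfolding 4 by simp
  next
    case 5
    then have "\<not> 0 < j" "\<not> 0 < j - 1" "\<not> 0 < j + 1" "0 < int n + j" "0 < int n + (j + 1)"
      "0 < - j" "0 < - (j - 1)" "0 < - (j + 1)"
      using j by auto
    moreover have "(0 < int n + (j - 1) \<and> int m = int n + (j - 1) \<and> D) = (int m = int n + (j - 1) \<and> D)" for D
      using m by auto
    ultimately show ?thesis unfolding defs by simp
  qed
qed

text \<open>The bound on j excludes j = n - 1, where the left side would count P(n, z) twice and the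
  formal rule once.\<close>

lemma mult_Z_step_n:
  assumes "\<bar>j\<bar> \<le> int n - 2"
  shows "2 * mult_Z j z (n - 1) s + 2 * mult_Z j z 1 (s - 1) = mult_Z (j + 1) z n s + mult_Z (j - 1) (z + 1) n s"
proof -
  have i: "int (n - 1) = int n - 1" using n2 by (simp add: of_nat_diff)
  have e: "s - 1 - z = s - (z + 1)" "s - 1 - (z + j) = s - (z + (j + 1))" "z + 1 + (j - 1) = z + j" by simp_all
  show ?thesis
  proof (cases "j = - 1")
    \<comment> \<open>The only j for which both parts of \<open>mult_Z\<close> contribute on the
      left: 2P(n - 1, z) gives 4 and the subtracted P(1, z - 1) gives -2, which matches the 2 of
      \<open>mult_Z 0 z\<close>.\<close>
    case True
    show ?thesis unfolding mult_Z_def mult_P_def i e True using n2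
      by (cases "int n dvd s - z"; simp)
  next
    case False
    have "0 < int n + j" "0 < int n + (j + 1)" "\<not> int n = j" "int n \<noteq> j - 1" "int n \<noteq> - j" "int n \<noteq> - (j + 1)"
      "int n - 1 \<noteq> - j" "int n - 1 \<noteq> j" "int n \<noteq> j + 1" "int n \<noteq> - (j - 1)" using assms by auto
    then show ?thesis unfolding mult_Z_def mult_P_def i e using assms n2 False by auto
  qed
qed

text \<open>All terms are values of one sequence \<open>Y\<close>. The left side sums it over
  indices 0 to l and 1 to l - 1, the right side over 0 to l - 1 and 1 to l; only the term at l
  changes place.\<close>

lemma sum_mult_Z_step:
  fixes f :: "int \<Rightarrow> int \<Rightarrow> int"
  assumes "0 < l"
  shows "(\<Sum>i<Suc l. f (int (Suc l) + k - 1 - 2 * int i) (z + int i)) + (\<Sum>i<l - 1. f (int (l - 1) + k - 1 - 2 * int i) (z + 1 + int i)) =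
    (\<Sum>i<l. f (int l + k - 1 - 2 * int i + 1) (z + int i) + f (int l + k - 1 - 2 * int i - 1) (z + int i + 1))"
proof -
  define Y where "Y i = f (int l + k - 2 * int i) (z + int i)" for i
  obtain l0 where l0: "l = Suc l0" using assms by (cases l) auto
  have 1: "f (int (Suc l) + k - 1 - 2 * int i) (z + int i) = Y i" "f (int l + k - 1 - 2 * int i + 1) (z + int i) = Y i"
    "f (int (l - 1) + k - 1 - 2 * int i) (z + 1 + int i) = Y (Suc i)"
    "f (int l + k - 1 - 2 * int i - 1) (z + int i + 1) = Y (Suc i)" for i
    unfolding Y_def l0 by (simp_all add: algebra_simps)
  show ?thesis unfolding 1 by (simp add: sum.distrib l0)
qed

text \<open>Strong induction with \<open>r\<close> arbitrary, because the step reaches back to V(l -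
  1, r + 1) as well as V(l, r). The case m = 0 is included since the recurrence at m = 1 refers to
  V(0, s).\<close>

lemma V_tensor_mult:
  assumes P: "H_projective n q P" and l': "0 < l'" "l' < n"
    and h: "\<And>m s. 0 < m \<Longrightarrow> m \<le> n \<Longrightarrow> int (hom_dim P (V q m s)) = mult_P (int l') r' m s"
  shows "l + l' \<le> n \<Longrightarrow> H_projective n q (H_tensor (V q l r) P) \<and>
    (\<forall>m s. m \<le> n \<longrightarrow> int (hom_dim (H_tensor (V q l r) P) (V q m s)) =
      (\<Sum>i<l. mult_Z (int l + int l' - 1 - 2 * int i) (r + r' + int i) m s))"
proof (induction l arbitrary: r rule: less_induct)
  case (less l)
  note wP = projective_wf[OF P]
  have Z0: "mult_Z j z 0 s = 0" for j z s by (simp add: mult_Z_def mult_P_def)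
  have hd0: "hom_dim M (V q 0 s) = 0" if "wf_hmod M" for M s
    by (rule hom_dim_empty) (simp_all add: that wf_V)
  consider "l = 0" | "l = 1" | k where "l = Suc k" "0 < k" by (metis One_nat_def not0_implies_Suc neq0_conv)
  then show ?case
  proof cases
    case 1
    have "hom_dim (H_tensor (V q 0 r) P) (V q m s) = 0" for m s
      by (rule hom_dim_empty) (simp_all add: wf_V wP wf_tensor)
    moreover have "H_projective n q (H_tensor (V q 0 r) P)"
      by (rule zero_projective) (simp_all add: wf_tensor wf_V wP)
    ultimately show ?thesis using 1 by simp
  next
    case 2
    have "int (hom_dim (H_tensor (V q 1 r) P) (V q m s)) = mult_Z (int l') (r + r') m s" if "m \<le> n" for m s
    proof (cases "m = 0")
      case True
      then show ?thesis using hd0[OF wf_tensor[OF wf_V wP]] Z0 by simp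
    next
      case False
      have e: "s - r - r' = s - (r + r')" by simp
      show ?thesis unfolding V1_tensor_projective(2)[OF P] using h[of m "s - r"] False that l'
        by (simp add: mult_Z_def mult_P_def e)
    qed
    then show ?thesis using V1_tensor_projective(1)[OF P, of r] unfolding 2 by simp
  next
    case 3
    let ?R = "r + r'"
    have k: "0 < k" "k < n" using 3 less.prems l' by auto
    have IH1: "H_projective n q (H_tensor (V q k r) P)"
      "\<And>m s. m \<le> n \<Longrightarrow> int (hom_dim (H_tensor (V q k r) P) (V q m s)) =
        (\<Sum>i<k. mult_Z (int k + int l' - 1 - 2 * int i) (?R + int i) m s)"
      using less.IH[of k r] 3 less.prems by auto
    have IH2: "H_projective n q (H_tensor (V q (k - 1) (r + 1)) P)"
      "\<And>m s. m \<le> n \<Longrightarrow> int (hom_dim (H_tensor (V q (k - 1) (r + 1)) P) (V q m s)) =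
        (\<Sum>i<k - 1. mult_Z (int (k - 1) + int l' - 1 - 2 * int i) (?R + 1 + int i) m s)"
      using less.IH[of "k - 1" "r + 1"] 3 less.prems by (auto simp: algebra_simps)
    note step = V_tensor_step[OF k wP IH1(1) IH2(1)]
    have "int (hom_dim (H_tensor (V q (Suc k) r) P) (V q m s)) =
      (\<Sum>i<Suc k. mult_Z (int (Suc k) + int l' - 1 - 2 * int i) (?R + int i) m s)" if m: "m \<le> n" for m s
    proof (cases "m = 0")
      case True
      then show ?thesis using hd0[OF wf_tensor[OF wf_V wP]] Z0 by simp
    next
      case m0: False
      let ?j = "\<lambda>i. int k + int l' - 1 - 2 * int i"
      \<comment> \<open>This uses l + l' <= n: with l = k + 1 the largest formal index k + l' - 1 is
        at most n - 2.\<close>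
      have j: "\<bar>?j i\<bar> \<le> int n - 2" if "i < k" for i using that 3 less.prems l' by auto
      have "int (hom_dim (H_tensor (V q 2 0) (H_tensor (V q k r) P)) (V q m s)) =
        (\<Sum>i<k. mult_Z (?j i + 1) (?R + int i) m s + mult_Z (?j i - 1) (?R + int i + 1) m s)"
      proof (cases "m = n")
        case True
        have "int (hom_dim (H_tensor (V q 2 0) (H_tensor (V q k r) P)) (V q n s)) =
          (\<Sum>i<k. 2 * mult_Z (?j i) (?R + int i) (n - 1) s + 2 * mult_Z (?j i) (?R + int i) 1 (s - 1))"
          unfolding hom_dim_V2_tensor_n[OF IH1(1)] using IH1(2)[of "n - 1" s] IH1(2)[of 1 "s - 1"] n2
          by (simp add: sum.distrib sum_distrib_left)
        also have "\<dots> = (\<Sum>i<k. mult_Z (?j i + 1) (?R + int i) n s + mult_Z (?j i - 1) (?R + int i + 1) n s)"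
          by (intro sum.cong refl mult_Z_step_n j) simp
        finally show ?thesis using True by simp
      next
        case False
        then have mn: "0 < m" "m < n" using m m0 by auto
        have "int (hom_dim (H_tensor (V q 2 0) (H_tensor (V q k r) P)) (V q m s)) =
          (\<Sum>i<k. mult_Z (?j i) (?R + int i) (Suc m) (s - 1) + mult_Z (?j i) (?R + int i) (m - 1) s)"
          unfolding hom_dim_V2_tensor_less[OF IH1(1) mn] using IH1(2)[of "Suc m" "s - 1"] IH1(2)[of "m - 1" s] mn
          by (simp add: sum.distrib)
        also have "\<dots> = (\<Sum>i<k. mult_Z (?j i + 1) (?R + int i) m s + mult_Z (?j i - 1) (?R + int i + 1) m s)"
          by (intro sum.cong refl mult_Z_step_less j mn) simp
        finally show ?thesis .
      qed
      then have "int (hom_dim (H_tensor (V q (Suc k) r) P) (V q m s)) +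
          (\<Sum>i<k - 1. mult_Z (int (k - 1) + int l' - 1 - 2 * int i) (?R + 1 + int i) m s) =
        (\<Sum>i<k. mult_Z (?j i + 1) (?R + int i) m s + mult_Z (?j i - 1) (?R + int i + 1) m s)"
        using step(2)[of m s] IH2(2)[OF m, of s] by simp
      then show ?thesis
        using sum_mult_Z_step[OF k(1), of "\<lambda>j z. mult_Z j z m s" "int l'" ?R] by linarith
    qed
    then show ?thesis using step(1) 3(1) by simp
  qed
qed

text \<open>From i = (l + l') div 2 on the formal index is nonpositive. Its subtracted part is the
  positive term with index reflected by i -> l + l' - 1 - i, so for l > l' the subtractions remove
  the positive terms from l' on and leave min l l' of them.\<close>

lemma mult_Z_sum:
  assumes "0 < l" "0 < l'"
  shows "(\<Sum>i<l. mult_Z (int l + int l' - 1 - 2 * int i) (z + int i) m s) =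
    (\<Sum>i<min l l'. mult_P (int l + int l' - 1 - 2 * int i) (z + int i) m s) +
    (\<Sum>i = (l + l') div 2..<l. 2 * mult_P (int n + int l + int l' - 1 - 2 * int i) (z + int i) m s)"
proof -
  define h where "h = (l + l') div 2"
  define Y where "Y i = mult_P (int l + int l' - 1 - 2 * int i) (z + int i) m s" for i
  define Q where "Q i = 2 * mult_P (int n + int l + int l' - 1 - 2 * int i) (z + int i) m s" for i
  define Z where "Z i = mult_Z (int l + int l' - 1 - 2 * int i) (z + int i) m s" for i
  have Y0: "Y i = 0" if "h \<le> i" for i
  proof -
    have "int l + int l' - 1 - 2 * int i \<le> 0" using that unfolding h_def by linarith
    then show ?thesis by (simp add: Y_def mult_P_def)
  qed
  have Z1: "Z i = Y i" if "i < h" for i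
  proof -
    have "0 < int l + int l' - 1 - 2 * int i" using that unfolding h_def by linarith
    then show ?thesis by (simp add: Y_def Z_def mult_Z_def)
  qed
  have Z2: "Z i = Q i - Y (l + l' - 1 - i)" if "h \<le> i" "i < l" for i
  proof -
    have "\<not> 0 < int l + int l' - 1 - 2 * int i" using that unfolding h_def by linarith
    moreover have "int (l + l' - 1 - i) = int l + int l' - 1 - int i" using that assms by (simp add: of_nat_diff)
    ultimately show ?thesis by (simp add: Y_def Z_def Q_def mult_Z_def algebra_simps)
  qed
  have "(\<Sum>i<l. Z i) = (\<Sum>i<min l l'. Y i) + (\<Sum>i = h..<l. Q i)"
  proof (cases "l \<le> l'")
    case True
    then have "l \<le> h" unfolding h_def by linarith
    then show ?thesis using True Z1 by (simp add: min_def)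
  next
    case False
    then have lh: "l' \<le> h" "h \<le> l" unfolding h_def by linarith+
    have "(\<Sum>i<l. Z i) = (\<Sum>i<h. Z i) + (\<Sum>i = h..<l. Z i)"
      using lh by (simp add: lessThan_atLeast0 sum.atLeastLessThan_concat)
    also have "\<dots> = (\<Sum>i<h. Y i) + ((\<Sum>i = h..<l. Q i) - (\<Sum>i = h..<l. Y (l + l' - 1 - i)))"
      using Z1 Z2 by (simp add: sum_subtractf)
    also have "(\<Sum>i = h..<l. Y (l + l' - 1 - i)) = (\<Sum>i = l'..<l + l' - h. Y i)"
      by (rule sum.reindex_bij_witness[where i = "\<lambda>i. l + l' - 1 - i" and j = "\<lambda>i. l + l' - 1 - i"]) (use lh in auto)
    \<comment> \<open>The upper bound l + l' - h is h or h + 1. In the second case the extra term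
      has formal index 0 and vanishes.\<close>
    also have "\<dots> = (\<Sum>i = l'..<h. Y i)"
    proof (rule sum.mono_neutral_right)
      show "{l'..<h} \<subseteq> {l'..<l + l' - h}" unfolding h_def by auto
    qed (use Y0 in auto)
    also have "(\<Sum>i<h. Y i) = (\<Sum>i<l'. Y i) + (\<Sum>i = l'..<h. Y i)"
      using lh by (simp add: lessThan_atLeast0 sum.atLeastLessThan_concat)
    finally show ?thesis using False by (simp add: min_def)
  qed
  then show ?thesis unfolding Y_def Z_def Q_def h_def .
qed

section \<open>Direct sums of covers and the comparison of multiplicities\<close>

lemma H_dsum_Nil: "hdim (H_dsum []) = 0"
  by (simp add: H_dsum_def)

lemma hom_dim_H_dsum:
  fixes X :: "'k hmod"
  assumes "wf_hmod X" "\<And>M. M \<in> set Ms \<Longrightarrow> wf_hmod M"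
  shows "hom_dim (H_dsum Ms) X = (\<Sum>M\<leftarrow>Ms. hom_dim M X)"
  using assms(2)
proof (induction Ms)
  case Nil
  have "hom_dim (H_dsum []) X = 0"
    using assms(1) by (intro hom_dim_empty wf_H_dsum) (simp_all add: H_dsum_Nil)
  then show ?case by simp
next
  case (Cons M Ms)
  then show ?case using hom_dim_biprod[OF biprod_H_dsum_Cons[of M Ms] assms(1)] by simp
qed

lemma projective_H_dsum:
  assumes "\<And>M. M \<in> set Ms \<Longrightarrow> H_projective n q M"
  shows "H_projective n q (H_dsum Ms)"
  using assms
proof (induction Ms)
  case Nil
  show ?case by (rule zero_projective[OF wf_H_dsum H_dsum_Nil]) simp
next
  case (Cons M Ms)
  have "biprod (H_dsum (M # Ms)) M (H_dsum Ms)"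
    by (rule biprod_H_dsum_Cons) (use Cons.prems projective_wf in auto)
  moreover have "H_projective n q M" "H_projective n q (H_dsum Ms)"
    by (simp_all add: Cons)
  ultimately show ?case by (metis projective_biprod)
qed

lemma hom_dim_cover:
  assumes "H_projective_cover n q P (V q a z)" "0 < a" "a \<le> n" "0 < m" "m \<le> n"
  shows "int (hom_dim P (V q m s)) = mult_P (int a) z m s"
  unfolding cover_hom_dim[OF assms(1,3,5)] hom_dim_V_V[OF assms(2-5)] mult_P_def
  using assms(2) by (auto simp: dvd_diff_commute)

end

text \<open>The lower summation bound is the first i for which l + l' - 1 - 2i is not
  positive.\<close>

lemma nat_half_up: "0 < l \<Longrightarrow> nat (half_up (int l + int l' - 1)) = (l + l') div 2"
proof -
  assume "0 < l"
  have "half_up (int l + int l' - 1) = \<lfloor>real_of_int (int l + int l') / real_of_int 2\<rfloor>"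
    by (simp add: half_up_def)
  also have "\<dots> = (int l + int l') div 2" by (rule floor_divide_of_int_eq)
  finally show ?thesis by simp
qed

theorem theorem3p3:
  fixes q :: "'k::alg_closed_field"
    and n l l' l\<^sub>1 :: nat
    and r r' :: int
    and P :: "nat \<Rightarrow> int \<Rightarrow> 'k hmod"
  assumes "n > 2"
    and "primitive_root_of_unity n q"
    and "\<And>m s. 1 \<le> m \<Longrightarrow> m < n \<Longrightarrow> H_projective_cover n q (P m s) (V q m s)"
    and "\<And>s. P n s = V q n s"
    and "1 \<le> l" and "l < n"
    and "1 \<le> l'" and "l' < n"
    and "l + l' \<le> n"
    and "l\<^sub>1 = min l l'"
  shows "H_iso n q (H_tensor (V q l r) (P l' r'))
     (H_dsum
       [H_dsum (map (\<lambda>i. P (l + l' - 1 - 2 * i) (r + r' + int i)) [0..<l\<^sub>1]),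
        H_dsum (map (\<lambda>i. H_copies 2 (P (n + l + l' - 1 - 2 * i) (r + r' + int i)))
                 [nat (half_up (int l + int l' - 1))..<l])])"
    (is "H_iso n q ?M (H_dsum [H_dsum ?As, H_dsum ?Bs])")
proof -
  interpret root_of_unity n q using assms(1,2) by unfold_locales
  \<comment> \<open>V(n, s) is its own cover, so \<open>P\<close> is a family of covers for all
    simple modules, including m = n.\<close>
  have cover: "H_projective_cover n q (P m s) (V q m s)" if "0 < m" "m \<le> n" for m s
    using assms(3)[of m s] assms(4)[of s] V_n_cover[of s] that by (cases "m = n") auto
  have proj: "H_projective n q (P m s)" if "0 < m" "m \<le> n" for m s
    using cover[OF that, of s] by (simp add: H_projective_cover_def)
  have l: "0 < l" "0 < l'" "l' \<le> n" "0 < l'" using assms by auto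
  note h = hom_dim_cover[OF cover]
  have half: "nat (half_up (int l + int l' - 1)) = (l + l') div 2" by (rule nat_half_up[OF l(1)])
  \<comment> \<open>In both index ranges the subtractions of natural numbers do not truncate, and
    the first arguments of \<open>P\<close> lie between 1 and n.\<close>
  have A: "0 < l + l' - 1 - 2 * i \<and> l + l' - 1 - 2 * i \<le> n \<and> int (l + l' - 1 - 2 * i) = int l + int l' - 1 - 2 * int i"
    if "i < min l l'" for i
    using that assms(9) by auto
  have B: "0 < n + l + l' - 1 - 2 * i \<and> n + l + l' - 1 - 2 * i \<le> n \<and> int (n + l + l' - 1 - 2 * i) = int n + int l + int l' - 1 - 2 * int i"
    if "(l + l') div 2 \<le> i" "i < l" for i
    using that assms(6-9) by auto
  have projA: "H_projective n q X" if "X \<in> set ?As" for X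
    using that A proj assms(10) by auto
  have projB: "H_projective n q X" if "X \<in> set ?Bs" for X
  proof -
    obtain i where i: "(l + l') div 2 \<le> i" "i < l" "X = H_copies 2 (P (n + l + l' - 1 - 2 * i) (r + r' + int i))"
      using \<open>X \<in> set ?Bs\<close> unfolding half by auto
    show ?thesis unfolding i(3)
      by (rule projective_H_dsum) (use B[OF i(1,2)] proj in auto)
  qed
  have AB: "H_projective n q (H_dsum ?As)" "H_projective n q (H_dsum ?Bs)"
    using projA projB by (iprover intro: projective_H_dsum)+
  have "H_projective n q (H_dsum [A, B])" if "H_projective n q A" "H_projective n q B" for A B
    by (rule projective_H_dsum) (use that in auto)
  from this[OF AB] have projQ: "H_projective n q (H_dsum [H_dsum ?As, H_dsum ?Bs])" .
  have M: "H_projective n q ?M"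
    "\<And>m s. m \<le> n \<Longrightarrow> int (hom_dim ?M (V q m s)) =
      (\<Sum>i<l. mult_Z (int l + int l' - 1 - 2 * int i) (r + r' + int i) m s)"
    using V_tensor_mult[OF proj[OF l(2,3)] l(2) assms(8) h[OF l(2,3) l(2,3)] assms(9), of r r'] by auto
  show ?thesis
  proof (rule projective_iso[OF cover M(1) projQ])
    fix m s assume m: "0 < m" "m \<le> n"
    have hA: "int (hom_dim (H_dsum ?As) (V q m s)) =
      (\<Sum>i<min l l'. mult_P (int l + int l' - 1 - 2 * int i) (r + r' + int i) m s)"
    proof -
      have "int (hom_dim (H_dsum ?As) (V q m s)) = (\<Sum>i<min l l'. int (hom_dim (P (l + l' - 1 - 2 * i) (r + r' + int i)) (V q m s)))"
        by (subst hom_dim_H_dsum[OF wf_V projective_wf[OF projA]], assumption)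
          (simp add: sum_list_distinct_conv_sum_set assms(10) lessThan_atLeast0 o_def)
      also have "\<dots> = (\<Sum>i<min l l'. mult_P (int l + int l' - 1 - 2 * int i) (r + r' + int i) m s)"
        by (intro sum.cong refl) (metis A h m lessThan_iff)
      finally show ?thesis .
    qed
    have hB: "int (hom_dim (H_dsum ?Bs) (V q m s)) =
      (\<Sum>i = (l + l') div 2..<l. 2 * mult_P (int n + int l + int l' - 1 - 2 * int i) (r + r' + int i) m s)"
    proof -
      have two: "int (hom_dim (H_copies 2 (P (n + l + l' - 1 - 2 * i) (r + r' + int i))) (V q m s)) =
        2 * mult_P (int n + int l + int l' - 1 - 2 * int i) (r + r' + int i) m s"
        if i: "(l + l') div 2 \<le> i" "i < l" for i
      proof -
        have "hom_dim (H_copies 2 (P (n + l + l' - 1 - 2 * i) (r + r' + int i))) (V q m s) =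
          2 * hom_dim (P (n + l + l' - 1 - 2 * i) (r + r' + int i)) (V q m s)"
          using B[OF i] projective_wf[OF proj]
          by (subst hom_dim_H_dsum[OF wf_V]) (auto simp: sum_list_replicate)
        then show ?thesis
          using h[of "n + l + l' - 1 - 2 * i" m "r + r' + int i" s] B[OF i] m by (simp only: of_nat_mult of_nat_numeral)
      qed
      have "int (hom_dim (H_dsum ?Bs) (V q m s)) =
        (\<Sum>i = (l + l') div 2..<l. int (hom_dim (H_copies 2 (P (n + l + l' - 1 - 2 * i) (r + r' + int i))) (V q m s)))"
        by (subst hom_dim_H_dsum[OF wf_V projective_wf[OF projB]], assumption)
          (simp add: sum_list_distinct_conv_sum_set half o_def)
      also have "\<dots> = (\<Sum>i = (l + l') div 2..<l. 2 * mult_P (int n + int l + int l' - 1 - 2 * int i) (r + r' + int i) m s)"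
        by (intro sum.cong refl two) auto
      finally show ?thesis .
    qed
    have "hom_dim (H_dsum [H_dsum ?As, H_dsum ?Bs]) (V q m s) = hom_dim (H_dsum ?As) (V q m s) + hom_dim (H_dsum ?Bs) (V q m s)"
    proof -
      have "hom_dim (H_dsum [A, B]) (V q m s) = hom_dim A (V q m s) + hom_dim B (V q m s)"
        if "wf_hmod A" "wf_hmod B" for A B
        by (subst hom_dim_H_dsum[OF wf_V]) (use that in auto)
      from this[OF AB[THEN projective_wf]] show ?thesis .
    qed
    then have "int (hom_dim (H_dsum [H_dsum ?As, H_dsum ?Bs]) (V q m s)) = int (hom_dim ?M (V q m s))"
      using hA hB M(2)[OF m(2), of s] mult_Z_sum[OF l(1,2), of "r + r'" m s] by (simp only: of_nat_add)
    then show "hom_dim ?M (V q m s) = hom_dim (H_dsum [H_dsum ?As, H_dsum ?Bs]) (V q m s)" by linarith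
  qed
qed

end
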